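(* Let $\mathcal{C}$ be a groupoidant 2-category, let $X,X^{\mathrm{op}}\in\mathcal{C}$, and let $(C,\gamma,\gamma_{01},\gamma^{\mathrm{op}},\gamma^{\mathrm{op}}_{01})$ be an opposition between $X$ and $X^{\mathrm{op}}$. Then for any groupoid $A\in\mathcal{C}$, the operation $(-)^{\mathrm{op}}$ on morphisms $A\to X$ and on 2-cells between them defines an isomorphism of categories $(-)^{\mathrm{op}}:\mathcal{C}(A,X)^{\mathrm{op}}\to\mathcal{C}(A,X^{\mathrm{op}})$. Moreover, these isomorphisms determine a strict natural isomorphism between the 2-functor $\mathcal{C}(-,X^{\mathrm{op}}):(\mathcal{C}_{\mathrm{gpd}})^{\mathrm{op}}\to\mathbf{Cat}$ and the 2-functor $$(\mathcal{C}_{\mathrm{gpd}})^{\mathrm{op}}\xrightarrow{\ \mathrm{inv}\ }(\mathcal{C}_{\mathrm{gpd}})^{\mathrm{coop}}\xrightarrow{\ \mathcal{C}(-,X)^{\mathrm{co}}\ }\mathbf{Cat}^{\mathrm{co}}\xrightarrow{\ \mathrm{op}\ }\mathbf{Cat},$$ where $\mathrm{inv}$ acts by the identity on objects and 1-cells and by inversion on 2-cells. The existence of this natural isomorphism determines $X^{\mathrm{op}}$ uniquely up to isomorphism.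
   Context: Conventions. 2-categories are strict. Composition is in diagrammatic order: $fg$ means first $f$, then $g$ (also for functors and whiskerings). $|\mathcal{C}|$ is the underlying 1-category of $\mathcal{C}$. For $f:X\to Y$, $f_*:\mathcal{C}(A,X)\to\mathcal{C}(A,Y)$ is composition with $f$. $\mathcal{C}_{\mathrm{gpd}}$ is the full sub-2-category of $\mathcal{C}$ on the groupoids. $(-)^{\mathrm{co}}$ reverses 2-cells, $(-)^{\mathrm{op}}$ of a 2-category reverses 1-cells, $(-)^{\mathrm{coop}}$ reverses both. $[k]$ is the linear order $\{0<\dots<k\}$ viewed as a category, and $\delta_{a_0\dots a_k}:[k]\to[l]$ is the functor $j\mapsto a_j$. Limits. A functor $F$ is an isofibration if every isomorphism $Fx\to b$ lifts to an isomorphism with domain $x$; it is a discrete opfibration (DOF) if every morphism $Fx\to b$ has a unique lift with domain $x$. A morphism $f$ of $\mathcal{C}$ is an isofibration (resp. DOF) if $f_*:\mathcal{C}(A,X)\to\mathcal{C}(A,Y)$ is one for all $A$. A commutative square with vertex $P$ over a cospan $X\to Z\leftarrow Y$ is a strict pullback if $\mathcal{C}(B,P)\to\mathcal{C}(B,X)\times_{\mathcal{C}(B,Z)}\mathcal{C}(B,Y)$ is an isomorphism of categories for all $B$. A strict terminal object has all $\mathcal{C}(A,\mathbf 1)$ equal to the one-morphism category. A strict cotensor of $X$ with a category $J$ is an object $X^J$ with a functor $\mathrm{ev}:J\to\mathcal{C}(X^J,X)$ inducing isomorphisms of categories $\mathcal{C}(A,X^J)\cong\mathrm{Fun}(J,\mathcal{C}(A,X))$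 for all $A$; functors $J\to J'$ induce $X^{J'}\to X^J$. The arrow object is $X^\to=X^{[1]}$, with universal 2-cell $\partial:\partial_0\Rightarrow\partial_1:X^\to\to X$. $\mathcal{C}$ is pita if it has a strict terminal object, strict arrow objects, and strict pullbacks of isofibrations along arbitrary morphisms (it then has cotensors with finite categories). Groupoids and cores. $X$ is a groupoid if every $\mathcal{C}(A,X)$ is a groupoid. $f:A\to X$ is an arrow-wise iso if $\alpha f$ is invertible for every 2-cell $\alpha$ between morphisms into $A$. A core of $X$ is an object $X^{\mathrm{iso}}$ with an arrow-wise iso $i:X^{\mathrm{iso}}\to X$ such that for all $A$, $i_*$ is an isomorphism from $\mathcal{C}(A,X^{\mathrm{iso}})$ onto the subcategory of $\mathcal{C}(A,X)$ of arrow-wise isos and invertible 2-cells. Any $f:X\to Y$ induces $f^{\mathrm{iso}}:X^{\mathrm{iso}}\to Y^{\mathrm{iso}}$ with $f^{\mathrm{iso}}i=if$. Congruences. An internal category $C$ in a 1-category has objects $C_0,C_1,C_2$ and morphisms $\pi_0,\pi_1:C_1\to C_0$ (source, target), $e:C_0\to C_1$ (identities), $\pi_{01},\pi_{12},\pi_{02}:C_2\to C_1$ (first arrow, second arrow, composite), with $C_2=C_1\times_{C_0}C_1$ via $\pi_{01}\pi_1=\pi_{12}\pi_0$, satisfying the usual axioms. $C_3=C_2\times_{C_1}C_2$ (along $\pi_{12},\pi_{01}$) is the object of composable triples; $\langle a,b,c\rangle:A\to C_3$ is the morphism with consecutive components $a,b,c:A\to C_1$, and $\pi_{02},\pi_{13}:C_3\to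 C_1$ give the composite of the first two, resp. last two, arrows. In a pita 2-category $\mathcal{C}$, an internal double category is an internal category in $|\mathcal{C}|$ with $\langle\pi_0,\pi_1\rangle:C_1\to C_0\times C_0$ an isofibration. It is a gbo-congruence if $C_0,C_1,C_2$ are groupoids and $\langle\pi_0,\pi_1\rangle$ is a DOF. Then there is a unique $r:C_0^\to\to C_1$ (the reflection morphism) for which there exists a 2-cell $\bar\rho:r\Rightarrow\partial_1e$ with $\bar\rho\langle\pi_0,\pi_1\rangle=\langle\partial,\mathrm{id}_{\partial_1}\rangle$. Let $\tau:C_0^\to\to C_0^\to$ be the morphism with $\tau\partial=\partial^{-1}$. A gbo-congruence $C$ is complete (a complete congruence) if the square with top $\langle r,\tau r,r\rangle:C_0^\to\to C_3$, left $\langle\partial_0,\partial_1\rangle:C_0^\to\to C_0\times C_0$, right $\langle\pi_{02},\pi_{13}\rangle:C_3\to C_1\times C_1$ and bottom $e\times e$ is a strict pullback. Nerves and quotients. A nerve $\mathrm{Nv}(X)$ of $X$ is the internal double category with objects $X^{\mathrm{iso}},(X^\to)^{\mathrm{iso}},(X^{[2]})^{\mathrm{iso}}$ (for some choice of cores and cotensors) and structure maps $\pi_{jk}=(X^{\delta_{jk}})^{\mathrm{iso}}$, $\pi_j=(X^{\delta_j})^{\mathrm{iso}}=\partial_j^{\mathrm{iso}}$, $e=(X^{\delta_{00}})^{\mathrm{iso}}$. A cocone under $C$ with vertex $Y$ is a morphism $\gamma:C_0\to Y$ and a 2-cell $\gamma_{01}:\pi_0\gamma\Rightarrow\pi_1\gamma$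 with $e\gamma_{01}=\mathrm{id}_\gamma$ and $\pi_{02}\gamma_{01}=(\pi_{01}\gamma_{01})(\pi_{12}\gamma_{01})$; a morphism $(\gamma,\gamma_{01})\to(\gamma',\gamma'_{01})$ is a 2-cell $\alpha:\gamma\Rightarrow\gamma'$ with $(\pi_0\alpha)\gamma'_{01}=\gamma_{01}(\pi_1\alpha)$. A cocone with vertex $X$ is a strict quotient of $C$ if the induced functor $\mathcal{C}(X,Y)\to\mathrm{Cocone}(C,Y)$ is an isomorphism for all $Y$. The tautological cocone under $\mathrm{Nv}(X)$ is $\gamma=i:X^{\mathrm{iso}}\to X$, $\gamma_{01}=i\partial$ (with $i:(X^\to)^{\mathrm{iso}}\to X^\to$). $\mathcal{C}$ is groupoidant if: it is pita; every object has a core; every complete congruence is a nerve (of some object); and the tautological cocone under any nerve is a strict quotient. Opposites. The opposite $C^{\mathrm{op}}$ of an internal double category $C$ is obtained by exchanging $\pi_0$ with $\pi_1$ and $\pi_{01}$ with $\pi_{12}$. An opposition between $X$ and $X^{\mathrm{op}}$ is a complete congruence $C$ with a quotient cocone $(X,\gamma:C_0\to X,\gamma_{01}:\pi_0\gamma\Rightarrow\pi_1\gamma)$ of $C$ and a quotient cocone $(X^{\mathrm{op}},\gamma^{\mathrm{op}}:C_0\to X^{\mathrm{op}},\gamma^{\mathrm{op}}_{01}:\pi_1\gamma^{\mathrm{op}}\Rightarrow\pi_0\gamma^{\mathrm{op}})$ of $C^{\mathrm{op}}$. If $\mathcal{C}$ is groupoidant, $C$ with $(\gamma,\gamma_{01})$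 is then a nerve of $X$ with its tautological cocone. For a groupoid $A$ and $f:A\to X$, let $f^{\mathrm{iso}}:A\to C_0$ be the unique morphism with $f^{\mathrm{iso}}\gamma=f$, and put $f^{\mathrm{op}}=f^{\mathrm{iso}}\gamma^{\mathrm{op}}:A\to X^{\mathrm{op}}$. For a 2-cell $\alpha:f\Rightarrow g:A\to X$, let $a:A\to C_1$ be the unique morphism with $a\gamma_{01}=\alpha$, and put $\alpha^{\mathrm{op}}=a\gamma^{\mathrm{op}}_{01}:g^{\mathrm{op}}\Rightarrow f^{\mathrm{op}}$. *)

theory Defs
  imports Main "HOL-Library.FuncSet"
begin

text \<open>All compositions are written in diagrammatic order.\<close>


section \<open>Categories and functors\<close>

record ('a, 'b) cat =
  Ob :: "'a set"
  Ar :: "'b set"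
  src :: "'b \<Rightarrow> 'a"
  tgt :: "'b \<Rightarrow> 'a"
  ident :: "'a \<Rightarrow> 'b"
  comp :: "'b \<Rightarrow> 'b \<Rightarrow> 'b"  (infixl "\<cdot>\<index>" 70)

definition hom :: "('a, 'b) cat \<Rightarrow> 'a \<Rightarrow> 'a \<Rightarrow> 'b set" where
  "hom D x y = {f \<in> Ar D. src D f = x \<and> tgt D f = y}"

definition category :: "('a, 'b) cat \<Rightarrow> bool" where
  "category D \<longleftrightarrow>
     (\<forall>f\<in>Ar D. src D f \<in> Ob D \<and> tgt D f \<in> Ob D) \<and>
     (\<forall>x\<in>Ob D. ident D x \<in> hom D x x) \<and>
     (\<forall>f\<in>Ar D. \<forall>g\<in>Ar D. tgt D f = src D g \<longrightarrow> f \<cdot>\<^bsub>D\<^esub> g \<in> hom D (src D f) (tgt D g)) \<and>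
     (\<forall>f\<in>Ar D. ident D (src D f) \<cdot>\<^bsub>D\<^esub> f = f \<and> f \<cdot>\<^bsub>D\<^esub> ident D (tgt D f) = f) \<and>
     (\<forall>f\<in>Ar D. \<forall>g\<in>Ar D. \<forall>h\<in>Ar D. tgt D f = src D g \<and> tgt D g = src D h \<longrightarrow>
        (f \<cdot>\<^bsub>D\<^esub> g) \<cdot>\<^bsub>D\<^esub> h = f \<cdot>\<^bsub>D\<^esub> (g \<cdot>\<^bsub>D\<^esub> h))"

definition inverse_arrows :: "('a, 'b) cat \<Rightarrow> 'b \<Rightarrow> 'b \<Rightarrow> bool" where
  "inverse_arrows D f g \<longleftrightarrow>
     f \<in> Ar D \<and> g \<in> hom D (tgt D f) (src D f) \<and>
     f \<cdot>\<^bsub>D\<^esub> g = ident D (src D f) \<and> g \<cdot>\<^bsub>D\<^esub> f = ident D (tgt D f)"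

definition invertible :: "('a, 'b) cat \<Rightarrow> 'b \<Rightarrow> bool" where
  "invertible D f \<longleftrightarrow> (\<exists>g. inverse_arrows D f g)"

definition is_groupoid :: "('a, 'b) cat \<Rightarrow> bool" where
  "is_groupoid D \<longleftrightarrow> category D \<and> (\<forall>f\<in>Ar D. invertible D f)"

definition op_cat :: "('a, 'b) cat \<Rightarrow> ('a, 'b) cat" where
  "op_cat D = \<lparr>Ob = Ob D, Ar = Ar D, src = tgt D, tgt = src D, ident = ident D,
               comp = (\<lambda>f g. g \<cdot>\<^bsub>D\<^esub> f)\<rparr>"

text \<open>The linear order \<open>{0 < \<dots> < k}\<close> as a category.\<close>

definition ord_cat :: "nat \<Rightarrow> (nat, nat \<times> nat) cat" where
  "ord_cat k = \<lparr>Ob = {0..k}, Ar = {(i, j). i \<le> j \<and> j \<le> k}, src = fst, tgt = snd,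
                ident = (\<lambda>i. (i, i)), comp = (\<lambda>a b. (fst a, snd b))\<rparr>"

type_synonym ('a, 'b, 'c, 'd) functor_data = "('a \<Rightarrow> 'c) \<times> ('b \<Rightarrow> 'd)"

definition is_functor ::
  "('a, 'b) cat \<Rightarrow> ('c, 'd) cat \<Rightarrow> ('a, 'b, 'c, 'd) functor_data \<Rightarrow> bool" where
  "is_functor D E F \<longleftrightarrow>
     (\<forall>x\<in>Ob D. fst F x \<in> Ob E) \<and>
     (\<forall>f\<in>Ar D. snd F f \<in> hom E (fst F (src D f)) (fst F (tgt D f))) \<and>
     (\<forall>x\<in>Ob D. snd F (ident D x) = ident E (fst F x)) \<and>
     (\<forall>f\<in>Ar D. \<forall>g\<in>Ar D. tgt D f = src D g \<longrightarrow> snd F (f \<cdot>\<^bsub>D\<^esub> g) = snd F f \<cdot>\<^bsub>E\<^esub> snd F g)"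

definition cat_iso ::
  "('a, 'b) cat \<Rightarrow> ('c, 'd) cat \<Rightarrow> ('a, 'b, 'c, 'd) functor_data \<Rightarrow> bool" where
  "cat_iso D E F \<longleftrightarrow> is_functor D E F \<and>
     bij_betw (fst F) (Ob D) (Ob E) \<and> bij_betw (snd F) (Ar D) (Ar E)"

definition isofibration_functor ::
  "('a, 'b) cat \<Rightarrow> ('c, 'd) cat \<Rightarrow> ('a, 'b, 'c, 'd) functor_data \<Rightarrow> bool" where
  "isofibration_functor D E F \<longleftrightarrow> is_functor D E F \<and>
     (\<forall>x\<in>Ob D. \<forall>b\<in>Ar E. src E b = fst F x \<and> invertible E b \<longrightarrow>
        (\<exists>a\<in>Ar D. src D a = x \<and> invertible D a \<and> snd F a = b))"

definition dof_functor ::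
  "('a, 'b) cat \<Rightarrow> ('c, 'd) cat \<Rightarrow> ('a, 'b, 'c, 'd) functor_data \<Rightarrow> bool" where
  "dof_functor D E F \<longleftrightarrow> is_functor D E F \<and>
     (\<forall>x\<in>Ob D. \<forall>b\<in>Ar E. src E b = fst F x \<longrightarrow>
        (\<exists>!a. a \<in> Ar D \<and> src D a = x \<and> snd F a = b))"

text \<open>Functors and natural transformations that occur as elements of a set are made
  extensional, so that equality of HOL functions is equality of functors.\<close>

definition ext_functor ::
  "('a, 'b) cat \<Rightarrow> ('c, 'd) cat \<Rightarrow> ('a, 'b, 'c, 'd) functor_data \<Rightarrow> bool" where
  "ext_functor D E F \<longleftrightarrow>
     is_functor D E F \<and> fst F \<in> extensional (Ob D) \<and> snd F \<in> extensional (Ar D)"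

definition nat_trans ::
  "('a, 'b) cat \<Rightarrow> ('c, 'd) cat \<Rightarrow> ('a, 'b, 'c, 'd) functor_data \<Rightarrow>
   ('a, 'b, 'c, 'd) functor_data \<Rightarrow> ('a \<Rightarrow> 'd) \<Rightarrow> bool" where
  "nat_trans D E F G \<eta> \<longleftrightarrow> \<eta> \<in> extensional (Ob D) \<and>
     (\<forall>x\<in>Ob D. \<eta> x \<in> hom E (fst F x) (fst G x)) \<and>
     (\<forall>f\<in>Ar D. snd F f \<cdot>\<^bsub>E\<^esub> \<eta> (tgt D f) = \<eta> (src D f) \<cdot>\<^bsub>E\<^esub> snd G f)"

definition fun_cat :: "('a, 'b) cat \<Rightarrow> ('c, 'd) cat \<Rightarrow>
   (('a, 'b, 'c, 'd) functor_data,
    ('a, 'b, 'c, 'd) functor_data \<times> ('a, 'b, 'c, 'd) functor_data \<times> ('a \<Rightarrow> 'd)) cat" where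
  "fun_cat D E =
     \<lparr>Ob = {F. ext_functor D E F},
      Ar = {(F, G, \<eta>). ext_functor D E F \<and> ext_functor D E G \<and> nat_trans D E F G \<eta>},
      src = (\<lambda>(F, G, \<eta>). F),
      tgt = (\<lambda>(F, G, \<eta>). G),
      ident = (\<lambda>F. (F, F, restrict (\<lambda>x. ident E (fst F x)) (Ob D))),
      comp = (\<lambda>(F, G, \<eta>) (G', H, \<theta>). (F, H, restrict (\<lambda>x. \<eta> x \<cdot>\<^bsub>E\<^esub> \<theta> x) (Ob D)))\<rparr>"

definition prod_cat :: "('a, 'b) cat \<Rightarrow> ('c, 'd) cat \<Rightarrow> ('a \<times> 'c, 'b \<times> 'd) cat" where
  "prod_cat D E =
     \<lparr>Ob = Ob D \<times> Ob E, Ar = Ar D \<times> Ar E,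
      src = map_prod (src D) (src E), tgt = map_prod (tgt D) (tgt E),
      ident = map_prod (ident D) (ident E),
      comp = (\<lambda>a b. (fst a \<cdot>\<^bsub>D\<^esub> fst b, snd a \<cdot>\<^bsub>E\<^esub> snd b))\<rparr>"

definition fibre_prod_cat ::
  "('a, 'b) cat \<Rightarrow> ('c, 'd) cat \<Rightarrow> ('a, 'b, 'e, 'f) functor_data \<Rightarrow>
   ('c, 'd, 'e, 'f) functor_data \<Rightarrow> ('a \<times> 'c, 'b \<times> 'd) cat" where
  "fibre_prod_cat D E F G = (prod_cat D E)
     \<lparr>Ob := {(x, y). x \<in> Ob D \<and> y \<in> Ob E \<and> fst F x = fst G y},
      Ar := {(a, b). a \<in> Ar D \<and> b \<in> Ar E \<and> snd F a = snd G b}\<rparr>"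


subsection \<open>Pullbacks in a category\<close>

definition pullback :: "('a, 'b) cat \<Rightarrow> 'b \<Rightarrow> 'b \<Rightarrow> 'b \<Rightarrow> 'b \<Rightarrow> bool" where
  "pullback D f g p q \<longleftrightarrow>
     f \<in> Ar D \<and> g \<in> Ar D \<and> tgt D f = tgt D g \<and>
     p \<in> Ar D \<and> q \<in> Ar D \<and> src D p = src D q \<and> tgt D p = src D f \<and> tgt D q = src D g \<and>
     p \<cdot>\<^bsub>D\<^esub> f = q \<cdot>\<^bsub>D\<^esub> g \<and>
     (\<forall>a\<in>Ar D. \<forall>b\<in>Ar D.
        src D a = src D b \<and> tgt D a = src D f \<and> tgt D b = src D g \<and> a \<cdot>\<^bsub>D\<^esub> f = b \<cdot>\<^bsub>D\<^esub> g \<longrightarrow>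
        (\<exists>!u. u \<in> hom D (src D a) (src D p) \<and> u \<cdot>\<^bsub>D\<^esub> p = a \<and> u \<cdot>\<^bsub>D\<^esub> q = b))"

text \<open>\<open>\<langle>a, b\<rangle>\<close>, for projections \<open>p\<close>, \<open>q\<close> of a product or of a pullback.\<close>

definition pairing :: "('a, 'b) cat \<Rightarrow> 'b \<Rightarrow> 'b \<Rightarrow> 'b \<Rightarrow> 'b \<Rightarrow> 'b" where
  "pairing D p q a b =
     (THE u. u \<in> hom D (src D a) (src D p) \<and> u \<cdot>\<^bsub>D\<^esub> p = a \<and> u \<cdot>\<^bsub>D\<^esub> q = b)"


section \<open>Strict 2-categories\<close>

record ('o, 'm, 'c) tcat =
  Obj :: "'o set"
  Mor :: "'m set"
  Cell :: "'c set"
  dom1 :: "'m \<Rightarrow> 'o"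
  cod1 :: "'m \<Rightarrow> 'o"
  id1 :: "'o \<Rightarrow> 'm"
  comp1 :: "'m \<Rightarrow> 'm \<Rightarrow> 'm"  (infixl "\<odot>\<index>" 70)
  dom2 :: "'c \<Rightarrow> 'm"
  cod2 :: "'c \<Rightarrow> 'm"
  id2 :: "'m \<Rightarrow> 'c"
  vcomp :: "'c \<Rightarrow> 'c \<Rightarrow> 'c"  (infixl "\<bullet>\<index>" 65)
  hcomp :: "'c \<Rightarrow> 'c \<Rightarrow> 'c"  (infixl "\<star>\<index>" 70)

definition und_cat :: "('o, 'm, 'c) tcat \<Rightarrow> ('o, 'm) cat" where
  "und_cat C = \<lparr>Ob = Obj C, Ar = Mor C, src = dom1 C, tgt = cod1 C, ident = id1 C,
                comp = comp1 C\<rparr>"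

definition vert_cat :: "('o, 'm, 'c) tcat \<Rightarrow> ('m, 'c) cat" where
  "vert_cat C = \<lparr>Ob = Mor C, Ar = Cell C, src = dom2 C, tgt = cod2 C, ident = id2 C,
                 comp = vcomp C\<rparr>"

definition horiz_cat :: "('o, 'm, 'c) tcat \<Rightarrow> ('o, 'c) cat" where
  "horiz_cat C = \<lparr>Ob = Obj C, Ar = Cell C, src = (\<lambda>\<alpha>. dom1 C (dom2 C \<alpha>)),
                  tgt = (\<lambda>\<alpha>. cod1 C (dom2 C \<alpha>)), ident = (\<lambda>A. id2 C (id1 C A)),
                  comp = hcomp C\<rparr>"

definition two_category :: "('o, 'm, 'c) tcat \<Rightarrow> bool" where
  "two_category C \<longleftrightarrow>
     category (und_cat C) \<and> category (vert_cat C) \<and> category (horiz_cat C) \<and>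
     (\<forall>\<alpha>\<in>Cell C. dom1 C (dom2 C \<alpha>) = dom1 C (cod2 C \<alpha>) \<and>
                  cod1 C (dom2 C \<alpha>) = cod1 C (cod2 C \<alpha>)) \<and>
     is_functor (horiz_cat C) (und_cat C) (\<lambda>A. A, dom2 C) \<and>
     is_functor (horiz_cat C) (und_cat C) (\<lambda>A. A, cod2 C) \<and>
     is_functor (und_cat C) (horiz_cat C) (\<lambda>A. A, id2 C) \<and>
     (\<forall>\<alpha>\<in>Cell C. \<forall>\<beta>\<in>Cell C. \<forall>\<alpha>'\<in>Cell C. \<forall>\<beta>'\<in>Cell C.
        cod2 C \<alpha> = dom2 C \<beta> \<and> cod2 C \<alpha>' = dom2 C \<beta>' \<and>
        cod1 C (dom2 C \<alpha>) = dom1 C (dom2 C \<alpha>') \<longrightarrow>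
        (\<alpha> \<bullet>\<^bsub>C\<^esub> \<beta>) \<star>\<^bsub>C\<^esub> (\<alpha>' \<bullet>\<^bsub>C\<^esub> \<beta>') = \<alpha> \<star>\<^bsub>C\<^esub> \<alpha>' \<bullet>\<^bsub>C\<^esub> \<beta> \<star>\<^bsub>C\<^esub> \<beta>')"

definition hom1 :: "('o, 'm, 'c) tcat \<Rightarrow> 'o \<Rightarrow> 'o \<Rightarrow> 'm set" where
  "hom1 C A B = {f \<in> Mor C. dom1 C f = A \<and> cod1 C f = B}"

definition hom2 :: "('o, 'm, 'c) tcat \<Rightarrow> 'm \<Rightarrow> 'm \<Rightarrow> 'c set" where
  "hom2 C f g = {\<alpha> \<in> Cell C. dom2 C \<alpha> = f \<and> cod2 C \<alpha> = g}"

definition hom_cat :: "('o, 'm, 'c) tcat \<Rightarrow> 'o \<Rightarrow> 'o \<Rightarrow> ('m, 'c) cat" where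
  "hom_cat C A B =
     \<lparr>Ob = hom1 C A B, Ar = {\<alpha> \<in> Cell C. dom2 C \<alpha> \<in> hom1 C A B \<and> cod2 C \<alpha> \<in> hom1 C A B},
      src = dom2 C, tgt = cod2 C, ident = id2 C, comp = vcomp C\<rparr>"

definition lwhisker :: "('o, 'm, 'c) tcat \<Rightarrow> 'm \<Rightarrow> 'c \<Rightarrow> 'c"  (infixl "\<rhd>\<index>" 70) where
  "f \<rhd>\<^bsub>C\<^esub> \<alpha> = id2 C f \<star>\<^bsub>C\<^esub> \<alpha>"

definition rwhisker :: "('o, 'm, 'c) tcat \<Rightarrow> 'c \<Rightarrow> 'm \<Rightarrow> 'c"  (infixl "\<lhd>\<index>" 70) where
  "\<alpha> \<lhd>\<^bsub>C\<^esub> f = \<alpha> \<star>\<^bsub>C\<^esub> id2 C f"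

definition post :: "('o, 'm, 'c) tcat \<Rightarrow> 'm \<Rightarrow> ('m, 'c, 'm, 'c) functor_data" where
  "post C f = (\<lambda>g. g \<odot>\<^bsub>C\<^esub> f, \<lambda>\<alpha>. \<alpha> \<lhd>\<^bsub>C\<^esub> f)"

definition inv_cell :: "('o, 'm, 'c) tcat \<Rightarrow> 'c \<Rightarrow> 'c" where
  "inv_cell C \<alpha> = (THE \<beta>. inverse_arrows (vert_cat C) \<alpha> \<beta>)"

definition isomorphic :: "('o, 'm, 'c) tcat \<Rightarrow> 'o \<Rightarrow> 'o \<Rightarrow> bool" where
  "isomorphic C X Y \<longleftrightarrow> (\<exists>f\<in>hom1 C X Y. invertible (und_cat C) f)"

definition op_tcat :: "('o, 'm, 'c) tcat \<Rightarrow> ('o, 'm, 'c) tcat" where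
  "op_tcat C = C\<lparr>dom1 := cod1 C, cod1 := dom1 C, comp1 := (\<lambda>f g. g \<odot>\<^bsub>C\<^esub> f),
                 hcomp := (\<lambda>\<alpha> \<beta>. \<beta> \<star>\<^bsub>C\<^esub> \<alpha>)\<rparr>"


subsection \<open>Strict limits\<close>

definition isofibration :: "('o, 'm, 'c) tcat \<Rightarrow> 'm \<Rightarrow> bool" where
  "isofibration C f \<longleftrightarrow> f \<in> Mor C \<and>
     (\<forall>A\<in>Obj C. isofibration_functor (hom_cat C A (dom1 C f)) (hom_cat C A (cod1 C f)) (post C f))"

definition dof :: "('o, 'm, 'c) tcat \<Rightarrow> 'm \<Rightarrow> bool" where
  "dof C f \<longleftrightarrow> f \<in> Mor C \<and>
     (\<forall>A\<in>Obj C. dof_functor (hom_cat C A (dom1 C f)) (hom_cat C A (cod1 C f)) (post C f))"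

definition strict_pullback :: "('o, 'm, 'c) tcat \<Rightarrow> 'm \<Rightarrow> 'm \<Rightarrow> 'm \<Rightarrow> 'm \<Rightarrow> bool" where
  "strict_pullback C f g p q \<longleftrightarrow>
     f \<in> Mor C \<and> g \<in> Mor C \<and> cod1 C f = cod1 C g \<and>
     p \<in> hom1 C (dom1 C p) (dom1 C f) \<and> q \<in> hom1 C (dom1 C p) (dom1 C g) \<and>
     p \<odot>\<^bsub>C\<^esub> f = q \<odot>\<^bsub>C\<^esub> g \<and>
     (\<forall>B\<in>Obj C.
        cat_iso (hom_cat C B (dom1 C p))
          (fibre_prod_cat (hom_cat C B (dom1 C f)) (hom_cat C B (dom1 C g)) (post C f) (post C g))
          (\<lambda>u. (u \<odot>\<^bsub>C\<^esub> p, u \<odot>\<^bsub>C\<^esub> q), \<lambda>\<alpha>. (\<alpha> \<lhd>\<^bsub>C\<^esub> p, \<alpha> \<lhd>\<^bsub>C\<^esub> q)))"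

definition strict_product :: "('o, 'm, 'c) tcat \<Rightarrow> 'o \<Rightarrow> 'o \<Rightarrow> 'm \<Rightarrow> 'm \<Rightarrow> bool" where
  "strict_product C X Y p q \<longleftrightarrow>
     p \<in> hom1 C (dom1 C p) X \<and> q \<in> hom1 C (dom1 C p) Y \<and>
     (\<forall>B\<in>Obj C.
        cat_iso (hom_cat C B (dom1 C p)) (prod_cat (hom_cat C B X) (hom_cat C B Y))
          (\<lambda>u. (u \<odot>\<^bsub>C\<^esub> p, u \<odot>\<^bsub>C\<^esub> q), \<lambda>\<alpha>. (\<alpha> \<lhd>\<^bsub>C\<^esub> p, \<alpha> \<lhd>\<^bsub>C\<^esub> q)))"

definition strict_terminal :: "('o, 'm, 'c) tcat \<Rightarrow> 'o \<Rightarrow> bool" where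
  "strict_terminal C T \<longleftrightarrow> T \<in> Obj C \<and>
     (\<forall>A\<in>Obj C. (\<exists>!f. f \<in> Ob (hom_cat C A T)) \<and> (\<exists>!\<alpha>. \<alpha> \<in> Ar (hom_cat C A T)))"

definition strict_cotensor ::
  "('o, 'm, 'c) tcat \<Rightarrow> ('j, 'k) cat \<Rightarrow> 'o \<Rightarrow> 'o \<Rightarrow> ('j, 'k, 'm, 'c) functor_data \<Rightarrow> bool" where
  "strict_cotensor C J X P ev \<longleftrightarrow>
     X \<in> Obj C \<and> P \<in> Obj C \<and> is_functor J (hom_cat C P X) ev \<and>
     (\<forall>A\<in>Obj C.
        cat_iso (hom_cat C A P) (fun_cat J (hom_cat C A X))
          (let whisk = (\<lambda>f. (restrict (\<lambda>j. f \<odot>\<^bsub>C\<^esub> fst ev j) (Ob J),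
                             restrict (\<lambda>a. f \<rhd>\<^bsub>C\<^esub> snd ev a) (Ar J)))
           in (whisk,
               \<lambda>\<alpha>. (whisk (dom2 C \<alpha>), whisk (cod2 C \<alpha>),
                    restrict (\<lambda>j. \<alpha> \<lhd>\<^bsub>C\<^esub> fst ev j) (Ob J)))))"

text \<open>\<open>X\<close> itself as the cotensor of \<open>X\<close> with the category \<open>[0]\<close>.\<close>

definition const_ev :: "('o, 'm, 'c) tcat \<Rightarrow> 'o \<Rightarrow> (nat, nat \<times> nat, 'm, 'c) functor_data" where
  "const_ev C X = (\<lambda>_. id1 C X, \<lambda>_. id2 C (id1 C X))"

text \<open>The morphism \<open>X\<^sup>\<delta> : P' \<rightarrow> P\<close> induced by a functor \<open>\<delta> : J \<rightarrow> J'\<close>, where \<open>(P, ev)\<close> and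
  \<open>(P', ev')\<close> are cotensors of \<open>X\<close> with \<open>J\<close> and \<open>J'\<close>.\<close>

definition cotensor_map ::
  "('o, 'm, 'c) tcat \<Rightarrow> ('i, 'h) cat \<Rightarrow> ('i, 'h, 'j, 'k) functor_data \<Rightarrow>
   'o \<Rightarrow> ('j, 'k, 'm, 'c) functor_data \<Rightarrow> 'o \<Rightarrow> ('i, 'h, 'm, 'c) functor_data \<Rightarrow> 'm" where
  "cotensor_map C J \<delta> P' ev' P ev =
     (THE u. u \<in> hom1 C P' P \<and>
        (\<forall>j\<in>Ob J. u \<odot>\<^bsub>C\<^esub> fst ev j = fst ev' (fst \<delta> j)) \<and>
        (\<forall>a\<in>Ar J. u \<rhd>\<^bsub>C\<^esub> snd ev a = snd ev' (snd \<delta> a)))"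

text \<open>The functor \<open>[k] \<rightarrow> [l]\<close> with list of values \<open>[a\<^sub>0, \<dots>, a\<^sub>k]\<close>.\<close>

definition delta :: "nat list \<Rightarrow> (nat, nat \<times> nat, nat, nat \<times> nat) functor_data" where
  "delta as = (\<lambda>j. as ! j, \<lambda>(i, j). (as ! i, as ! j))"

definition pita :: "('o, 'm, 'c) tcat \<Rightarrow> bool" where
  "pita C \<longleftrightarrow>
     (\<exists>T. strict_terminal C T) \<and>
     (\<forall>X\<in>Obj C. \<exists>P ev. strict_cotensor C (ord_cat 1) X P ev) \<and>
     (\<forall>f g. isofibration C f \<and> g \<in> Mor C \<and> cod1 C g = cod1 C f \<longrightarrow>
        (\<exists>p q. strict_pullback C f g p q))"


subsection \<open>Groupoids and cores\<close>

definition groupoid_obj :: "('o, 'm, 'c) tcat \<Rightarrow> 'o \<Rightarrow> bool" where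
  "groupoid_obj C X \<longleftrightarrow> X \<in> Obj C \<and> (\<forall>A\<in>Obj C. is_groupoid (hom_cat C A X))"

definition gpd :: "('o, 'm, 'c) tcat \<Rightarrow> ('o, 'm, 'c) tcat" where
  "gpd C = C\<lparr>Obj := {X. groupoid_obj C X},
             Mor := {f \<in> Mor C. groupoid_obj C (dom1 C f) \<and> groupoid_obj C (cod1 C f)},
             Cell := {\<alpha> \<in> Cell C. groupoid_obj C (dom1 C (dom2 C \<alpha>)) \<and>
                                   groupoid_obj C (cod1 C (dom2 C \<alpha>))}\<rparr>"

definition arrowwise_iso :: "('o, 'm, 'c) tcat \<Rightarrow> 'm \<Rightarrow> bool" where
  "arrowwise_iso C f \<longleftrightarrow> f \<in> Mor C \<and>
     (\<forall>\<alpha>\<in>Cell C. cod1 C (dom2 C \<alpha>) = dom1 C f \<longrightarrow> invertible (vert_cat C) (\<alpha> \<lhd>\<^bsub>C\<^esub> f))"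

definition arrowwise_iso_cat :: "('o, 'm, 'c) tcat \<Rightarrow> 'o \<Rightarrow> 'o \<Rightarrow> ('m, 'c) cat" where
  "arrowwise_iso_cat C A X = (hom_cat C A X)
     \<lparr>Ob := {f \<in> hom1 C A X. arrowwise_iso C f},
      Ar := {\<alpha> \<in> Ar (hom_cat C A X). arrowwise_iso C (dom2 C \<alpha>) \<and> arrowwise_iso C (cod2 C \<alpha>) \<and>
                                     invertible (vert_cat C) \<alpha>}\<rparr>"

definition is_core :: "('o, 'm, 'c) tcat \<Rightarrow> 'o \<Rightarrow> 'o \<Rightarrow> 'm \<Rightarrow> bool" where
  "is_core C X I i \<longleftrightarrow> X \<in> Obj C \<and> i \<in> hom1 C I X \<and> arrowwise_iso C i \<and>
     (\<forall>A\<in>Obj C. cat_iso (hom_cat C A I) (arrowwise_iso_cat C A X) (post C i))"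

text \<open>The morphism \<open>f\<^bsup>iso\<^esup>\<close> between cores with inclusions \<open>i\<close> and \<open>j\<close>.\<close>

definition core_map :: "('o, 'm, 'c) tcat \<Rightarrow> 'm \<Rightarrow> 'm \<Rightarrow> 'm \<Rightarrow> 'm" where
  "core_map C i j f = (THE g. g \<in> hom1 C (dom1 C i) (dom1 C j) \<and> g \<odot>\<^bsub>C\<^esub> j = i \<odot>\<^bsub>C\<^esub> f)"


section \<open>Congruences\<close>

record ('o, 'm) internal =
  obj0 :: 'o
  obj1 :: 'o
  obj2 :: 'o
  pi0 :: 'm
  pi1 :: 'm
  idm :: 'm
  pi01 :: 'm
  pi12 :: 'm
  pi02 :: 'm

text \<open>In the associativity law, \<open>p\<close> and \<open>q\<close> are the first two and the last two arrows of a
  composable triple of generalized arrows; the generic such triple is the one with domain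
  \<open>C\<^sub>3\<close>, whose \<open>p\<close> and \<open>q\<close> are the pullback projections.\<close>

definition internal_category :: "('o, 'm) cat \<Rightarrow> ('o, 'm) internal \<Rightarrow> bool" where
  "internal_category D K \<longleftrightarrow>
     obj0 K \<in> Ob D \<and> obj1 K \<in> Ob D \<and> obj2 K \<in> Ob D \<and>
     pi0 K \<in> hom D (obj1 K) (obj0 K) \<and> pi1 K \<in> hom D (obj1 K) (obj0 K) \<and>
     idm K \<in> hom D (obj0 K) (obj1 K) \<and>
     pi01 K \<in> hom D (obj2 K) (obj1 K) \<and> pi12 K \<in> hom D (obj2 K) (obj1 K) \<and>
     pi02 K \<in> hom D (obj2 K) (obj1 K) \<and>
     pullback D (pi1 K) (pi0 K) (pi01 K) (pi12 K) \<and>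
     idm K \<cdot>\<^bsub>D\<^esub> pi0 K = ident D (obj0 K) \<and> idm K \<cdot>\<^bsub>D\<^esub> pi1 K = ident D (obj0 K) \<and>
     pi02 K \<cdot>\<^bsub>D\<^esub> pi0 K = pi01 K \<cdot>\<^bsub>D\<^esub> pi0 K \<and> pi02 K \<cdot>\<^bsub>D\<^esub> pi1 K = pi12 K \<cdot>\<^bsub>D\<^esub> pi1 K \<and>
     (let pair = pairing D (pi01 K) (pi12 K) in
        pair (pi0 K \<cdot>\<^bsub>D\<^esub> idm K) (ident D (obj1 K)) \<cdot>\<^bsub>D\<^esub> pi02 K = ident D (obj1 K) \<and>
        pair (ident D (obj1 K)) (pi1 K \<cdot>\<^bsub>D\<^esub> idm K) \<cdot>\<^bsub>D\<^esub> pi02 K = ident D (obj1 K) \<and>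
        (\<forall>p\<in>Ar D. \<forall>q\<in>Ar D. src D p = src D q \<and> tgt D p = obj2 K \<and> tgt D q = obj2 K \<and>
           p \<cdot>\<^bsub>D\<^esub> pi12 K = q \<cdot>\<^bsub>D\<^esub> pi01 K \<longrightarrow>
           pair (p \<cdot>\<^bsub>D\<^esub> pi02 K) (q \<cdot>\<^bsub>D\<^esub> pi12 K) \<cdot>\<^bsub>D\<^esub> pi02 K =
           pair (p \<cdot>\<^bsub>D\<^esub> pi01 K) (q \<cdot>\<^bsub>D\<^esub> pi02 K) \<cdot>\<^bsub>D\<^esub> pi02 K))"

definition internal_double_category :: "('o, 'm, 'c) tcat \<Rightarrow> ('o, 'm) internal \<Rightarrow> bool" where
  "internal_double_category C K \<longleftrightarrow>
     internal_category (und_cat C) K \<and>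
     (\<exists>s t. strict_product C (obj0 K) (obj0 K) s t \<and>
            isofibration C (pairing (und_cat C) s t (pi0 K) (pi1 K)))"

definition gbo_congruence :: "('o, 'm, 'c) tcat \<Rightarrow> ('o, 'm) internal \<Rightarrow> bool" where
  "gbo_congruence C K \<longleftrightarrow>
     internal_double_category C K \<and>
     groupoid_obj C (obj0 K) \<and> groupoid_obj C (obj1 K) \<and> groupoid_obj C (obj2 K) \<and>
     (\<exists>s t. strict_product C (obj0 K) (obj0 K) s t \<and>
            dof C (pairing (und_cat C) s t (pi0 K) (pi1 K)))"

text \<open>\<open>r\<close> is the reflection morphism of \<open>K\<close>, for \<open>(P, ev)\<close> an arrow object of \<open>obj0 K\<close>: here
  \<open>fst ev 0\<close> and \<open>fst ev 1\<close> are \<open>\<partial>\<^sub>0\<close> and \<open>\<partial>\<^sub>1\<close>, and \<open>snd ev (0, 1)\<close> is \<open>\<partial>\<close>. The equation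
  for \<open>\<rho>\<close> composed with \<open>\<langle>\<pi>\<^sub>0, \<pi>\<^sub>1\<rangle>\<close> is stated on both components.\<close>

definition is_reflection ::
  "('o, 'm, 'c) tcat \<Rightarrow> ('o, 'm) internal \<Rightarrow> 'o \<Rightarrow>
   (nat, nat \<times> nat, 'm, 'c) functor_data \<Rightarrow> 'm \<Rightarrow> bool" where
  "is_reflection C K P ev r \<longleftrightarrow>
     r \<in> hom1 C P (obj1 K) \<and>
     (\<exists>\<rho>\<in>hom2 C r (fst ev 1 \<odot>\<^bsub>C\<^esub> idm K).
        \<rho> \<lhd>\<^bsub>C\<^esub> pi0 K = snd ev (0, 1) \<and> \<rho> \<lhd>\<^bsub>C\<^esub> pi1 K = id2 C (fst ev 1))"

text \<open>The auxiliary choices are: the arrow object \<open>(P, ev)\<close> of \<open>obj0 K\<close>; the pullback \<open>C\<^sub>3\<close>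
  with projections \<open>l\<close> (first two arrows) and \<open>m\<close> (last two arrows); the products
  \<open>C\<^sub>0 \<times> C\<^sub>0\<close> with projections \<open>s\<close>, \<open>t\<close> and \<open>C\<^sub>1 \<times> C\<^sub>1\<close> with projections \<open>s'\<close>, \<open>t'\<close>.
  The objects of the last four are the domains of their projections.\<close>

definition complete_congruence :: "('o, 'm, 'c) tcat \<Rightarrow> ('o, 'm) internal \<Rightarrow> bool" where
  "complete_congruence C K \<longleftrightarrow> gbo_congruence C K \<and>
     (\<exists>P ev r \<tau> l m s t s' t'.
        strict_cotensor C (ord_cat 1) (obj0 K) P ev \<and>
        is_reflection C K P ev r \<and>
        \<tau> \<in> hom1 C P P \<and> \<tau> \<rhd>\<^bsub>C\<^esub> snd ev (0, 1) = inv_cell C (snd ev (0, 1)) \<and>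
        pullback (und_cat C) (pi12 K) (pi01 K) l m \<and>
        strict_product C (obj0 K) (obj0 K) s t \<and>
        strict_product C (obj1 K) (obj1 K) s' t' \<and>
        (let pair2 = pairing (und_cat C) (pi01 K) (pi12 K);
             pair3 = pairing (und_cat C) l m;
             pair0 = pairing (und_cat C) s t;
             pair1 = pairing (und_cat C) s' t'
         in strict_pullback C
              (pair1 (l \<odot>\<^bsub>C\<^esub> pi02 K) (m \<odot>\<^bsub>C\<^esub> pi02 K))
              (pair1 (s \<odot>\<^bsub>C\<^esub> idm K) (t \<odot>\<^bsub>C\<^esub> idm K))
              (pair3 (pair2 r (\<tau> \<odot>\<^bsub>C\<^esub> r)) (pair2 (\<tau> \<odot>\<^bsub>C\<^esub> r) r))
              (pair0 (fst ev 0) (fst ev 1))))"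

definition op_internal :: "('o, 'm) internal \<Rightarrow> ('o, 'm) internal" where
  "op_internal K = K\<lparr>pi0 := pi1 K, pi1 := pi0 K, pi01 := pi12 K, pi12 := pi01 K\<rparr>"


subsection \<open>Nerves and quotients\<close>

text \<open>\<open>K\<close> is a nerve of \<open>X\<close> and \<open>(\<gamma>, \<gamma>\<^sub>0\<^sub>1)\<close> is its tautological cocone, for some choice of
  cotensors \<open>(P, ev)\<close> with \<open>[1]\<close> and \<open>(Q, ew)\<close> with \<open>[2]\<close> and of core inclusions \<open>\<gamma>\<close>, \<open>i\<close>, \<open>j\<close>
  of \<open>X\<close>, \<open>P\<close>, \<open>Q\<close>.\<close>

definition nerve_with_cocone ::
  "('o, 'm, 'c) tcat \<Rightarrow> 'o \<Rightarrow> ('o, 'm) internal \<Rightarrow> 'm \<Rightarrow> 'c \<Rightarrow> bool" where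
  "nerve_with_cocone C X K \<gamma> \<gamma>01 \<longleftrightarrow>
     (\<exists>P ev Q ew i j.
        strict_cotensor C (ord_cat 1) X P ev \<and>
        strict_cotensor C (ord_cat 2) X Q ew \<and>
        is_core C X (obj0 K) \<gamma> \<and> is_core C P (obj1 K) i \<and> is_core C Q (obj2 K) j \<and>
        pi0 K = core_map C i \<gamma> (cotensor_map C (ord_cat 0) (delta [0]) P ev X (const_ev C X)) \<and>
        pi1 K = core_map C i \<gamma> (cotensor_map C (ord_cat 0) (delta [1]) P ev X (const_ev C X)) \<and>
        idm K = core_map C \<gamma> i (cotensor_map C (ord_cat 1) (delta [0, 0]) X (const_ev C X) P ev) \<and>
        pi01 K = core_map C j i (cotensor_map C (ord_cat 1) (delta [0, 1]) Q ew P ev) \<and>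
        pi12 K = core_map C j i (cotensor_map C (ord_cat 1) (delta [1, 2]) Q ew P ev) \<and>
        pi02 K = core_map C j i (cotensor_map C (ord_cat 1) (delta [0, 2]) Q ew P ev) \<and>
        \<gamma>01 = i \<rhd>\<^bsub>C\<^esub> snd ev (0, 1))"

definition is_cocone ::
  "('o, 'm, 'c) tcat \<Rightarrow> ('o, 'm) internal \<Rightarrow> 'o \<Rightarrow> 'm \<times> 'c \<Rightarrow> bool" where
  "is_cocone C K Y = (\<lambda>(\<gamma>, \<gamma>01).
     \<gamma> \<in> hom1 C (obj0 K) Y \<and> \<gamma>01 \<in> hom2 C (pi0 K \<odot>\<^bsub>C\<^esub> \<gamma>) (pi1 K \<odot>\<^bsub>C\<^esub> \<gamma>) \<and>
     idm K \<rhd>\<^bsub>C\<^esub> \<gamma>01 = id2 C \<gamma> \<and>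
     pi02 K \<rhd>\<^bsub>C\<^esub> \<gamma>01 = pi01 K \<rhd>\<^bsub>C\<^esub> \<gamma>01 \<bullet>\<^bsub>C\<^esub> pi12 K \<rhd>\<^bsub>C\<^esub> \<gamma>01)"

definition cocone_cat ::
  "('o, 'm, 'c) tcat \<Rightarrow> ('o, 'm) internal \<Rightarrow> 'o \<Rightarrow>
   ('m \<times> 'c, ('m \<times> 'c) \<times> ('m \<times> 'c) \<times> 'c) cat" where
  "cocone_cat C K Y =
     \<lparr>Ob = {G. is_cocone C K Y G},
      Ar = {(G, G', \<alpha>). is_cocone C K Y G \<and> is_cocone C K Y G' \<and> \<alpha> \<in> hom2 C (fst G) (fst G') \<and>
              pi0 K \<rhd>\<^bsub>C\<^esub> \<alpha> \<bullet>\<^bsub>C\<^esub> snd G' = snd G \<bullet>\<^bsub>C\<^esub> pi1 K \<rhd>\<^bsub>C\<^esub> \<alpha>},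
      src = (\<lambda>(G, G', \<alpha>). G),
      tgt = (\<lambda>(G, G', \<alpha>). G'),
      ident = (\<lambda>G. (G, G, id2 C (fst G))),
      comp = (\<lambda>(G, G', \<alpha>) (H, H', \<beta>). (G, H', \<alpha> \<bullet>\<^bsub>C\<^esub> \<beta>))\<rparr>"

definition strict_quotient ::
  "('o, 'm, 'c) tcat \<Rightarrow> ('o, 'm) internal \<Rightarrow> 'o \<Rightarrow> 'm \<Rightarrow> 'c \<Rightarrow> bool" where
  "strict_quotient C K X \<gamma> \<gamma>01 \<longleftrightarrow> X \<in> Obj C \<and> is_cocone C K X (\<gamma>, \<gamma>01) \<and>
     (\<forall>Y\<in>Obj C.
        cat_iso (hom_cat C X Y) (cocone_cat C K Y)
          (let push = (\<lambda>h. (\<gamma> \<odot>\<^bsub>C\<^esub> h, \<gamma>01 \<lhd>\<^bsub>C\<^esub> h))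
           in (push, \<lambda>\<beta>. (push (dom2 C \<beta>), push (cod2 C \<beta>), \<gamma> \<rhd>\<^bsub>C\<^esub> \<beta>))))"

definition groupoidant :: "('o, 'm, 'c) tcat \<Rightarrow> bool" where
  "groupoidant C \<longleftrightarrow> two_category C \<and> pita C \<and>
     (\<forall>X\<in>Obj C. \<exists>I i. is_core C X I i) \<and>
     (\<forall>K. complete_congruence C K \<longrightarrow> (\<exists>X\<in>Obj C. \<exists>\<gamma> \<gamma>01. nerve_with_cocone C X K \<gamma> \<gamma>01)) \<and>
     (\<forall>X\<in>Obj C. \<forall>K \<gamma> \<gamma>01. nerve_with_cocone C X K \<gamma> \<gamma>01 \<longrightarrow> strict_quotient C K X \<gamma> \<gamma>01)"


subsection \<open>Oppositions\<close>

definition opposition ::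
  "('o, 'm, 'c) tcat \<Rightarrow> 'o \<Rightarrow> 'o \<Rightarrow> ('o, 'm) internal \<Rightarrow> 'm \<Rightarrow> 'c \<Rightarrow> 'm \<Rightarrow> 'c \<Rightarrow> bool" where
  "opposition C X X' K \<gamma> \<gamma>01 \<gamma>' \<gamma>01' \<longleftrightarrow>
     complete_congruence C K \<and>
     strict_quotient C K X \<gamma> \<gamma>01 \<and> strict_quotient C (op_internal K) X' \<gamma>' \<gamma>01'"

definition opp_mor ::
  "('o, 'm, 'c) tcat \<Rightarrow> ('o, 'm) internal \<Rightarrow> 'm \<Rightarrow> 'm \<Rightarrow> 'm \<Rightarrow> 'm" where
  "opp_mor C K \<gamma> \<gamma>' f = (THE h. h \<in> hom1 C (dom1 C f) (obj0 K) \<and> h \<odot>\<^bsub>C\<^esub> \<gamma> = f) \<odot>\<^bsub>C\<^esub> \<gamma>'"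

definition opp_cell ::
  "('o, 'm, 'c) tcat \<Rightarrow> ('o, 'm) internal \<Rightarrow> 'c \<Rightarrow> 'c \<Rightarrow> 'c \<Rightarrow> 'c" where
  "opp_cell C K \<gamma>01 \<gamma>01' \<alpha> =
     (THE a. a \<in> hom1 C (dom1 C (dom2 C \<alpha>)) (obj1 K) \<and> a \<rhd>\<^bsub>C\<^esub> \<gamma>01 = \<alpha>) \<rhd>\<^bsub>C\<^esub> \<gamma>01'"


section \<open>2-functors into the 2-category of categories\<close>

type_synonym ('a, 'b) cat_mor = "('a, 'b) cat \<times> ('a, 'b) cat \<times> ('a, 'b, 'a, 'b) functor_data"
type_synonym ('a, 'b) cat_cell = "('a, 'b) cat_mor \<times> ('a, 'b) cat_mor \<times> ('a \<Rightarrow> 'b)"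

fun comp_cat_mor :: "('a, 'b) cat_mor \<Rightarrow> ('a, 'b) cat_mor \<Rightarrow> ('a, 'b) cat_mor" where
  "comp_cat_mor (D, E, F) (D', E', F') =
     (D, E', (restrict (\<lambda>x. fst F' (fst F x)) (Ob D), restrict (\<lambda>a. snd F' (snd F a)) (Ar D)))"

fun vcomp_cat_cell :: "('a, 'b) cat_cell \<Rightarrow> ('a, 'b) cat_cell \<Rightarrow> ('a, 'b) cat_cell" where
  "vcomp_cat_cell ((D, E, F), G, \<eta>) (G', H, \<theta>) =
     ((D, E, F), H, restrict (\<lambda>x. \<eta> x \<cdot>\<^bsub>E\<^esub> \<theta> x) (Ob D))"

fun hcomp_cat_cell :: "('a, 'b) cat_cell \<Rightarrow> ('a, 'b) cat_cell \<Rightarrow> ('a, 'b) cat_cell" where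
  "hcomp_cat_cell ((D, E, F), G, \<eta>) ((D', E', F'), (D'', E'', G'), \<theta>) =
     (comp_cat_mor (D, E, F) (D', E', F'), comp_cat_mor G (D'', E'', G'),
      restrict (\<lambda>x. \<theta> (fst F x) \<cdot>\<^bsub>E'\<^esub> snd G' (\<eta> x)) (Ob D))"

definition Cat :: "(('a, 'b) cat, ('a, 'b) cat_mor, ('a, 'b) cat_cell) tcat" where
  "Cat =
     \<lparr>Obj = {D. category D},
      Mor = {(D, E, F). category D \<and> category E \<and> ext_functor D E F},
      Cell = {((D, E, F), (D', E', G), \<eta>). D' = D \<and> E' = E \<and> category D \<and> category E \<and>
                ext_functor D E F \<and> ext_functor D E G \<and> nat_trans D E F G \<eta>},
      dom1 = (\<lambda>(D, E, F). D),
      cod1 = (\<lambda>(D, E, F). E),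
      id1 = (\<lambda>D. (D, D, (restrict (\<lambda>x. x) (Ob D), restrict (\<lambda>a. a) (Ar D)))),
      comp1 = comp_cat_mor,
      dom2 = (\<lambda>(F, G, \<eta>). F),
      cod2 = (\<lambda>(F, G, \<eta>). G),
      id2 = (\<lambda>(D, E, F). ((D, E, F), (D, E, F), restrict (\<lambda>x. ident E (fst F x)) (Ob D))),
      vcomp = vcomp_cat_cell,
      hcomp = hcomp_cat_cell\<rparr>"

type_synonym ('o, 'm, 'c, 'p, 'n, 'd) tfunctor_data = "('o \<Rightarrow> 'p) \<times> ('m \<Rightarrow> 'n) \<times> ('c \<Rightarrow> 'd)"

fun two_functor ::
  "('o, 'm, 'c) tcat \<Rightarrow> ('p, 'n, 'd) tcat \<Rightarrow> ('o, 'm, 'c, 'p, 'n, 'd) tfunctor_data \<Rightarrow> bool" where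
  "two_functor C D (F0, F1, F2) \<longleftrightarrow>
     is_functor (und_cat C) (und_cat D) (F0, F1) \<and>
     is_functor (vert_cat C) (vert_cat D) (F1, F2) \<and>
     is_functor (horiz_cat C) (horiz_cat D) (F0, F2)"

fun comp_tfunctor ::
  "('o, 'm, 'c, 'p, 'n, 'd) tfunctor_data \<Rightarrow> ('p, 'n, 'd, 'q, 'l, 'e) tfunctor_data \<Rightarrow>
   ('o, 'm, 'c, 'q, 'l, 'e) tfunctor_data" where
  "comp_tfunctor (F0, F1, F2) (G0, G1, G2) =
     (\<lambda>A. G0 (F0 A), \<lambda>f. G1 (F1 f), \<lambda>\<alpha>. G2 (F2 \<alpha>))"

text \<open>The data of \<open>\<C>(-, X)\<close>, as a 2-functor from \<open>op_tcat C\<close> (or its restriction to groupoids)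
  to \<open>Cat\<close>. The domain of \<open>f\<close> in \<open>op_tcat C\<close> is \<open>cod1 C f\<close>.\<close>

definition repr_mor :: "('o, 'm, 'c) tcat \<Rightarrow> 'o \<Rightarrow> 'm \<Rightarrow> ('m, 'c) cat_mor" where
  "repr_mor C X f =
     (let D = hom_cat C (cod1 C f) X
      in (D, hom_cat C (dom1 C f) X,
          (restrict (\<lambda>g. f \<odot>\<^bsub>C\<^esub> g) (Ob D), restrict (\<lambda>\<alpha>. f \<rhd>\<^bsub>C\<^esub> \<alpha>) (Ar D))))"

definition repr ::
  "('o, 'm, 'c) tcat \<Rightarrow> 'o \<Rightarrow>
   ('o, 'm, 'c, ('m, 'c) cat, ('m, 'c) cat_mor, ('m, 'c) cat_cell) tfunctor_data" where
  "repr C X =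
     (\<lambda>A. hom_cat C A X,
      repr_mor C X,
      \<lambda>\<sigma>. (repr_mor C X (dom2 C \<sigma>), repr_mor C X (cod2 C \<sigma>),
            restrict (\<lambda>g. \<sigma> \<lhd>\<^bsub>C\<^esub> g) (hom1 C (cod1 C (dom2 C \<sigma>)) X)))"

text \<open>The 2-functor sending a category to its opposite; it is covariant on functors and reverses
  natural transformations, so its domain is the 2-cell dual of \<open>Cat\<close>.\<close>

fun op_cat_mor :: "('a, 'b) cat_mor \<Rightarrow> ('a, 'b) cat_mor" where
  "op_cat_mor (D, E, F) = (op_cat D, op_cat E, F)"

definition op_tfunctor ::
  "(('a, 'b) cat, ('a, 'b) cat_mor, ('a, 'b) cat_cell,
    ('a, 'b) cat, ('a, 'b) cat_mor, ('a, 'b) cat_cell) tfunctor_data" where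
  "op_tfunctor = (op_cat, op_cat_mor, \<lambda>(F, G, \<eta>). (op_cat_mor G, op_cat_mor F, \<eta>))"

definition inv_tfunctor :: "('o, 'm, 'c) tcat \<Rightarrow> ('o, 'm, 'c, 'o, 'm, 'c) tfunctor_data" where
  "inv_tfunctor C = (\<lambda>A. A, \<lambda>f. f, inv_cell C)"

text \<open>The composite of inversion, \<open>\<C>(-, X)\<^bsup>co\<^esup>\<close> and passage to opposite categories. A 2-functor
  \<open>F\<close> and its dual \<open>F\<^bsup>co\<^esup>\<close> have the same underlying data.\<close>

definition op_repr ::
  "('o, 'm, 'c) tcat \<Rightarrow> 'o \<Rightarrow>
   ('o, 'm, 'c, ('m, 'c) cat, ('m, 'c) cat_mor, ('m, 'c) cat_cell) tfunctor_data" where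
  "op_repr C X = comp_tfunctor (comp_tfunctor (inv_tfunctor (gpd C)) (repr C X)) op_tfunctor"

fun strict_natural_iso ::
  "('o, 'm, 'c) tcat \<Rightarrow> ('p, 'n, 'd) tcat \<Rightarrow> ('o, 'm, 'c, 'p, 'n, 'd) tfunctor_data \<Rightarrow>
   ('o, 'm, 'c, 'p, 'n, 'd) tfunctor_data \<Rightarrow> ('o \<Rightarrow> 'n) \<Rightarrow> bool" where
  "strict_natural_iso C D (F0, F1, F2) (G0, G1, G2) \<theta> \<longleftrightarrow>
     two_functor C D (F0, F1, F2) \<and> two_functor C D (G0, G1, G2) \<and>
     (\<forall>A\<in>Obj C. \<theta> A \<in> hom1 D (F0 A) (G0 A) \<and> invertible (und_cat D) (\<theta> A)) \<and>
     (\<forall>f\<in>Mor C. F1 f \<odot>\<^bsub>D\<^esub> \<theta> (cod1 C f) = \<theta> (dom1 C f) \<odot>\<^bsub>D\<^esub> G1 f) \<and>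
     (\<forall>\<alpha>\<in>Cell C. F2 \<alpha> \<lhd>\<^bsub>D\<^esub> \<theta> (cod1 C (dom2 C \<alpha>)) = \<theta> (dom1 C (dom2 C \<alpha>)) \<rhd>\<^bsub>D\<^esub> G2 \<alpha>)"

definition opp_functor ::
  "('o, 'm, 'c) tcat \<Rightarrow> 'o \<Rightarrow> 'o \<Rightarrow> ('o, 'm) internal \<Rightarrow> 'm \<Rightarrow> 'c \<Rightarrow> 'm \<Rightarrow> 'c \<Rightarrow> 'o \<Rightarrow>
   ('m, 'c) cat_mor" where
  "opp_functor C X X' K \<gamma> \<gamma>01 \<gamma>' \<gamma>01' A =
     (op_cat (hom_cat C A X), hom_cat C A X',
      (restrict (opp_mor C K \<gamma> \<gamma>') (Ob (hom_cat C A X)),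
       restrict (opp_cell C K \<gamma>01 \<gamma>01') (Ar (hom_cat C A X))))"

end

theory Submission
  imports Defs
begin

text \<open>A complete congruence is a nerve, and all its strict quotients are isomorphic. Hence, for a
  groupoid \<open>A\<close>, morphisms \<open>A \<rightarrow> C\<^sub>0\<close> and \<open>A \<rightarrow> C\<^sub>1\<close> correspond bijectively to morphisms and 2-cells
  \<open>A \<rightarrow> X\<close>. The opposite of a complete congruence is again complete, so the same objects \<open>C\<^sub>0\<close> and
  \<open>C\<^sub>1\<close> classify morphisms and 2-cells \<open>A \<rightarrow> X\<^sup>o\<^sup>p\<close>, and \<open>(-)\<^sup>o\<^sup>p\<close> is the composite of the two
  bijections. Naturality in 2-cells comes from the reflection morphism \<open>r\<close>, which classifies
  \<open>\<partial>\<gamma>\<close> in \<open>X\<close> and the inverse of \<open>\<partial>\<gamma>\<^sup>o\<^sup>p\<close> in \<open>X\<^sup>o\<^sup>p\<close>. For uniqueness, every object is the quotient of its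
  nerve, so it is determined by the morphisms and 2-cells from groupoids into it.\<close>

section \<open>Calculus of a strict 2-category\<close>

text \<open>Groupoids enter because a core only sees arrow-wise isos, and every morphism out of a
  groupoid is one. Inversion enters for a related reason: a 2-cell \<sigma> between morphisms of
  groupoids acts on morphisms into \<open>X\<close> by whiskering, the operation reverses the
  result, and inverting \<sigma> beforehand restores its direction. Three obstacles shape the proof.
  A nerve needs the cotensor with [2], while \<open>pita\<close> offers only arrow objects and
  pullbacks of isofibrations; it is built as a pullback of two arrow objects. Completeness is stated
  through chosen limits and definite descriptions of pairings; exchanging every choice turns the
  square of the opposite into the original one up to the symmetry \<open>\<tau>\<close>. In the
  uniqueness claim the given isomorphism starts from opposite categories; the reversed opposition,
  from \<open>X'\<close> to \<open>X\<close>, cancels them and leaves a natural isomorphism between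
  two representables.\<close>

lemma hom1_iff [simp]: "f \<in> hom1 C A B \<longleftrightarrow> f \<in> Mor C \<and> dom1 C f = A \<and> cod1 C f = B"
  by (auto simp: hom1_def)

lemma hom2_iff [simp]: "\<alpha> \<in> hom2 C f g \<longleftrightarrow> \<alpha> \<in> Cell C \<and> dom2 C \<alpha> = f \<and> cod2 C \<alpha> = g"
  by (auto simp: hom2_def)

locale two_cat =
  fixes C :: "('o, 'm, 'c) tcat" (structure)
  assumes tc: "two_category C"
begin

lemma cats: "category (und_cat C)" "category (vert_cat C)" "category (horiz_cat C)"
  using tc unfolding two_category_def by auto

lemma Mor_Obj [simp]: "f \<in> Mor C \<Longrightarrow> dom1 C f \<in> Obj C" "f \<in> Mor C \<Longrightarrow> cod1 C f \<in> Obj C"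
  using cats(1) unfolding category_def und_cat_def by auto

lemma id1_props [simp]:
  assumes "A \<in> Obj C"
  shows "id1 C A \<in> Mor C" "dom1 C (id1 C A) = A" "cod1 C (id1 C A) = A"
  using cats(1) assms unfolding category_def und_cat_def hom_def by auto

lemma comp1_props [simp]:
  assumes "f \<in> Mor C" "g \<in> Mor C" "cod1 C f = dom1 C g"
  shows "f \<odot> g \<in> Mor C" "dom1 C (f \<odot> g) = dom1 C f" "cod1 C (f \<odot> g) = cod1 C g"
  using cats(1) assms unfolding category_def und_cat_def hom_def by auto

lemma comp1_id [simp]:
  assumes "f \<in> Mor C"
  shows "dom1 C f = A \<Longrightarrow> id1 C A \<odot> f = f" "cod1 C f = B \<Longrightarrow> f \<odot> id1 C B = f"
  using cats(1) assms unfolding category_def und_cat_def hom_def by auto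

lemma comp1_assoc [simp]:
  assumes "f \<in> Mor C" "g \<in> Mor C" "h \<in> Mor C" "cod1 C f = dom1 C g" "cod1 C g = dom1 C h"
  shows "(f \<odot> g) \<odot> h = f \<odot> (g \<odot> h)"
  using cats(1) assms unfolding category_def und_cat_def by auto

lemma Cell_Mor [simp]:
  assumes "\<alpha> \<in> Cell C"
  shows "dom2 C \<alpha> \<in> Mor C" "cod2 C \<alpha> \<in> Mor C"
    "dom1 C (cod2 C \<alpha>) = dom1 C (dom2 C \<alpha>)" "cod1 C (cod2 C \<alpha>) = cod1 C (dom2 C \<alpha>)"
  using tc assms unfolding two_category_def category_def vert_cat_def by auto

lemma id2_props [simp]:
  assumes "f \<in> Mor C"
  shows "id2 C f \<in> Cell C" "dom2 C (id2 C f) = f" "cod2 C (id2 C f) = f"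
  using cats(2) assms unfolding category_def vert_cat_def hom_def by auto

lemma vcomp_props [simp]:
  assumes "\<alpha> \<in> Cell C" "\<beta> \<in> Cell C" "cod2 C \<alpha> = dom2 C \<beta>"
  shows "\<alpha> \<bullet> \<beta> \<in> Cell C" "dom2 C (\<alpha> \<bullet> \<beta>) = dom2 C \<alpha>" "cod2 C (\<alpha> \<bullet> \<beta>) = cod2 C \<beta>"
  using cats(2) assms unfolding category_def vert_cat_def hom_def by auto

lemma vcomp_id [simp]:
  assumes "\<alpha> \<in> Cell C"
  shows "dom2 C \<alpha> = f \<Longrightarrow> id2 C f \<bullet> \<alpha> = \<alpha>" "cod2 C \<alpha> = g \<Longrightarrow> \<alpha> \<bullet> id2 C g = \<alpha>"
  using cats(2) assms unfolding category_def vert_cat_def by auto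

lemma vcomp_assoc [simp]:
  assumes "\<alpha> \<in> Cell C" "\<beta> \<in> Cell C" "\<delta> \<in> Cell C" "cod2 C \<alpha> = dom2 C \<beta>" "cod2 C \<beta> = dom2 C \<delta>"
  shows "(\<alpha> \<bullet> \<beta>) \<bullet> \<delta> = \<alpha> \<bullet> (\<beta> \<bullet> \<delta>)"
  using cats(2) assms unfolding category_def vert_cat_def by auto

lemma hcomp_props [simp]:
  assumes "\<alpha> \<in> Cell C" "\<beta> \<in> Cell C" "cod1 C (dom2 C \<alpha>) = dom1 C (dom2 C \<beta>)"
  shows "\<alpha> \<star> \<beta> \<in> Cell C" "dom2 C (\<alpha> \<star> \<beta>) = dom2 C \<alpha> \<odot> dom2 C \<beta>"
    "cod2 C (\<alpha> \<star> \<beta>) = cod2 C \<alpha> \<odot> cod2 C \<beta>"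
  using tc assms unfolding two_category_def category_def horiz_cat_def hom_def is_functor_def
    und_cat_def by auto

lemma hcomp_assoc:
  assumes "\<alpha> \<in> Cell C" "\<beta> \<in> Cell C" "\<delta> \<in> Cell C"
    "cod1 C (dom2 C \<alpha>) = dom1 C (dom2 C \<beta>)" "cod1 C (dom2 C \<beta>) = dom1 C (dom2 C \<delta>)"
  shows "(\<alpha> \<star> \<beta>) \<star> \<delta> = \<alpha> \<star> (\<beta> \<star> \<delta>)"
  using cats(3) assms unfolding category_def horiz_cat_def by auto

lemma hcomp_id:
  assumes "\<alpha> \<in> Cell C"
  shows "dom1 C (dom2 C \<alpha>) = A \<Longrightarrow> id2 C (id1 C A) \<star> \<alpha> = \<alpha>"
    "cod1 C (dom2 C \<alpha>) = B \<Longrightarrow> \<alpha> \<star> id2 C (id1 C B) = \<alpha>"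
  using cats(3) assms unfolding category_def horiz_cat_def by auto

lemma hcomp_id2:
  assumes "f \<in> Mor C" "g \<in> Mor C" "cod1 C f = dom1 C g"
  shows "id2 C f \<star> id2 C g = id2 C (f \<odot> g)"
  using tc assms unfolding two_category_def is_functor_def und_cat_def horiz_cat_def by auto

lemma interchange:
  assumes "\<alpha> \<in> Cell C" "\<beta> \<in> Cell C" "\<alpha>' \<in> Cell C" "\<beta>' \<in> Cell C"
    "cod2 C \<alpha> = dom2 C \<beta>" "cod2 C \<alpha>' = dom2 C \<beta>'" "cod1 C (dom2 C \<alpha>) = dom1 C (dom2 C \<alpha>')"
  shows "(\<alpha> \<bullet> \<beta>) \<star> (\<alpha>' \<bullet> \<beta>') = \<alpha> \<star> \<alpha>' \<bullet> \<beta> \<star> \<beta>'"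
  using tc assms unfolding two_category_def by auto

section \<open>Whiskering and its normal form\<close>

lemma lwhisker_props [simp]:
  assumes "f \<in> Mor C" "\<alpha> \<in> Cell C" "cod1 C f = dom1 C (dom2 C \<alpha>)"
  shows "f \<rhd> \<alpha> \<in> Cell C" "dom2 C (f \<rhd> \<alpha>) = f \<odot> dom2 C \<alpha>" "cod2 C (f \<rhd> \<alpha>) = f \<odot> cod2 C \<alpha>"
  using assms by (auto simp: lwhisker_def)

lemma rwhisker_props [simp]:
  assumes "f \<in> Mor C" "\<alpha> \<in> Cell C" "dom1 C f = cod1 C (dom2 C \<alpha>)"
  shows "\<alpha> \<lhd> f \<in> Cell C" "dom2 C (\<alpha> \<lhd> f) = dom2 C \<alpha> \<odot> f" "cod2 C (\<alpha> \<lhd> f) = cod2 C \<alpha> \<odot> f"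
  using assms by (auto simp: rwhisker_def)

lemma lwhisker_comp [simp]:
  assumes "f \<in> Mor C" "g \<in> Mor C" "\<alpha> \<in> Cell C" "cod1 C f = dom1 C g" "cod1 C g = dom1 C (dom2 C \<alpha>)"
  shows "(f \<odot> g) \<rhd> \<alpha> = f \<rhd> (g \<rhd> \<alpha>)"
  using assms by (simp add: lwhisker_def hcomp_assoc flip: hcomp_id2)

lemma rwhisker_comp [simp]:
  assumes "f \<in> Mor C" "g \<in> Mor C" "\<alpha> \<in> Cell C" "cod1 C f = dom1 C g" "dom1 C f = cod1 C (dom2 C \<alpha>)"
  shows "\<alpha> \<lhd> (f \<odot> g) = (\<alpha> \<lhd> f) \<lhd> g"
  using assms by (simp add: rwhisker_def hcomp_assoc flip: hcomp_id2)

text \<open>Together with \<open>lwhisker_comp\<close> and \<open>rwhisker_comp\<close> this fixes a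
  normal form for simp: composites are split, left whiskers stand outside and right whiskers
  inside.\<close>

lemma lrwhisker [simp]:
  assumes "f \<in> Mor C" "g \<in> Mor C" "\<alpha> \<in> Cell C" "cod1 C f = dom1 C (dom2 C \<alpha>)"
    "dom1 C g = cod1 C (dom2 C \<alpha>)"
  shows "(f \<rhd> \<alpha>) \<lhd> g = f \<rhd> (\<alpha> \<lhd> g)"
  using assms by (simp add: rwhisker_def lwhisker_def hcomp_assoc)

lemma whisker_id1 [simp]:
  assumes "\<alpha> \<in> Cell C"
  shows "dom1 C (dom2 C \<alpha>) = A \<Longrightarrow> id1 C A \<rhd> \<alpha> = \<alpha>" "cod1 C (dom2 C \<alpha>) = B \<Longrightarrow> \<alpha> \<lhd> id1 C B = \<alpha>"
  using assms by (simp_all add: rwhisker_def lwhisker_def hcomp_id)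

lemma whisker_id2 [simp]:
  assumes "f \<in> Mor C" "g \<in> Mor C" "cod1 C f = dom1 C g"
  shows "f \<rhd> id2 C g = id2 C (f \<odot> g)" "id2 C f \<lhd> g = id2 C (f \<odot> g)"
  using assms by (simp_all add: rwhisker_def lwhisker_def hcomp_id2)

lemma lwhisker_vcomp [simp]:
  assumes "f \<in> Mor C" "\<alpha> \<in> Cell C" "\<beta> \<in> Cell C" "cod2 C \<alpha> = dom2 C \<beta>"
    "cod1 C f = dom1 C (dom2 C \<alpha>)"
  shows "f \<rhd> (\<alpha> \<bullet> \<beta>) = f \<rhd> \<alpha> \<bullet> f \<rhd> \<beta>"
  using assms interchange[of "id2 C f" "id2 C f" \<alpha> \<beta>] by (simp add: lwhisker_def)

lemma rwhisker_vcomp [simp]: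
  assumes "f \<in> Mor C" "\<alpha> \<in> Cell C" "\<beta> \<in> Cell C" "cod2 C \<alpha> = dom2 C \<beta>"
    "dom1 C f = cod1 C (dom2 C \<alpha>)"
  shows "(\<alpha> \<bullet> \<beta>) \<lhd> f = \<alpha> \<lhd> f \<bullet> \<beta> \<lhd> f"
proof -
  have "cod1 C (dom2 C \<beta>) = cod1 C (dom2 C \<alpha>)" by (metis Cell_Mor(4) assms(2,4))
  then show ?thesis
    using assms interchange[of \<alpha> \<beta> "id2 C f" "id2 C f"] by (simp add: rwhisker_def)
qed

text \<open>Interchange with identity cells on either side. Equating the two formulas yields the
  naturality square of \<open>\<alpha>\<close> against \<open>\<beta>\<close>, the form in which
  interchange is used for cotensors, representables and the reflection cell.\<close>

lemma hcomp_whisker: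
  assumes "\<alpha> \<in> Cell C" "\<beta> \<in> Cell C" "cod1 C (dom2 C \<alpha>) = dom1 C (dom2 C \<beta>)"
  shows "\<alpha> \<star> \<beta> = \<alpha> \<lhd> dom2 C \<beta> \<bullet> cod2 C \<alpha> \<rhd> \<beta>"
    "\<alpha> \<star> \<beta> = dom2 C \<alpha> \<rhd> \<beta> \<bullet> \<alpha> \<lhd> cod2 C \<beta>"
  using assms interchange[of \<alpha> "id2 C (cod2 C \<alpha>)" "id2 C (dom2 C \<beta>)" \<beta>]
    interchange[of "id2 C (dom2 C \<alpha>)" \<alpha> \<beta> "id2 C (cod2 C \<beta>)"]
  by (simp_all add: rwhisker_def lwhisker_def)

section \<open>Hom categories, vertical inverses and groupoid objects\<close>

lemma category_hom_cat: "A \<in> Obj C \<Longrightarrow> X \<in> Obj C \<Longrightarrow> category (hom_cat C A X)"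
  unfolding category_def hom_cat_def hom_def by auto

lemma hom_cat_simps [simp]:
  "Ob (hom_cat C A X) = hom1 C A X" "src (hom_cat C A X) = dom2 C" "tgt (hom_cat C A X) = cod2 C"
  "ident (hom_cat C A X) = id2 C" "comp (hom_cat C A X) = vcomp C"
  "\<alpha> \<in> Ar (hom_cat C A X) \<longleftrightarrow> \<alpha> \<in> Cell C \<and> dom1 C (dom2 C \<alpha>) = A \<and> cod1 C (dom2 C \<alpha>) = X"
  by (auto simp: hom_cat_def)

text \<open>A vertical inverse has the reversed boundary, hence lies in the same hom category.
  Invertibility can therefore be discussed in \<open>vert_cat C\<close> without naming a hom
  category.\<close>

lemma inverse_arrows_hom_cat:
  "inverse_arrows (hom_cat C A X) \<alpha> \<beta> \<longleftrightarrow> inverse_arrows (vert_cat C) \<alpha> \<beta> \<and> \<alpha> \<in> Ar (hom_cat C A X)"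
  unfolding inverse_arrows_def hom_def by (auto simp: vert_cat_def)

lemma inverse_arrows_vert [simp]:
  "inverse_arrows (vert_cat C) \<alpha> \<beta> \<longleftrightarrow> \<alpha> \<in> Cell C \<and> \<beta> \<in> Cell C \<and> dom2 C \<beta> = cod2 C \<alpha> \<and>
     cod2 C \<beta> = dom2 C \<alpha> \<and> \<alpha> \<bullet> \<beta> = id2 C (dom2 C \<alpha>) \<and> \<beta> \<bullet> \<alpha> = id2 C (cod2 C \<alpha>)"
  unfolding inverse_arrows_def hom_def by (auto simp: vert_cat_def)

lemma inverse_unique:
  assumes "inverse_arrows (vert_cat C) \<alpha> \<beta>" "inverse_arrows (vert_cat C) \<alpha> \<beta>'"
  shows "\<beta> = \<beta>'"
proof -
  have "\<beta> = \<beta> \<bullet> (\<alpha> \<bullet> \<beta>')" using assms by simp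
  also have "\<dots> = (\<beta> \<bullet> \<alpha>) \<bullet> \<beta>'" using assms by (subst vcomp_assoc) auto
  also have "\<dots> = \<beta>'" using assms by simp
  finally show ?thesis .
qed

lemma inv_cellI: "inverse_arrows (vert_cat C) \<alpha> \<beta> \<Longrightarrow> inv_cell C \<alpha> = \<beta>"
  unfolding inv_cell_def using inverse_unique by blast

lemma inv_cell_inverse: "invertible (vert_cat C) \<alpha> \<Longrightarrow> inverse_arrows (vert_cat C) \<alpha> (inv_cell C \<alpha>)"
  unfolding invertible_def using inv_cellI by metis

lemma groupoid_obj_inv:
  assumes "groupoid_obj C A" "\<alpha> \<in> Cell C" "cod1 C (dom2 C \<alpha>) = A"
  shows "inverse_arrows (vert_cat C) \<alpha> (inv_cell C \<alpha>)"
proof -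
  have "invertible (hom_cat C (dom1 C (dom2 C \<alpha>)) A) \<alpha>"
    using assms unfolding groupoid_obj_def is_groupoid_def by simp
  then show ?thesis
    using inv_cell_inverse inverse_arrows_hom_cat unfolding invertible_def by metis
qed

lemma groupoid_objI:
  assumes "A \<in> Obj C" "\<And>\<alpha>. \<alpha> \<in> Cell C \<Longrightarrow> cod1 C (dom2 C \<alpha>) = A \<Longrightarrow> invertible (vert_cat C) \<alpha>"
  shows "groupoid_obj C A"
  using assms unfolding groupoid_obj_def is_groupoid_def
  by (auto simp: category_hom_cat invertible_def inverse_arrows_hom_cat simp del: inverse_arrows_vert)

lemma groupoid_obj_Obj: "groupoid_obj C A \<Longrightarrow> A \<in> Obj C"
  by (simp add: groupoid_obj_def)

lemma rwhisker_inverse: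
  assumes "inverse_arrows (vert_cat C) \<alpha> \<beta>" "f \<in> Mor C" "dom1 C f = cod1 C (dom2 C \<alpha>)"
  shows "inverse_arrows (vert_cat C) (\<alpha> \<lhd> f) (\<beta> \<lhd> f)"
  using assms by (simp flip: rwhisker_vcomp)

lemma lwhisker_inverse:
  assumes "inverse_arrows (vert_cat C) \<alpha> \<beta>" "f \<in> Mor C" "cod1 C f = dom1 C (dom2 C \<alpha>)"
  shows "inverse_arrows (vert_cat C) (f \<rhd> \<alpha>) (f \<rhd> \<beta>)"
  using assms by (simp flip: lwhisker_vcomp)

lemma inverse_arrows_sym: "inverse_arrows (vert_cat C) \<alpha> \<beta> \<Longrightarrow> inverse_arrows (vert_cat C) \<beta> \<alpha>"
  by auto

end

section \<open>Arrow objects and pullbacks\<close>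

text \<open>The vertices of [1] and [2] appear as literals in \<open>fst ev 1\<close> and
  \<open>snd ev (0, 1)\<close>; rewriting \<open>1\<close> to \<open>Suc 0\<close> would stop rules
  about these terms from matching.\<close>

declare One_nat_def [simp del]

lemma ord_cat_simps [simp]:
  "Ob (ord_cat n) = {0..n}" "(i, j) \<in> Ar (ord_cat n) \<longleftrightarrow> i \<le> j \<and> j \<le> n"
  "src (ord_cat n) = fst" "tgt (ord_cat n) = snd" "ident (ord_cat n) = (\<lambda>i. (i, i))"
  "comp (ord_cat n) = (\<lambda>a b. (fst a, snd b))"
  by (auto simp: ord_cat_def)

lemma Ar_ord_cat_1: "Ar (ord_cat 1) = {(0,0), (0,1), (1,1)}"
  by (auto simp: ord_cat_def)

lemma Ar_ord_cat_2: "Ar (ord_cat 2) = {(0,0), (0,1), (0,2), (1,1), (1,2), (2,2)}"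
  by (auto simp: ord_cat_def)

lemma Ob_ord_cat_1: "{0..1} = {0, 1 :: nat}"
  by auto

lemma Ob_ord_cat_2: "{0..2} = {0, 1, 2 :: nat}"
  by auto

lemma fun_cat_simps [simp]:
  "Ob (fun_cat D E) = {F. ext_functor D E F}"
  "(F, G, \<eta>) \<in> Ar (fun_cat D E) \<longleftrightarrow> ext_functor D E F \<and> ext_functor D E G \<and> nat_trans D E F G \<eta>"
  "src (fun_cat D E) = (\<lambda>(F, G, \<eta>). F)" "tgt (fun_cat D E) = (\<lambda>(F, G, \<eta>). G)"
  "ident (fun_cat D E) = (\<lambda>F. (F, F, restrict (\<lambda>x. ident E (fst F x)) (Ob D)))"
  "comp (fun_cat D E) =
     (\<lambda>(F, G, \<eta>) (G', H, \<theta>). (F, H, restrict (\<lambda>x. \<eta> x \<cdot>\<^bsub>E\<^esub> \<theta> x) (Ob D)))"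
  by (auto simp: fun_cat_def)

context two_cat
begin

text \<open>\<open>whisk_mor\<close> and \<open>whisk_cell\<close> are the object part and the arrow
  part of the comparison functor that sits under a \<open>let\<close> in
  \<open>strict_cotensor\<close>; naming them lets its two bijections be treated separately.\<close>

definition whisk_mor ::
  "('j, 'k) cat \<Rightarrow> ('j, 'k, 'm, 'c) functor_data \<Rightarrow> 'm \<Rightarrow> ('j, 'k, 'm, 'c) functor_data" where
  "whisk_mor J ev f =
     (restrict (\<lambda>j. f \<odot> fst ev j) (Ob J), restrict (\<lambda>a. f \<rhd> snd ev a) (Ar J))"

definition whisk_cell ::
  "('j, 'k) cat \<Rightarrow> ('j, 'k, 'm, 'c) functor_data \<Rightarrow> 'c \<Rightarrow>
   ('j, 'k, 'm, 'c) functor_data \<times> ('j, 'k, 'm, 'c) functor_data \<times> ('j \<Rightarrow> 'c)" where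
  "whisk_cell J ev \<alpha> = (whisk_mor J ev (dom2 C \<alpha>), whisk_mor J ev (cod2 C \<alpha>),
     restrict (\<lambda>j. \<alpha> \<lhd> fst ev j) (Ob J))"

lemma strict_cotensor_iff:
  "strict_cotensor C J X P ev \<longleftrightarrow>
     X \<in> Obj C \<and> P \<in> Obj C \<and> is_functor J (hom_cat C P X) ev \<and>
     (\<forall>A\<in>Obj C. cat_iso (hom_cat C A P) (fun_cat J (hom_cat C A X))
        (whisk_mor J ev, whisk_cell J ev))"
  unfolding strict_cotensor_def whisk_mor_def whisk_cell_def Let_def ..

lemma ext_functor_whisk_mor:
  assumes J: "category J" and ev: "is_functor J (hom_cat C P X) ev" and f: "f \<in> hom1 C A P"
  shows "ext_functor J (hom_cat C A X) (whisk_mor J ev f)"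
proof -
  have "fst ev j \<in> hom1 C P X" if "j \<in> Ob J" for j
    using ev that unfolding is_functor_def by simp
  moreover have "snd ev a \<in> Cell C \<and> dom2 C (snd ev a) = fst ev (src J a) \<and>
      cod2 C (snd ev a) = fst ev (tgt J a) \<and> src J a \<in> Ob J \<and> tgt J a \<in> Ob J" if "a \<in> Ar J" for a
    using ev J that unfolding is_functor_def category_def hom_def by auto
  moreover have "snd ev (ident J x) = id2 C (fst ev x) \<and> ident J x \<in> Ar J" if "x \<in> Ob J" for x
    using ev J that unfolding is_functor_def category_def hom_def by auto
  moreover have "snd ev (a \<cdot>\<^bsub>J\<^esub> b) = snd ev a \<bullet> snd ev b \<and> a \<cdot>\<^bsub>J\<^esub> b \<in> Ar J"
    if "a \<in> Ar J" "b \<in> Ar J" "tgt J a = src J b" for a b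
    using ev J that unfolding is_functor_def category_def hom_def by auto
  ultimately show ?thesis
    using f unfolding ext_functor_def is_functor_def whisk_mor_def
    by (auto simp: hom_def)
qed

text \<open>Naturality at \<open>a\<close> is the interchange of \<open>\<alpha>\<close> with the
  2-cell \<open>snd ev a\<close>.\<close>

lemma nat_trans_whisk_cell:
  assumes J: "category J" and ev: "is_functor J (hom_cat C P X) ev"
    and \<alpha>: "\<alpha> \<in> Ar (hom_cat C A P)"
  shows "nat_trans J (hom_cat C A X) (whisk_mor J ev (dom2 C \<alpha>)) (whisk_mor J ev (cod2 C \<alpha>))
    (restrict (\<lambda>j. \<alpha> \<lhd> fst ev j) (Ob J))"
proof -
  have "fst ev j \<in> hom1 C P X" if "j \<in> Ob J" for j
    using ev that unfolding is_functor_def by simp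
  moreover have a: "snd ev a \<in> Cell C \<and> dom2 C (snd ev a) = fst ev (src J a) \<and>
      cod2 C (snd ev a) = fst ev (tgt J a) \<and> src J a \<in> Ob J \<and> tgt J a \<in> Ob J" if "a \<in> Ar J" for a
    using ev J that unfolding is_functor_def category_def hom_def by auto
  moreover have "dom2 C \<alpha> \<rhd> snd ev a \<bullet> \<alpha> \<lhd> fst ev (tgt J a) =
      \<alpha> \<lhd> fst ev (src J a) \<bullet> cod2 C \<alpha> \<rhd> snd ev a" if "a \<in> Ar J" for a
    using hcomp_whisker[of \<alpha> "snd ev a"] a[OF that] \<alpha> calculation(1) by fastforce
  ultimately show ?thesis
    using \<alpha> unfolding nat_trans_def whisk_mor_def by (auto simp: hom_def)
qed

text \<open>The comparison is functorial for every functor \<open>ev\<close>, so verifying a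
  candidate cotensor reduces to the two bijections.\<close>

lemma is_functor_whisk:
  assumes J: "category J" and ev: "is_functor J (hom_cat C P X) ev"
  shows "is_functor (hom_cat C A P) (fun_cat J (hom_cat C A X)) (whisk_mor J ev, whisk_cell J ev)"
proof -
  have *: "fst ev j \<in> hom1 C P X" if "j \<in> Ob J" for j
    using ev that unfolding is_functor_def by simp
  have "snd (whisk_mor J ev, whisk_cell J ev) f
      \<in> hom (fun_cat J (hom_cat C A X)) (whisk_mor J ev (dom2 C f)) (whisk_mor J ev (cod2 C f))"
    if "f \<in> Ar (hom_cat C A P)" for f
    unfolding hom_def whisk_cell_def using nat_trans_whisk_cell[OF J ev that]
      ext_functor_whisk_mor[OF J ev, of "dom2 C f" A] ext_functor_whisk_mor[OF J ev, of "cod2 C f" A]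
      that by simp
  then show ?thesis
    using ext_functor_whisk_mor[OF J ev] * unfolding is_functor_def
    by (auto simp: whisk_cell_def whisk_mor_def restrict_def fun_eq_iff)
qed

lemma category_ord_cat: "category (ord_cat n)"
  unfolding category_def hom_def by auto

text \<open>The cotensor with [1] in elementary terms: a functor out of [1] is a single 2-cell, and
  a natural transformation between two of them is a commutative square. The clause on
  \<open>\<alpha>\<close> is the one-dimensional universal property, the last clause the
  two-dimensional one.\<close>

definition arrow_object :: "'o \<Rightarrow> 'o \<Rightarrow> 'm \<Rightarrow> 'm \<Rightarrow> 'c \<Rightarrow> bool" where
  "arrow_object X P d0 d1 d \<longleftrightarrow>
     d0 \<in> hom1 C P X \<and> d1 \<in> hom1 C P X \<and> d \<in> hom2 C d0 d1 \<and>
     (\<forall>\<alpha>\<in>Cell C. cod1 C (dom2 C \<alpha>) = X \<longrightarrow>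
        (\<exists>!u. u \<in> hom1 C (dom1 C (dom2 C \<alpha>)) P \<and> u \<rhd> d = \<alpha>)) \<and>
     (\<forall>u v a b. u \<in> Mor C \<and> cod1 C u = P \<and> v \<in> hom1 C (dom1 C u) P \<and>
        a \<in> hom2 C (u \<odot> d0) (v \<odot> d0) \<and> b \<in> hom2 C (u \<odot> d1) (v \<odot> d1) \<and>
        a \<bullet> v \<rhd> d = u \<rhd> d \<bullet> b \<longrightarrow>
        (\<exists>!\<theta>. \<theta> \<in> hom2 C u v \<and> \<theta> \<lhd> d0 = a \<and> \<theta> \<lhd> d1 = b))"

lemma is_functor_ord_cat_1:
  "is_functor (ord_cat 1) (hom_cat C A X) F \<longleftrightarrow>
     fst F 0 \<in> hom1 C A X \<and> fst F 1 \<in> hom1 C A X \<and> snd F (0,1) \<in> hom2 C (fst F 0) (fst F 1) \<and>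
     snd F (0,0) = id2 C (fst F 0) \<and> snd F (1,1) = id2 C (fst F 1)"
  unfolding is_functor_def ord_cat_simps Ar_ord_cat_1 Ob_ord_cat_1 by (auto simp: hom_def)

text \<open>The bijection of the comparison functor on objects becomes the one-dimensional property,
  its bijection on arrows the two-dimensional one.\<close>

lemma cotensor_arrow_object:
  assumes "strict_cotensor C (ord_cat 1) X P ev"
  shows "arrow_object X P (fst ev 0) (fst ev 1) (snd ev (0, 1))"
proof -
  let ?J = "ord_cat 1"
  define d0 d1 d where "d0 = fst ev 0" and "d1 = fst ev 1" and "d = snd ev (0, 1)"
  note d_defs = this
  have J: "category ?J" by (rule category_ord_cat)
  have obj: "X \<in> Obj C" "P \<in> Obj C" and ev: "is_functor ?J (hom_cat C P X) ev"
    and iso: "\<And>A. A \<in> Obj C \<Longrightarrow> cat_iso (hom_cat C A P) (fun_cat ?J (hom_cat C A X))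
        (whisk_mor ?J ev, whisk_cell ?J ev)"
    using assms unfolding strict_cotensor_iff by blast+
  have d: "d0 \<in> hom1 C P X" "d1 \<in> hom1 C P X" "d \<in> hom2 C d0 d1"
    "snd ev (0,0) = id2 C d0" "snd ev (1,1) = id2 C d1"
    using ev unfolding is_functor_ord_cat_1 d_defs by blast+
  \<comment> \<open>The value on the arrow (0, 1) determines a functor out of [1]: its boundary
    gives the two vertices, and the other arrows are identities. Extensionality makes the HOL
    functions equal.\<close>
  have whisk_eqI: "whisk_mor ?J ev u = F" if "ext_functor ?J (hom_cat C A X) F"
    "u \<in> hom1 C A P" "u \<rhd> d = snd F (0, 1)" for A u F
  proof -
    have F: "fst F 0 \<in> hom1 C A X" "fst F 1 \<in> hom1 C A X" "snd F (0,1) \<in> hom2 C (fst F 0) (fst F 1)"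
      "snd F (0,0) = id2 C (fst F 0)" "snd F (1,1) = id2 C (fst F 1)"
      "fst F \<in> extensional (Ob ?J)" "snd F \<in> extensional (Ar ?J)"
      using that unfolding ext_functor_def is_functor_ord_cat_1 by blast+
    have "u \<odot> d0 = fst F 0" "u \<odot> d1 = fst F 1"
      using arg_cong[OF that(3), of "dom2 C"] arg_cong[OF that(3), of "cod2 C"] F(3) d that(2) by auto
    then have "u \<odot> fst ev j = fst F j" if "j \<in> {0, 1}" for j
      using that unfolding d_defs by auto
    moreover have "u \<rhd> snd ev a = snd F a" if "a \<in> {(0,0), (0,1), (1,1)}" for a
      using that \<open>u \<rhd> d = snd F (0, 1)\<close> d F \<open>u \<in> hom1 C A P\<close> \<open>u \<odot> d0 = fst F 0\<close> \<open>u \<odot> d1 = fst F 1\<close>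
      by (auto simp flip: d_defs)
    ultimately show ?thesis
      unfolding whisk_mor_def ord_cat_simps Ar_ord_cat_1 Ob_ord_cat_1
      using F(6,7)[unfolded ord_cat_simps Ar_ord_cat_1 Ob_ord_cat_1]
      by (intro prod_eqI) (auto simp: extensional_def fun_eq_iff)
  qed
  have 1: "\<exists>!u. u \<in> hom1 C (dom1 C (dom2 C \<alpha>)) P \<and> u \<rhd> d = \<alpha>"
    if \<alpha>: "\<alpha> \<in> Cell C" "cod1 C (dom2 C \<alpha>) = X" for \<alpha>
  proof -
    let ?A = "dom1 C (dom2 C \<alpha>)"
    \<comment> \<open>The functor out of [1] that names \<open>\<alpha>\<close>;
      \<open>restrict\<close> makes it an element of the functor category.\<close>
    define F :: "(nat, nat \<times> nat, 'm, 'c) functor_data" where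
      "F = (restrict (\<lambda>j. if j = 0 then dom2 C \<alpha> else cod2 C \<alpha>) (Ob ?J),
            restrict (\<lambda>a. if a = (0,0) then id2 C (dom2 C \<alpha>)
              else if a = (1,1) then id2 C (cod2 C \<alpha>) else \<alpha>) (Ar ?J))"
    have F01: "snd F (0, 1) = \<alpha>" by (simp add: F_def)
    have F: "ext_functor ?J (hom_cat C ?A X) F"
      unfolding ext_functor_def is_functor_ord_cat_1 F_def using \<alpha> by auto
    have bij: "bij_betw (whisk_mor ?J ev) (hom1 C ?A P) {F. ext_functor ?J (hom_cat C ?A X) F}"
      using iso[of ?A] \<alpha> unfolding cat_iso_def by simp
    have "\<exists>u \<in> hom1 C ?A P. whisk_mor ?J ev u = F"
      using bij F unfolding bij_betw_def by (metis imageE mem_Collect_eq)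
    then obtain u where u: "u \<in> hom1 C ?A P" "whisk_mor ?J ev u = F"
      by blast
    have "u \<rhd> d = \<alpha>"
      using u(2) F01 unfolding whisk_mor_def d_defs by auto
    moreover have "v = u" if "v \<in> hom1 C ?A P" "v \<rhd> d = \<alpha>" for v
      using whisk_eqI[OF F that(1)] that F01 u bij unfolding bij_betw_def inj_on_def by metis
    ultimately show ?thesis using u(1) by blast
  qed
  have 2: "\<exists>!\<theta>. \<theta> \<in> hom2 C u v \<and> \<theta> \<lhd> d0 = a \<and> \<theta> \<lhd> d1 = b"
    if u: "u \<in> Mor C" "cod1 C u = P" "v \<in> hom1 C (dom1 C u) P"
      and a: "a \<in> hom2 C (u \<odot> d0) (v \<odot> d0)" and b: "b \<in> hom2 C (u \<odot> d1) (v \<odot> d1)"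
      and ab: "a \<bullet> v \<rhd> d = u \<rhd> d \<bullet> b" for u v a b
  proof -
    let ?A = "dom1 C u"
    define \<eta> where "\<eta> = restrict (\<lambda>j::nat. if j = 0 then a else b) (Ob ?J)"
    define W where "W = (whisk_mor ?J ev u, whisk_mor ?J ev v, \<eta>)"
    have uv: "u \<in> hom1 C ?A P" "v \<in> hom1 C ?A P" using u by auto
    have "nat_trans ?J (hom_cat C ?A X) (whisk_mor ?J ev u) (whisk_mor ?J ev v) \<eta>"
      unfolding nat_trans_def Ar_ord_cat_1
      using u a b ab d by (auto simp: \<eta>_def whisk_mor_def hom_def Ob_ord_cat_1 d_defs[symmetric]
          Ar_ord_cat_1 )
    then have W: "W \<in> Ar (fun_cat ?J (hom_cat C ?A X))"
      using ext_functor_whisk_mor[OF J ev] uv by (simp add: W_def del: hom1_iff)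
    have bij: "bij_betw (whisk_cell ?J ev) (Ar (hom_cat C ?A P)) (Ar (fun_cat ?J (hom_cat C ?A X)))"
      and bij0: "bij_betw (whisk_mor ?J ev) (hom1 C ?A P) {F. ext_functor ?J (hom_cat C ?A X) F}"
      using iso[of ?A] u unfolding cat_iso_def by auto
    obtain \<theta> where \<theta>: "\<theta> \<in> Ar (hom_cat C ?A P)" "whisk_cell ?J ev \<theta> = W"
      using bij_betw_imp_surj_on[OF bij] W by (metis imageE)
    \<comment> \<open>Arrows of \<open>fun_cat\<close> carry their source and target functors, so
      injectivity on objects recovers the boundary of \<open>\<theta>\<close>.\<close>
    have "dom2 C \<theta> = u" "cod2 C \<theta> = v"
      by (rule inj_onD[OF bij_betw_imp_inj_on[OF bij0]]; use \<theta> uv in \<open>simp add: W_def whisk_cell_def\<close>)+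
    moreover have "\<theta> \<lhd> d0 = a" "\<theta> \<lhd> d1 = b"
      using \<theta>(2) unfolding W_def whisk_cell_def \<eta>_def d_defs
      by (auto simp: restrict_def fun_eq_iff split: if_splits)
    moreover have "\<theta>' = \<theta>" if "\<theta>' \<in> hom2 C u v \<and> \<theta>' \<lhd> d0 = a \<and> \<theta>' \<lhd> d1 = b" for \<theta>'
    proof -
      have "whisk_cell ?J ev \<theta>' = W"
        using that unfolding W_def whisk_cell_def \<eta>_def d_defs ord_cat_simps Ob_ord_cat_1
        by (auto simp: restrict_def fun_eq_iff )
      moreover have "\<theta>' \<in> Ar (hom_cat C ?A P)" using that u by auto
      ultimately show ?thesis
        using inj_onD[OF bij_betw_imp_inj_on[OF bij]] \<theta> by metis
    qed
    ultimately show ?thesis using \<theta>(1) hom2_iff by (metis hom_cat_simps(6))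
  qed
  show ?thesis
    unfolding arrow_object_def d_defs[symmetric]
    by (intro conjI ballI allI impI d 1 2; (elim conjE)?; assumption)
qed

section \<open>Unique fillers for strict pullbacks and arrow objects\<close>

lemma strict_pullback_mor:
  assumes "strict_pullback C f g p q" "u \<in> Mor C" "v \<in> hom1 C (dom1 C u) (dom1 C g)"
    "cod1 C u = dom1 C f" "u \<odot> f = v \<odot> g"
  shows "\<exists>!w. w \<in> hom1 C (dom1 C u) (dom1 C p) \<and> w \<odot> p = u \<and> w \<odot> q = v"
proof -
  have "bij_betw (\<lambda>u. (u \<odot> p, u \<odot> q)) (hom1 C (dom1 C u) (dom1 C p))
      {(x, y). x \<in> hom1 C (dom1 C u) (dom1 C f) \<and> y \<in> hom1 C (dom1 C u) (dom1 C g) \<and> x \<odot> f = y \<odot> g}"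
    using assms unfolding strict_pullback_def cat_iso_def
    by (auto simp: fibre_prod_cat_def post_def)
  moreover have "(u, v) \<in> {(x, y). x \<in> hom1 C (dom1 C u) (dom1 C f) \<and>
      y \<in> hom1 C (dom1 C u) (dom1 C g) \<and> x \<odot> f = y \<odot> g}"
    using assms by auto
  ultimately have "\<exists>!w. w \<in> hom1 C (dom1 C u) (dom1 C p) \<and> (u, v) = (w \<odot> p, w \<odot> q)"
    unfolding bij_betw_iff_bijections by (smt (verit, best))
  then show ?thesis unfolding prod.inject by (metis (no_types, lifting))
qed

text \<open>The bijection on arrows produces a 2-cell of unspecified boundary; its ends are
  identified with \<open>u\<close> and \<open>v\<close> because morphisms into a pullback are
  determined by their projections.\<close>

lemma strict_pullback_cell:
  assumes "strict_pullback C f g p q" "u \<in> Mor C" "v \<in> hom1 C (dom1 C u) (dom1 C p)"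
    "cod1 C u = dom1 C p"
    "a \<in> hom2 C (u \<odot> p) (v \<odot> p)" "b \<in> hom2 C (u \<odot> q) (v \<odot> q)" "a \<lhd> f = b \<lhd> g"
  shows "\<exists>!\<theta>. \<theta> \<in> hom2 C u v \<and> \<theta> \<lhd> p = a \<and> \<theta> \<lhd> q = b"
proof -
  let ?A = "dom1 C u"
  have pq: "p \<in> Mor C" "q \<in> Mor C" "dom1 C q = dom1 C p" "cod1 C p = dom1 C f" "cod1 C q = dom1 C g"
    "f \<in> Mor C" "g \<in> Mor C" "cod1 C f = cod1 C g" "p \<odot> f = q \<odot> g"
    using assms(1) unfolding strict_pullback_def by auto
  have "bij_betw (\<lambda>\<alpha>. (\<alpha> \<lhd> p, \<alpha> \<lhd> q)) (Ar (hom_cat C ?A (dom1 C p)))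
      {(x, y). x \<in> Ar (hom_cat C ?A (dom1 C f)) \<and> y \<in> Ar (hom_cat C ?A (dom1 C g)) \<and> x \<lhd> f = y \<lhd> g}"
    using assms unfolding strict_pullback_def cat_iso_def
    by (auto simp: fibre_prod_cat_def post_def)
  moreover have "(a, b) \<in> {(x, y). x \<in> Ar (hom_cat C ?A (dom1 C f)) \<and>
      y \<in> Ar (hom_cat C ?A (dom1 C g)) \<and> x \<lhd> f = y \<lhd> g}"
    using assms pq by auto
  ultimately have ex: "\<exists>!\<theta>. \<theta> \<in> Ar (hom_cat C ?A (dom1 C p)) \<and> (a, b) = (\<theta> \<lhd> p, \<theta> \<lhd> q)"
    unfolding bij_betw_iff_bijections by (smt (verit, best))
  then obtain \<theta> where \<theta>: "\<theta> \<in> Ar (hom_cat C ?A (dom1 C p))" "a = \<theta> \<lhd> p" "b = \<theta> \<lhd> q"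
    by auto
  have eq: "x = y" if "x \<in> hom1 C ?A (dom1 C p)" "y \<in> hom1 C ?A (dom1 C p)"
    "x \<odot> p = y \<odot> p" "x \<odot> q = y \<odot> q" for x y
  proof -
    have "(x \<odot> p) \<odot> f = (x \<odot> q) \<odot> g" using that pq by simp
    then show ?thesis
      using strict_pullback_mor[OF assms(1), of "x \<odot> p" "x \<odot> q"] that pq by auto
  qed
  have "dom2 C \<theta> = u" "cod2 C \<theta> = v"
    by (rule eq; use \<theta> assms pq in auto)+
  then have "\<theta> \<in> hom2 C u v" using \<theta> by auto
  moreover have "\<theta>' = \<theta>" if "\<theta>' \<in> hom2 C u v" "\<theta>' \<lhd> p = a" "\<theta>' \<lhd> q = b" for \<theta>'
  proof -
    have "\<theta>' \<in> Ar (hom_cat C ?A (dom1 C p))" using that assms by auto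
    then show ?thesis using ex \<theta> that by (metis (no_types, lifting))
  qed
  ultimately show ?thesis using \<theta> by (metis (no_types, lifting))
qed

lemma arrow_object_typed:
  assumes "arrow_object X P d0 d1 d"
  shows "d0 \<in> Mor C" "dom1 C d0 = P" "cod1 C d0 = X" "d1 \<in> Mor C" "dom1 C d1 = P" "cod1 C d1 = X"
    "d \<in> Cell C" "dom2 C d = d0" "cod2 C d = d1" "P \<in> Obj C" "X \<in> Obj C"
proof -
  show t: "d0 \<in> Mor C" "dom1 C d0 = P" "cod1 C d0 = X" "d1 \<in> Mor C" "dom1 C d1 = P"
    "cod1 C d1 = X" "d \<in> Cell C" "dom2 C d = d0" "cod2 C d = d1"
    using assms unfolding arrow_object_def by auto
  show "P \<in> Obj C" "X \<in> Obj C" using t by auto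
qed

lemma arrow_object_ex1:
  assumes "arrow_object X P d0 d1 d" "\<alpha> \<in> Cell C" "cod1 C (dom2 C \<alpha>) = X"
  shows "\<exists>!u. u \<in> hom1 C (dom1 C (dom2 C \<alpha>)) P \<and> u \<rhd> d = \<alpha>"
  using assms unfolding arrow_object_def by blast

lemma arrow_object_cell_ex1:
  assumes "arrow_object X P d0 d1 d" "u \<in> Mor C" "cod1 C u = P" "v \<in> hom1 C (dom1 C u) P"
    "a \<in> hom2 C (u \<odot> d0) (v \<odot> d0)" "b \<in> hom2 C (u \<odot> d1) (v \<odot> d1)" "a \<bullet> v \<rhd> d = u \<rhd> d \<bullet> b"
  shows "\<exists>!\<theta>. \<theta> \<in> hom2 C u v \<and> \<theta> \<lhd> d0 = a \<and> \<theta> \<lhd> d1 = b"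
  using assms unfolding arrow_object_def by blast

lemma arrow_object_obtain:
  assumes "arrow_object X P d0 d1 d" "\<alpha> \<in> Cell C" "cod1 C (dom2 C \<alpha>) = X"
  obtains u where "u \<in> Mor C" "dom1 C u = dom1 C (dom2 C \<alpha>)" "cod1 C u = P" "u \<rhd> d = \<alpha>"
    "u \<odot> d0 = dom2 C \<alpha>" "u \<odot> d1 = cod2 C \<alpha>"
proof -
  obtain u where "u \<in> hom1 C (dom1 C (dom2 C \<alpha>)) P" "u \<rhd> d = \<alpha>"
    using arrow_object_ex1[OF assms] by blast
  then show ?thesis using that[of u] arrow_object_typed[OF assms(1)] by auto
qed

lemma arrow_object_inj:
  assumes "arrow_object X P d0 d1 d" "u \<in> hom1 C A P" "v \<in> hom1 C A P" "u \<rhd> d = v \<rhd> d"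
  shows "u = v"
proof -
  have "u \<rhd> d \<in> Cell C \<and> dom1 C (dom2 C (u \<rhd> d)) = A \<and> cod1 C (dom2 C (u \<rhd> d)) = X"
    using assms(2) arrow_object_typed[OF assms(1)] by simp
  then show ?thesis using arrow_object_ex1[OF assms(1), of "u \<rhd> d"] assms(2-4) by metis
qed

lemma arrow_object_cell_obtain:
  assumes "arrow_object X P d0 d1 d" "u \<in> Mor C" "cod1 C u = P" "v \<in> hom1 C (dom1 C u) P"
    "a \<in> hom2 C (u \<odot> d0) (v \<odot> d0)" "b \<in> hom2 C (u \<odot> d1) (v \<odot> d1)" "a \<bullet> v \<rhd> d = u \<rhd> d \<bullet> b"
  obtains \<theta> where "\<theta> \<in> Cell C" "dom2 C \<theta> = u" "cod2 C \<theta> = v" "\<theta> \<lhd> d0 = a" "\<theta> \<lhd> d1 = b"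
  using arrow_object_cell_ex1[OF assms] by auto

text \<open>The square condition of the two-dimensional property holds for every 2-cell into
  \<open>P\<close>, by interchange with \<open>d\<close>; hence its uniqueness part separates
  2-cells with equal boundary by their two components.\<close>

lemma arrow_object_cell_inj:
  assumes "arrow_object X P d0 d1 d" "\<theta> \<in> Cell C" "cod1 C (dom2 C \<theta>) = P"
    "\<theta>' \<in> hom2 C (dom2 C \<theta>) (cod2 C \<theta>)" "\<theta> \<lhd> d0 = \<theta>' \<lhd> d0" "\<theta> \<lhd> d1 = \<theta>' \<lhd> d1"
  shows "\<theta> = \<theta>'"
proof -
  note t = arrow_object_typed[OF assms(1)]
  have "\<exists>!\<phi>. \<phi> \<in> hom2 C (dom2 C \<theta>) (cod2 C \<theta>) \<and> \<phi> \<lhd> d0 = \<theta> \<lhd> d0 \<and> \<phi> \<lhd> d1 = \<theta> \<lhd> d1"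
  proof (rule arrow_object_cell_ex1[OF assms(1)])
    show "\<theta> \<lhd> d0 \<bullet> cod2 C \<theta> \<rhd> d = dom2 C \<theta> \<rhd> d \<bullet> \<theta> \<lhd> d1"
      using hcomp_whisker[of \<theta> d] assms t by simp
  qed (use assms t in auto)
  then show ?thesis using assms(2,4-6) by (metis hom2_iff)
qed

lemma is_functor_post:
  assumes "f \<in> hom1 C P X"
  shows "is_functor (hom_cat C A P) (hom_cat C A X) (post C f)"
  using assms unfolding is_functor_def post_def by (auto simp: hom_def)

text \<open>An invertible \<open>b\<close> out of the target of an arrow is lifted by composing the
  arrow with \<open>b\<close> while its source stays fixed. This entitles \<open>d1\<close> to be
  pulled back along \<open>d0\<close> in a pita 2-category.\<close>

lemma isofibration_d1:
  assumes ar: "arrow_object X P d0 d1 d"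
  shows "isofibration C d1"
proof -
  note t = arrow_object_typed[OF ar]
  have "\<exists>a\<in>Ar (hom_cat C A P). dom2 C a = u \<and> invertible (hom_cat C A P) a \<and> a \<lhd> d1 = b"
    if u: "u \<in> hom1 C A P" and b: "b \<in> Ar (hom_cat C A X)" "dom2 C b = u \<odot> d1"
      and inv: "invertible (hom_cat C A X) b" for A u b
  proof -
    obtain b' where b': "b' \<in> Cell C" "dom2 C b' = cod2 C b" "cod2 C b' = dom2 C b"
      "b \<bullet> b' = id2 C (dom2 C b)" "b' \<bullet> b = id2 C (cod2 C b)"
      using inv unfolding invertible_def inverse_arrows_hom_cat by auto
    obtain v where v: "v \<in> Mor C" "dom1 C v = A" "cod1 C v = P" "v \<rhd> d = u \<rhd> d \<bullet> b"
      "v \<odot> d0 = u \<odot> d0" "v \<odot> d1 = cod2 C b"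
      by (rule arrow_object_obtain[OF ar, of "u \<rhd> d \<bullet> b"]) (use u b t in auto)
    obtain \<theta> where \<theta>: "\<theta> \<in> Cell C" "dom2 C \<theta> = u" "cod2 C \<theta> = v" "\<theta> \<lhd> d0 = id2 C (u \<odot> d0)"
      "\<theta> \<lhd> d1 = b"
      by (rule arrow_object_cell_obtain[OF ar, of u v "id2 C (u \<odot> d0)" b]) (use u b t v in auto)
    \<comment> \<open>The candidate inverse has the inverted components of \<open>\<theta>\<close>;
      both composites are then recognized as identities component by component.\<close>
    obtain \<theta>' where \<theta>': "\<theta>' \<in> Cell C" "dom2 C \<theta>' = v" "cod2 C \<theta>' = u" "\<theta>' \<lhd> d0 = id2 C (u \<odot> d0)"
      "\<theta>' \<lhd> d1 = b'"
      by (rule arrow_object_cell_obtain[OF ar, of v u "id2 C (u \<odot> d0)" b']) (use u b t v b' in auto)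
    have "\<theta> \<bullet> \<theta>' = id2 C u" "\<theta>' \<bullet> \<theta> = id2 C v"
      by (rule arrow_object_cell_inj[OF ar]; use u b t v b' \<theta> \<theta>' in simp)+
    then have "inverse_arrows (hom_cat C A P) \<theta> \<theta>'"
      unfolding inverse_arrows_hom_cat using u \<theta> \<theta>' by simp
    then show ?thesis using \<theta> u unfolding invertible_def by (intro bexI[of _ \<theta>]) auto
  qed
  then show ?thesis
    unfolding isofibration_def isofibration_functor_def
    using is_functor_post[of d1 P X] t by (auto simp: post_def)
qed

section \<open>The cotensor with [2]\<close>

lemma is_functor_ord_cat_2:
  "is_functor (ord_cat 2) (hom_cat C A X) F \<longleftrightarrow>
     fst F 0 \<in> hom1 C A X \<and> fst F 1 \<in> hom1 C A X \<and> fst F 2 \<in> hom1 C A X \<and>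
     snd F (0,1) \<in> hom2 C (fst F 0) (fst F 1) \<and> snd F (1,2) \<in> hom2 C (fst F 1) (fst F 2) \<and>
     snd F (0,0) = id2 C (fst F 0) \<and> snd F (1,1) = id2 C (fst F 1) \<and> snd F (2,2) = id2 C (fst F 2) \<and>
     snd F (0,2) = snd F (0,1) \<bullet> snd F (1,2)"
  unfolding is_functor_def ord_cat_simps Ar_ord_cat_2 Ob_ord_cat_2 by (auto simp: hom_def)

text \<open>[2] is generated by the arrows (0, 1) and (1, 2): their boundaries give the vertices,
  and (0, 2) is their composite.\<close>

lemma ext_functor_ord_cat_2_eqI:
  assumes F: "ext_functor (ord_cat 2) (hom_cat C A X) F" and G: "ext_functor (ord_cat 2) (hom_cat C A X) G"
    and eq: "snd F (0,1) = snd G (0,1)" "snd F (1,2) = snd G (1,2)"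
  shows "F = G"
proof -
  note F' = F[unfolded ext_functor_def is_functor_ord_cat_2]
  note G' = G[unfolded ext_functor_def is_functor_ord_cat_2]
  have 0: "fst F 0 = fst G 0" "fst F 1 = fst G 1" "fst F 2 = fst G 2"
    using eq F' G' hom2_iff by metis+
  then have "fst F j = fst G j" if "j \<in> {0, 1, 2}" for j
    using that by auto
  moreover have "snd F a = snd G a" if "a \<in> {(0,0), (0,1), (0,2), (1,1), (1,2), (2,2)}" for a
  proof -
    consider "a = (0,0)" | "a = (0,1)" | "a = (0,2)" | "a = (1,1)" | "a = (1,2)" | "a = (2,2)"
      using \<open>a \<in> _\<close> by blast
    then show ?thesis using eq 0 F' G' by cases simp_all
  qed
  moreover have "fst F \<in> extensional {0,1,2}" "fst G \<in> extensional {0,1,2}"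
    "snd F \<in> extensional {(0,0), (0,1), (0,2), (1,1), (1,2), (2,2)}"
    "snd G \<in> extensional {(0,0), (0,1), (0,2), (1,1), (1,2), (2,2)}"
    using F' G' unfolding ord_cat_simps Ar_ord_cat_2 Ob_ord_cat_2 by blast+
  ultimately show ?thesis
    by (intro prod_eqI) (metis extensionalityI)+
qed

text \<open>[2] is two copies of [1] glued at an end, so its cotensor is the pullback of two arrow
  objects, matching the target of the first arrow with the source of the second. Prescribing
  \<open>ew\<close> on the two generating arrows fixes the rest by functoriality.\<close>

lemma strict_cotensor_ord_cat_2I:
  assumes ar: "arrow_object X P d0 d1 d" and pb: "strict_pullback C d1 d0 p q"
    and ew: "is_functor (ord_cat 2) (hom_cat C (dom1 C p) X) ew"
    and ew01: "snd ew (0,1) = p \<rhd> d" and ew12: "snd ew (1,2) = q \<rhd> d"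
  shows "strict_cotensor C (ord_cat 2) X (dom1 C p) ew"
proof -
  let ?J = "ord_cat 2" and ?Q = "dom1 C p"
  note t = arrow_object_typed[OF ar]
  note J = category_ord_cat[of 2]
  have pq: "p \<in> Mor C" "q \<in> Mor C" "dom1 C q = ?Q" "cod1 C p = P" "cod1 C q = P"
    and comm: "p \<odot> d1 = q \<odot> d0"
    using pb t unfolding strict_pullback_def by auto
  note ew' = ew[unfolded is_functor_ord_cat_2 ew01 ew12]
  have ew012: "fst ew 0 = p \<odot> d0" "fst ew 1 = p \<odot> d1" "fst ew 1 = q \<odot> d0" "fst ew 2 = q \<odot> d1"
    using ew' pq comm t by auto
  have Ar: "(0,1) \<in> Ar ?J" "(1,2) \<in> Ar ?J" "(0::nat) \<in> Ob ?J" "1 \<in> Ob ?J" "2 \<in> Ob ?J" by auto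
  have snd_whisk: "snd (whisk_mor ?J ew u) (0,1) = (u \<odot> p) \<rhd> d"
      "snd (whisk_mor ?J ew u) (1,2) = (u \<odot> q) \<rhd> d"
    if "u \<in> hom1 C A ?Q" for A u
    using that ew01 ew12 t pq unfolding whisk_mor_def by auto
  have whisk_inj: "u = v" if uv: "u \<in> hom1 C A ?Q" "v \<in> hom1 C A ?Q"
    and eq: "whisk_mor ?J ew u = whisk_mor ?J ew v" for A u v
  proof -
    have "(u \<odot> p) \<rhd> d = (v \<odot> p) \<rhd> d" "(u \<odot> q) \<rhd> d = (v \<odot> q) \<rhd> d"
      using snd_whisk uv eq by metis+
    then have "u \<odot> p = v \<odot> p" "u \<odot> q = v \<odot> q"
      using uv pq by (auto intro!: arrow_object_inj[OF ar, of _ A] simp del: lwhisker_comp)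
    moreover have "\<exists>!w. w \<in> hom1 C (dom1 C (u \<odot> p)) ?Q \<and> w \<odot> p = u \<odot> p \<and> w \<odot> q = u \<odot> q"
      by (rule strict_pullback_mor[OF pb]) (use uv pq t comm in auto)
    ultimately show ?thesis using uv pq hom1_iff comp1_props(2) by metis
  qed
  have whisk_surj: "\<exists>u\<in>hom1 C A ?Q. whisk_mor ?J ew u = F"
    if F: "ext_functor ?J (hom_cat C A X) F" and A: "A \<in> Obj C" for A F
  proof -
    note F' = F[unfolded ext_functor_def is_functor_ord_cat_2]
    obtain u where u: "u \<in> Mor C" "dom1 C u = A" "cod1 C u = P" "u \<rhd> d = snd F (0,1)"
      "u \<odot> d0 = fst F 0" "u \<odot> d1 = fst F 1"
      by (rule arrow_object_obtain[OF ar, of "snd F (0,1)"]) (use F' in auto)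
    obtain v where v: "v \<in> Mor C" "dom1 C v = A" "cod1 C v = P" "v \<rhd> d = snd F (1,2)"
      "v \<odot> d0 = fst F 1" "v \<odot> d1 = fst F 2"
      by (rule arrow_object_obtain[OF ar, of "snd F (1,2)"]) (use F' in auto)
    obtain w where w: "w \<in> hom1 C A ?Q" "w \<odot> p = u" "w \<odot> q = v"
      using strict_pullback_mor[OF pb, of u v] u v t by auto
    have "whisk_mor ?J ew w = F"
    proof (rule ext_functor_ord_cat_2_eqI[OF _ F])
      show "ext_functor ?J (hom_cat C A X) (whisk_mor ?J ew w)"
        by (rule ext_functor_whisk_mor[OF J ew w(1)])
    qed (use snd_whisk[OF w(1)] w u v in simp_all)
    then show ?thesis using w(1) by blast
  qed
  have cell_inj: "\<theta> = \<theta>'" if \<theta>: "\<theta> \<in> Ar (hom_cat C A ?Q)" "\<theta>' \<in> Ar (hom_cat C A ?Q)"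
    and eq: "whisk_cell ?J ew \<theta> = whisk_cell ?J ew \<theta>'" for A \<theta> \<theta>'
  proof -
    have dc: "dom2 C \<theta>' = dom2 C \<theta>" "cod2 C \<theta>' = cod2 C \<theta>"
      by (rule whisk_inj[of _ A]; use \<theta> eq in \<open>simp add: whisk_cell_def\<close>)+
    have "\<theta> \<lhd> fst ew j = \<theta>' \<lhd> fst ew j" if "j \<in> Ob ?J" for j
      using arg_cong[OF eq, of "\<lambda>W. snd (snd W) j"] that unfolding whisk_cell_def by simp
    note eqs = this[OF Ar(3), unfolded ew012(1)] this[OF Ar(4), unfolded ew012(2)]
      this[OF Ar(4), unfolded ew012(3)] this[OF Ar(5), unfolded ew012(4)]
    have p: "\<theta> \<lhd> p = \<theta>' \<lhd> p"
      by (rule arrow_object_cell_inj[OF ar]) (use \<theta> dc eqs pq t in auto)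
    have q: "\<theta> \<lhd> q = \<theta>' \<lhd> q"
      by (rule arrow_object_cell_inj[OF ar]) (use \<theta> dc eqs pq t in auto)
    have "\<exists>!\<phi>. \<phi> \<in> hom2 C (dom2 C \<theta>) (cod2 C \<theta>) \<and> \<phi> \<lhd> p = \<theta> \<lhd> p \<and> \<phi> \<lhd> q = \<theta> \<lhd> q"
      by (rule strict_pullback_cell[OF pb])
        (use \<theta> pq t in \<open>auto simp: comm simp flip: rwhisker_comp\<close>)
    then show ?thesis using \<theta> dc p q hom2_iff hom_cat_simps(6) by metis
  qed
  have cell_surj: "\<exists>\<theta>\<in>Ar (hom_cat C A ?Q). whisk_cell ?J ew \<theta> = W"
    if W: "W \<in> Ar (fun_cat ?J (hom_cat C A X))" and A: "A \<in> Obj C" for A W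
  proof -
    obtain F G \<eta> where W_eq: "W = (F, G, \<eta>)" by (metis prod_cases3)
    have FG: "ext_functor ?J (hom_cat C A X) F" "ext_functor ?J (hom_cat C A X) G"
      and \<eta>: "nat_trans ?J (hom_cat C A X) F G \<eta>"
      using W unfolding W_eq by simp_all
    obtain u where u: "u \<in> hom1 C A ?Q" "whisk_mor ?J ew u = F" using whisk_surj[OF FG(1) A] by blast
    obtain v where v: "v \<in> hom1 C A ?Q" "whisk_mor ?J ew v = G" using whisk_surj[OF FG(2) A] by blast
    have F: "fst F 0 = u \<odot> p \<odot> d0" "fst F 1 = u \<odot> p \<odot> d1" "fst F 2 = u \<odot> q \<odot> d1"
      "snd F (0,1) = u \<odot> p \<rhd> d" "snd F (1,2) = u \<odot> q \<rhd> d"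
      using snd_whisk[OF u(1)] ew012 u pq t unfolding whisk_mor_def by auto
    have G: "fst G 0 = v \<odot> p \<odot> d0" "fst G 1 = v \<odot> p \<odot> d1" "fst G 2 = v \<odot> q \<odot> d1"
      "snd G (0,1) = v \<odot> p \<rhd> d" "snd G (1,2) = v \<odot> q \<rhd> d"
      using snd_whisk[OF v(1)] ew012 v pq t unfolding whisk_mor_def by auto
    have nat: "\<eta> j \<in> hom2 C (fst F j) (fst G j)" if "j \<in> Ob ?J" for j
      using \<eta> that unfolding nat_trans_def hom_def by simp
    note \<eta>j = nat[OF Ar(3)] nat[OF Ar(4)] nat[OF Ar(5)]
    have sq: "snd F (i, j) \<bullet> \<eta> j = \<eta> i \<bullet> snd G (i, j)" if "(i, j) \<in> Ar ?J" for i j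
      using \<eta> that unfolding nat_trans_def by fastforce
    \<comment> \<open>The two squares of \<open>\<eta>\<close> share the component
      \<open>\<eta> 1\<close>; this is the compatibility over the common vertex that glues
      \<open>\<theta>p\<close> and \<open>\<theta>q\<close> in the pullback.\<close>
    obtain \<theta>p where \<theta>p: "\<theta>p \<in> Cell C" "dom2 C \<theta>p = u \<odot> p" "cod2 C \<theta>p = v \<odot> p"
      "\<theta>p \<lhd> d0 = \<eta> 0" "\<theta>p \<lhd> d1 = \<eta> 1"
      by (rule arrow_object_cell_obtain[OF ar, of "u \<odot> p" "v \<odot> p" "\<eta> 0" "\<eta> 1"])
        (use u v pq \<eta>j sq[OF Ar(1)] F G in auto)
    have e: "u \<odot> p \<odot> d1 = u \<odot> q \<odot> d0" "v \<odot> p \<odot> d1 = v \<odot> q \<odot> d0"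
      using u v pq t comm by simp_all
    obtain \<theta>q where \<theta>q: "\<theta>q \<in> Cell C" "dom2 C \<theta>q = u \<odot> q" "cod2 C \<theta>q = v \<odot> q"
      "\<theta>q \<lhd> d0 = \<eta> 1" "\<theta>q \<lhd> d1 = \<eta> 2"
      by (rule arrow_object_cell_obtain[OF ar, of "u \<odot> q" "v \<odot> q" "\<eta> 1" "\<eta> 2"])
        (use u v pq \<eta>j sq[OF Ar(2)] F G e in auto)
    have "\<exists>!\<theta>. \<theta> \<in> hom2 C u v \<and> \<theta> \<lhd> p = \<theta>p \<and> \<theta> \<lhd> q = \<theta>q"
      by (rule strict_pullback_cell[OF pb]) (use u v pq \<theta>p \<theta>q t in auto)
    then obtain \<theta> where \<theta>: "\<theta> \<in> hom2 C u v" "\<theta> \<lhd> p = \<theta>p" "\<theta> \<lhd> q = \<theta>q" by blast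
    have "\<theta> \<lhd> fst ew 0 = \<eta> 0" "\<theta> \<lhd> fst ew 1 = \<eta> 1" "\<theta> \<lhd> fst ew 2 = \<eta> 2"
      unfolding ew012(1,2,4) using \<theta> u pq t \<theta>p \<theta>q by auto
    then have "restrict (\<lambda>j. \<theta> \<lhd> fst ew j) (Ob ?J) = \<eta>"
      using \<eta> unfolding nat_trans_def ord_cat_simps Ob_ord_cat_2
      by (auto simp: fun_eq_iff extensional_def)
    then have "whisk_cell ?J ew \<theta> = W"
      unfolding whisk_cell_def W_eq using \<theta> u v by simp
    moreover have "\<theta> \<in> Ar (hom_cat C A ?Q)" using \<theta> u by auto
    ultimately show ?thesis by blast
  qed
  have "cat_iso (hom_cat C A ?Q) (fun_cat ?J (hom_cat C A X)) (whisk_mor ?J ew, whisk_cell ?J ew)"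
    if A: "A \<in> Obj C" for A
  proof -
    note fu = is_functor_whisk[OF J ew, of A]
    have "bij_betw (whisk_mor ?J ew) (Ob (hom_cat C A ?Q)) (Ob (fun_cat ?J (hom_cat C A X)))"
    proof (rule bij_betw_imageI)
      show "inj_on (whisk_mor ?J ew) (Ob (hom_cat C A ?Q))"
        by (rule inj_onI) (metis whisk_inj hom_cat_simps(1))
      show "whisk_mor ?J ew ` Ob (hom_cat C A ?Q) = Ob (fun_cat ?J (hom_cat C A X))"
        unfolding hom_cat_simps(1) fun_cat_simps(1)
        using whisk_surj[OF _ A] ext_functor_whisk_mor[OF J ew] by blast
    qed
    moreover have "bij_betw (whisk_cell ?J ew) (Ar (hom_cat C A ?Q)) (Ar (fun_cat ?J (hom_cat C A X)))"
    proof (rule bij_betw_imageI)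
      show "inj_on (whisk_cell ?J ew) (Ar (hom_cat C A ?Q))"
        by (rule inj_onI) (metis cell_inj)
      have "whisk_cell ?J ew \<theta> \<in> Ar (fun_cat ?J (hom_cat C A X))" if "\<theta> \<in> Ar (hom_cat C A ?Q)" for \<theta>
        using fu that unfolding is_functor_def hom_def by (metis (no_types, lifting) mem_Collect_eq snd_conv)
      then show "whisk_cell ?J ew ` Ar (hom_cat C A ?Q) = Ar (fun_cat ?J (hom_cat C A X))"
        using cell_surj[OF _ A] by blast
    qed
    ultimately show ?thesis using fu unfolding cat_iso_def by simp
  qed
  then show ?thesis
    unfolding strict_cotensor_iff using ew t pq(1) by auto
qed

text \<open>The object of composable pairs of a nerve is a core of this cotensor.\<close>

lemma pita_cotensor_ord_cat_2:
  assumes "pita C" "X \<in> Obj C"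
  shows "\<exists>Q ew. strict_cotensor C (ord_cat 2) X Q ew"
proof -
  obtain P ev where "strict_cotensor C (ord_cat 1) X P ev"
    using assms unfolding pita_def by blast
  then obtain d0 d1 d where ar: "arrow_object X P d0 d1 d" using cotensor_arrow_object by blast
  note t = arrow_object_typed[OF ar]
  obtain p q where pb: "strict_pullback C d1 d0 p q"
    using assms isofibration_d1[OF ar] t unfolding pita_def by metis
  have pq: "p \<in> Mor C" "q \<in> Mor C" "dom1 C q = dom1 C p" "cod1 C p = P" "cod1 C q = P" "p \<odot> d1 = q \<odot> d0"
    using pb t unfolding strict_pullback_def by auto
  \<comment> \<open>The three vertices; the middle one can equally be written
    \<open>q \<odot> d0\<close>, by commutativity of the pullback square.\<close>
  define o0 where "o0 = (\<lambda>j::nat. if j = 0 then p \<odot> d0 else if j = 1 then p \<odot> d1 else q \<odot> d1)"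
  define ew where "ew = (o0, \<lambda>(i, j). if i = j then id2 C (o0 i) else if j = 1 then p \<rhd> d
    else if i = 1 then q \<rhd> d else p \<rhd> d \<bullet> q \<rhd> d)"
  have "strict_cotensor C (ord_cat 2) X (dom1 C p) ew"
    by (rule strict_cotensor_ord_cat_2I[OF ar pb])
      (use pq t in \<open>auto simp: is_functor_ord_cat_2 ew_def o0_def\<close>)
  then show ?thesis by blast
qed

end

section \<open>Cores, nerves and quotients\<close>

lemma bij_betw_ex1: "bij_betw f A B \<Longrightarrow> y \<in> B \<Longrightarrow> \<exists>!x. x \<in> A \<and> f x = y"
  by (auto simp: bij_betw_def inj_on_def)

context two_cat
begin

text \<open>Whiskering preserves inverses, so every morphism out of a groupoid is an arrow-wise iso
  and the universal property of the core applies to it.\<close>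

lemma core_ex1:
  assumes core: "is_core C X I i" and A: "groupoid_obj C A" and f: "f \<in> hom1 C A X"
  shows "\<exists>!u. u \<in> hom1 C A I \<and> u \<odot> i = f"
proof -
  have "invertible (vert_cat C) (\<alpha> \<lhd> f)" if "\<alpha> \<in> Cell C" "cod1 C (dom2 C \<alpha>) = A" for \<alpha>
    using rwhisker_inverse[OF groupoid_obj_inv[OF A that], of f] that f unfolding invertible_def
    by (metis hom1_iff)
  then have "f \<in> {f \<in> hom1 C A X. arrowwise_iso C f}"
    using f unfolding arrowwise_iso_def by auto
  moreover have "bij_betw (\<lambda>u. u \<odot> i) (hom1 C A I) {f \<in> hom1 C A X. arrowwise_iso C f}"
    using core groupoid_obj_Obj[OF A]
    unfolding is_core_def cat_iso_def arrowwise_iso_cat_def post_def by simp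
  ultimately show ?thesis
    by (rule bij_betw_ex1[rotated])
qed

text \<open>Composition with \<open>i\<close> lands among invertible 2-cells, so
  \<open>\<alpha> \<lhd> i\<close> has an inverse. That inverse belongs to the same subcategory,
  hence lifts along \<open>i\<close>, and faithfulness makes the lift an inverse of
  \<open>\<alpha>\<close>.\<close>

lemma core_groupoid:
  assumes core: "is_core C X I i"
  shows "groupoid_obj C I"
proof (rule groupoid_objI)
  have i: "i \<in> Mor C" "dom1 C i = I" "cod1 C i = X"
    using core unfolding is_core_def by auto
  then show I: "I \<in> Obj C" by auto
  fix \<alpha> assume \<alpha>: "\<alpha> \<in> Cell C" "cod1 C (dom2 C \<alpha>) = I"
  let ?A = "dom1 C (dom2 C \<alpha>)"
  have iso: "cat_iso (hom_cat C ?A I) (arrowwise_iso_cat C ?A X) (post C i)"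
    using core \<alpha> unfolding is_core_def by simp
  then have bij0: "bij_betw (\<lambda>u. u \<odot> i) (hom1 C ?A I) {f \<in> hom1 C ?A X. arrowwise_iso C f}"
    and bij: "bij_betw (\<lambda>\<beta>. \<beta> \<lhd> i) (Ar (hom_cat C ?A I)) (Ar (arrowwise_iso_cat C ?A X))"
    unfolding cat_iso_def by (simp_all add: post_def arrowwise_iso_cat_def)
  have \<alpha>': "\<alpha> \<in> Ar (hom_cat C ?A I)" using \<alpha> by simp
  then have "\<alpha> \<lhd> i \<in> Ar (arrowwise_iso_cat C ?A X)"
    using bij_betw_imp_surj_on[OF bij] by blast
  then have ai: "arrowwise_iso C (dom2 C (\<alpha> \<lhd> i))" "arrowwise_iso C (cod2 C (\<alpha> \<lhd> i))"
    "invertible (vert_cat C) (\<alpha> \<lhd> i)"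
    unfolding arrowwise_iso_cat_def by simp_all
  obtain \<beta> where \<beta>: "inverse_arrows (vert_cat C) (\<alpha> \<lhd> i) \<beta>"
    using ai unfolding invertible_def by blast
  then have \<beta>t: "\<beta> \<in> Cell C" "dom2 C \<beta> = cod2 C \<alpha> \<odot> i" "cod2 C \<beta> = dom2 C \<alpha> \<odot> i"
    using \<alpha> i by auto
  have "invertible (vert_cat C) \<beta>"
    using inverse_arrows_sym[OF \<beta>] unfolding invertible_def by blast
  then have "\<beta> \<in> Ar (arrowwise_iso_cat C ?A X)"
    unfolding arrowwise_iso_cat_def using \<beta>t ai \<alpha> i by simp
  then obtain \<beta>' where \<beta>': "\<beta>' \<in> Ar (hom_cat C ?A I)" "\<beta>' \<lhd> i = \<beta>"
    using bij_betw_imp_surj_on[OF bij] by (metis (no_types, lifting) imageE)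
  have d: "dom2 C \<beta>' = cod2 C \<alpha>" "cod2 C \<beta>' = dom2 C \<alpha>"
    by (rule inj_onD[OF bij_betw_imp_inj_on[OF bij0]]; use \<beta>t \<beta>' \<alpha> i in auto)+
  have "(\<alpha> \<bullet> \<beta>') \<lhd> i = id2 C (dom2 C \<alpha>) \<lhd> i" "(\<beta>' \<bullet> \<alpha>) \<lhd> i = id2 C (cod2 C \<alpha>) \<lhd> i"
    using \<beta> \<beta>' d \<alpha> i by auto
  then have "\<alpha> \<bullet> \<beta>' = id2 C (dom2 C \<alpha>)" "\<beta>' \<bullet> \<alpha> = id2 C (cod2 C \<alpha>)"
    by (auto intro!: inj_onD[OF bij_betw_imp_inj_on[OF bij]] simp del: rwhisker_vcomp whisker_id2)
      (use \<beta>' d \<alpha> in auto)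
  then have "inverse_arrows (vert_cat C) \<alpha> \<beta>'"
    using \<alpha> \<beta>' d by auto
  then show "invertible (vert_cat C) \<alpha>" unfolding invertible_def by blast
qed

section \<open>Construction of nerves\<close>

lemma core_map_hom1:
  assumes "is_core C X I i" "is_core C Y J j" "f \<in> hom1 C X Y"
  shows "core_map C i j f \<in> hom1 C I J" "core_map C i j f \<odot> j = i \<odot> f"
proof -
  have i: "i \<in> hom1 C I X" "j \<in> hom1 C J Y" using assms unfolding is_core_def by auto
  have "\<exists>!u. u \<in> hom1 C I J \<and> u \<odot> j = i \<odot> f"
    by (rule core_ex1[OF assms(2) core_groupoid[OF assms(1)]]) (use i assms in auto)
  from theI'[OF this] show "core_map C i j f \<in> hom1 C I J" "core_map C i j f \<odot> j = i \<odot> f"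
    unfolding core_map_def using i by simp_all
qed

text \<open>A functor out of [1] is determined by one 2-cell, so the definite description has a
  unique solution as soon as \<open>ev'\<close> precomposed with \<open>\<delta>\<close> is a
  functor.\<close>

lemma cotensor_map_hom1:
  assumes P: "strict_cotensor C (ord_cat 1) X P ev"
    and F: "is_functor (ord_cat 1) (hom_cat C P' X) (\<lambda>j. fst ev' (fst \<delta> j), \<lambda>a. snd ev' (snd \<delta> a))"
  shows "cotensor_map C (ord_cat 1) \<delta> P' ev' P ev \<in> hom1 C P' P"
    "j \<le> 1 \<Longrightarrow> cotensor_map C (ord_cat 1) \<delta> P' ev' P ev \<odot> fst ev j = fst ev' (fst \<delta> j)"
proof -
  note ar = cotensor_arrow_object[OF P]
  note t = arrow_object_typed[OF ar]
  note F' = F[unfolded is_functor_ord_cat_1 fst_conv snd_conv]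
  have ev: "snd ev (0,0) = id2 C (fst ev 0)" "snd ev (1,1) = id2 C (fst ev 1)"
    using P unfolding strict_cotensor_def is_functor_ord_cat_1 by blast+
  obtain u where u: "u \<in> Mor C" "dom1 C u = P'" "cod1 C u = P"
    "u \<rhd> snd ev (0,1) = snd ev' (snd \<delta> (0,1))"
    "u \<odot> fst ev 0 = fst ev' (fst \<delta> 0)" "u \<odot> fst ev 1 = fst ev' (fst \<delta> 1)"
    by (rule arrow_object_obtain[OF ar, of "snd ev' (snd \<delta> (0,1))"]) (use F' in auto)
  have "\<exists>!u. u \<in> hom1 C P' P \<and> (\<forall>j\<in>Ob (ord_cat 1). u \<odot> fst ev j = fst ev' (fst \<delta> j)) \<and>
      (\<forall>a\<in>Ar (ord_cat 1). u \<rhd> snd ev a = snd ev' (snd \<delta> a))"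
    unfolding ord_cat_simps Ar_ord_cat_1 Ob_ord_cat_1
  proof (rule ex1I[of _ u])
    show "u \<in> hom1 C P' P \<and> (\<forall>j\<in>{0, 1}. u \<odot> fst ev j = fst ev' (fst \<delta> j)) \<and>
      (\<forall>a\<in>{(0, 0), (0, 1), (1, 1)}. u \<rhd> snd ev a = snd ev' (snd \<delta> a))"
      using u F' ev t by simp
    show "v = u" if "v \<in> hom1 C P' P \<and> (\<forall>j\<in>{0, 1}. v \<odot> fst ev j = fst ev' (fst \<delta> j)) \<and>
      (\<forall>a\<in>{(0, 0), (0, 1), (1, 1)}. v \<rhd> snd ev a = snd ev' (snd \<delta> a))" for v
      by (rule arrow_object_inj[OF ar, of _ P']) (use u that in auto)
  qed
  from theI'[OF this] show "cotensor_map C (ord_cat 1) \<delta> P' ev' P ev \<in> hom1 C P' P"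
    "j \<le> 1 \<Longrightarrow> cotensor_map C (ord_cat 1) \<delta> P' ev' P ev \<odot> fst ev j = fst ev' (fst \<delta> j)"
    unfolding cotensor_map_def by simp_all
qed

text \<open>\<open>const_ev\<close> consists of identities, so the defining equation at the only
  vertex of [0] already forces the value. Source and target of a nerve thereby become the maps of
  cores induced by the two projections of the arrow object.\<close>

lemma cotensor_map_0_eq:
  assumes P: "strict_cotensor C (ord_cat 1) X P ev" and k: "k \<le> 1"
  shows "cotensor_map C (ord_cat 0) (delta [k]) P ev X (const_ev C X) = fst ev k" "fst ev k \<in> hom1 C P X"
proof -
  have ev: "is_functor (ord_cat 1) (hom_cat C P X) ev" "X \<in> Obj C"
    using P unfolding strict_cotensor_def by blast+
  have "k = 0 \<or> k = 1" using k by auto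
  then have e: "fst ev k \<in> hom1 C P X" "snd ev (k, k) = id2 C (fst ev k)"
    using ev(1) unfolding is_functor_ord_cat_1 by auto
  then show "fst ev k \<in> hom1 C P X" by blast
  have J: "Ar (ord_cat 0) = {(0,0)}" "Ob (ord_cat 0) = {0}" by (auto simp: ord_cat_def)
  have "u \<in> hom1 C P X \<and>
      (\<forall>j\<in>Ob (ord_cat 0). u \<odot> fst (const_ev C X) j = fst ev (fst (delta [k]) j)) \<and>
      (\<forall>a\<in>Ar (ord_cat 0). u \<rhd> snd (const_ev C X) a = snd ev (snd (delta [k]) a)) \<longleftrightarrow> u = fst ev k"
    (is "?L \<longleftrightarrow> _") for u
  proof
    assume ?L
    then have "u \<in> Mor C" "cod1 C u = X" "u \<odot> id1 C X = fst ev k"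
      unfolding J const_ev_def delta_def by simp_all
    then show "u = fst ev k" using comp1_id(2) by metis
  qed (use e ev(2) in \<open>simp add: J const_ev_def delta_def\<close>)
  then show "cotensor_map C (ord_cat 0) (delta [k]) P ev X (const_ev C X) = fst ev k"
    unfolding cotensor_map_def by simp
qed

text \<open>What is extracted from a congruence or a nerve in order to carry a cocone along a
  natural isomorphism: groupoid objects, typing, and the equation that makes consecutive arrows
  composable.\<close>

definition internal_typed :: "('o, 'm) internal \<Rightarrow> bool" where
  "internal_typed K \<longleftrightarrow> groupoid_obj C (obj0 K) \<and> groupoid_obj C (obj1 K) \<and> groupoid_obj C (obj2 K) \<and>
     pi0 K \<in> hom1 C (obj1 K) (obj0 K) \<and> pi1 K \<in> hom1 C (obj1 K) (obj0 K) \<and>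
     idm K \<in> hom1 C (obj0 K) (obj1 K) \<and> pi01 K \<in> hom1 C (obj2 K) (obj1 K) \<and>
     pi12 K \<in> hom1 C (obj2 K) (obj1 K) \<and> pi02 K \<in> hom1 C (obj2 K) (obj1 K) \<and>
     pi01 K \<odot> pi1 K = pi12 K \<odot> pi0 K"

text \<open>\<open>groupoidant\<close> makes the tautological cocone of a given nerve a quotient;
  here a nerve of an arbitrary object is assembled from chosen cotensors and cores. The uniqueness
  claim needs it for the competing object.\<close>

lemma nerve_exists:
  assumes pita: "pita C" and cores: "\<forall>X\<in>Obj C. \<exists>I i. is_core C X I i" and X: "X \<in> Obj C"
  shows "\<exists>K \<gamma> \<gamma>01. nerve_with_cocone C X K \<gamma> \<gamma>01 \<and> internal_typed K"
proof -
  obtain P ev where P: "strict_cotensor C (ord_cat 1) X P ev"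
    using assms unfolding pita_def by blast
  obtain Q ew where Q: "strict_cotensor C (ord_cat 2) X Q ew"
    using pita_cotensor_ord_cat_2[OF pita X] by blast
  have PQ: "P \<in> Obj C" "Q \<in> Obj C" "is_functor (ord_cat 2) (hom_cat C Q X) ew"
    using P Q unfolding strict_cotensor_def by blast+
  note ew = PQ(3)[unfolded is_functor_ord_cat_2]
  obtain I \<gamma> where \<gamma>: "is_core C X I \<gamma>" using cores X by blast
  obtain I1 i where i: "is_core C P I1 i" using cores PQ by blast
  obtain I2 j where j: "is_core C Q I2 j" using cores PQ by blast
  define K where "K = \<lparr>obj0 = I, obj1 = I1, obj2 = I2,
    pi0 = core_map C i \<gamma> (cotensor_map C (ord_cat 0) (delta [0]) P ev X (const_ev C X)),
    pi1 = core_map C i \<gamma> (cotensor_map C (ord_cat 0) (delta [1]) P ev X (const_ev C X)),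
    idm = core_map C \<gamma> i (cotensor_map C (ord_cat 1) (delta [0, 0]) X (const_ev C X) P ev),
    pi01 = core_map C j i (cotensor_map C (ord_cat 1) (delta [0, 1]) Q ew P ev),
    pi12 = core_map C j i (cotensor_map C (ord_cat 1) (delta [1, 2]) Q ew P ev),
    pi02 = core_map C j i (cotensor_map C (ord_cat 1) (delta [0, 2]) Q ew P ev)\<rparr>"
  have nerve: "nerve_with_cocone C X K \<gamma> (i \<rhd> snd ev (0, 1))"
    unfolding nerve_with_cocone_def K_def internal.simps
    using P Q \<gamma> i j by blast
  define c where "c = (\<lambda>a b. cotensor_map C (ord_cat 1) (delta [a, b]) Q ew P ev)"
  have c: "c a b \<in> hom1 C Q P" "c a b \<odot> fst ev 0 = fst ew a" "c a b \<odot> fst ev 1 = fst ew b"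
    if "(a, b) \<in> {(0, 1), (0, 2), (1, 2)}" for a b
  proof -
    have "is_functor (ord_cat 1) (hom_cat C Q X)
        (\<lambda>j. fst ew (fst (delta [a, b]) j), \<lambda>x. snd ew (snd (delta [a, b]) x))"
      using ew that by (auto simp: is_functor_ord_cat_1 delta_def nth_Cons')
    from cotensor_map_hom1[OF P this]
    show "c a b \<in> hom1 C Q P" "c a b \<odot> fst ev 0 = fst ew a" "c a b \<odot> fst ev 1 = fst ew b"
      unfolding c_def by (simp_all add: delta_def nth_Cons')
  qed
  have e: "cotensor_map C (ord_cat 1) (delta [0, 0]) X (const_ev C X) P ev \<in> hom1 C X P"
    by (rule cotensor_map_hom1[OF P])
      (use X in \<open>simp add: is_functor_ord_cat_1 delta_def const_ev_def nth_Cons'\<close>)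
  have d: "fst ev 0 \<in> hom1 C P X" "fst ev 1 \<in> hom1 C P X"
    using cotensor_map_0_eq(2)[OF P] by auto
  have K: "pi0 K = core_map C i \<gamma> (fst ev 0)" "pi1 K = core_map C i \<gamma> (fst ev 1)"
    "pi01 K = core_map C j i (c 0 1)" "pi12 K = core_map C j i (c 1 2)" "pi02 K = core_map C j i (c 0 2)"
    unfolding K_def c_def using cotensor_map_0_eq(1)[OF P] by simp_all
  note cm = core_map_hom1[OF j i c(1)[of 0 1]] core_map_hom1[OF j i c(1)[of 1 2]]
    core_map_hom1[OF i \<gamma> d(1)] core_map_hom1[OF i \<gamma> d(2)]
  have it: "i \<in> hom1 C I1 P" "j \<in> hom1 C I2 Q" "\<gamma> \<in> hom1 C I X"
    using i j \<gamma> unfolding is_core_def by blast+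
  \<comment> \<open>Both sides start at the groupoid \<open>I2\<close>, so it suffices to compare
    them after \<open>\<gamma>\<close>; there both restrict a composable pair to its middle
    vertex.\<close>
  have "pi01 K \<odot> pi1 K = pi12 K \<odot> pi0 K"
  proof -
    have "(pi01 K \<odot> pi1 K) \<odot> \<gamma> = (pi01 K \<odot> i) \<odot> fst ev 1"
      using cm(1,3,5,7,8) it d unfolding K by simp
    also have "\<dots> = j \<odot> (c 0 1 \<odot> fst ev 1)"
      using cm it d c(1)[of 0 1] unfolding K by simp
    also have "\<dots> = j \<odot> (c 1 2 \<odot> fst ev 0)"
      using c(3)[of 0 1] c(2)[of 1 2] by simp
    also have "\<dots> = (pi12 K \<odot> i) \<odot> fst ev 0"
      using cm it d c(1)[of 1 2] unfolding K by simp
    also have "\<dots> = (pi12 K \<odot> pi0 K) \<odot> \<gamma>"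
      using cm(1,3,5,6,7) it d unfolding K by simp
    finally have eq: "(pi01 K \<odot> pi1 K) \<odot> \<gamma> = (pi12 K \<odot> pi0 K) \<odot> \<gamma>" .
    have t: "pi01 K \<odot> pi1 K \<in> hom1 C I2 I" "pi12 K \<odot> pi0 K \<in> hom1 C I2 I"
      using cm unfolding K by simp_all
    then have "(pi01 K \<odot> pi1 K) \<odot> \<gamma> \<in> hom1 C I2 X" using it by simp
    from core_ex1[OF \<gamma> core_groupoid[OF j] this] show ?thesis using t eq by metis
  qed
  moreover have "obj0 K = I" "obj1 K = I1" "obj2 K = I2"
    "idm K = core_map C \<gamma> i (cotensor_map C (ord_cat 1) (delta [0, 0]) X (const_ev C X) P ev)"
    unfolding K_def by simp_all
  ultimately have "internal_typed K"
    unfolding internal_typed_def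
    using core_groupoid[OF \<gamma>] core_groupoid[OF i] core_groupoid[OF j] cm core_map_hom1(1)[OF \<gamma> i e]
      core_map_hom1(1)[OF j i c(1)[of 0 2]] by (simp add: K)
  then show ?thesis using nerve by blast
qed

text \<open>The common property of a nerve with its tautological cocone and of any quotient cocone
  of a complete congruence. It makes the definite descriptions in \<open>opp_mor\<close> and
  \<open>opp_cell\<close> well defined.\<close>

definition classifies :: "('o, 'm) internal \<Rightarrow> 'o \<Rightarrow> 'm \<Rightarrow> 'c \<Rightarrow> bool" where
  "classifies K X \<gamma> \<gamma>01 \<longleftrightarrow>
     \<gamma> \<in> hom1 C (obj0 K) X \<and>
     \<gamma>01 \<in> Cell C \<and> dom1 C (dom2 C \<gamma>01) = obj1 K \<and> cod1 C (dom2 C \<gamma>01) = X \<and>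
     (\<forall>A f. groupoid_obj C A \<longrightarrow> f \<in> hom1 C A X \<longrightarrow> (\<exists>!u. u \<in> hom1 C A (obj0 K) \<and> u \<odot> \<gamma> = f)) \<and>
     (\<forall>A \<alpha>. groupoid_obj C A \<longrightarrow> \<alpha> \<in> Ar (hom_cat C A X) \<longrightarrow>
        (\<exists>!a. a \<in> hom1 C A (obj1 K) \<and> a \<rhd> \<gamma>01 = \<alpha>))"

lemma classifies_typed:
  assumes "classifies K X \<gamma> \<gamma>01"
  shows "\<gamma> \<in> Mor C" "dom1 C \<gamma> = obj0 K" "cod1 C \<gamma> = X"
    "\<gamma>01 \<in> Cell C" "dom1 C (dom2 C \<gamma>01) = obj1 K" "cod1 C (dom2 C \<gamma>01) = X"
  using assms unfolding classifies_def by simp_all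

text \<open>A 2-cell into \<open>X\<close> is a morphism into the arrow object, and from a groupoid
  such a morphism factors uniquely through the core of the arrow object.\<close>

lemma nerve_classifies:
  assumes "nerve_with_cocone C X K \<gamma> \<gamma>01"
  shows "classifies K X \<gamma> \<gamma>01"
proof -
  obtain P ev i where P: "strict_cotensor C (ord_cat 1) X P ev"
    and \<gamma>: "is_core C X (obj0 K) \<gamma>" and i: "is_core C P (obj1 K) i" and \<gamma>01: "\<gamma>01 = i \<rhd> snd ev (0, 1)"
    using assms unfolding nerve_with_cocone_def by blast
  note ar = cotensor_arrow_object[OF P]
  note t = arrow_object_typed[OF ar]
  have it: "i \<in> Mor C" "dom1 C i = obj1 K" "cod1 C i = P" and \<gamma>t: "\<gamma> \<in> hom1 C (obj0 K) X"
    using i \<gamma> unfolding is_core_def by auto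
  have "\<exists>!a. a \<in> hom1 C A (obj1 K) \<and> a \<rhd> \<gamma>01 = \<alpha>"
    if A: "groupoid_obj C A" and \<alpha>: "\<alpha> \<in> Ar (hom_cat C A X)" for A \<alpha>
  proof -
    obtain u where u: "u \<in> Mor C" "dom1 C u = A" "cod1 C u = P" "u \<rhd> snd ev (0,1) = \<alpha>"
      by (rule arrow_object_obtain[OF ar, of \<alpha>]) (use \<alpha> in auto)
    then have ex: "\<exists>!a. a \<in> hom1 C A (obj1 K) \<and> a \<odot> i = u"
      using core_ex1[OF i A] by simp
    have "a \<odot> i = u" if "a \<in> hom1 C A (obj1 K)" "a \<rhd> \<gamma>01 = \<alpha>" for a
      by (rule arrow_object_inj[OF ar, of _ A]) (use that u \<gamma>01 it t in auto)
    moreover have "a \<rhd> \<gamma>01 = \<alpha>" if "a \<in> hom1 C A (obj1 K)" "a \<odot> i = u" for a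
      using that \<gamma>01 u it t lwhisker_comp[of a i "snd ev (0,1)"] by simp
    ultimately show ?thesis using ex by metis
  qed
  note R1 = this
  show ?thesis
    unfolding classifies_def
    by (intro conjI allI impI core_ex1[OF \<gamma>] R1) (use \<gamma>t it t \<gamma>01 in simp_all)
qed

section \<open>Strict quotients of a congruence\<close>

lemma strict_quotient_typed:
  assumes "strict_quotient C K X \<gamma> \<gamma>01"
  shows "is_cocone C K X (\<gamma>, \<gamma>01)" "X \<in> Obj C" "\<gamma> \<in> Mor C" "dom1 C \<gamma> = obj0 K" "cod1 C \<gamma> = X"
    "\<gamma>01 \<in> Cell C" "dom2 C \<gamma>01 = pi0 K \<odot> \<gamma>" "cod2 C \<gamma>01 = pi1 K \<odot> \<gamma>"
  using assms unfolding strict_quotient_def is_cocone_def by auto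

lemma strict_quotient_bij:
  assumes "strict_quotient C K X \<gamma> \<gamma>01" "Y \<in> Obj C"
  shows "bij_betw (\<lambda>h. (\<gamma> \<odot> h, \<gamma>01 \<lhd> h)) (hom1 C X Y) {G. is_cocone C K Y G}"
  using assms unfolding strict_quotient_def cat_iso_def by (simp add: cocone_cat_def Let_def)

lemma strict_quotient_obtain:
  assumes "strict_quotient C K X \<gamma> \<gamma>01" "is_cocone C K Y (\<delta>, \<delta>01)"
  obtains h where "h \<in> hom1 C X Y" "\<gamma> \<odot> h = \<delta>" "\<gamma>01 \<lhd> h = \<delta>01"
proof -
  have "Y \<in> Obj C" using assms(2) unfolding is_cocone_def by auto
  from bij_betw_imp_surj_on[OF strict_quotient_bij[OF assms(1) this]] assms(2)
  have "(\<delta>, \<delta>01) \<in> (\<lambda>h. (\<gamma> \<odot> h, \<gamma>01 \<lhd> h)) ` hom1 C X Y" by (metis mem_Collect_eq)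
  then show ?thesis using that by blast
qed

lemma strict_quotient_inj:
  assumes "strict_quotient C K X \<gamma> \<gamma>01" "h \<in> hom1 C X Y" "k \<in> hom1 C X Y"
    "\<gamma> \<odot> h = \<gamma> \<odot> k" "\<gamma>01 \<lhd> h = \<gamma>01 \<lhd> k"
  shows "h = k"
proof -
  have "Y \<in> Obj C" using assms(2) by auto
  then show ?thesis
    using inj_onD[OF bij_betw_imp_inj_on[OF strict_quotient_bij[OF assms(1)]]] assms by blast
qed

text \<open>\<open>groupoidant\<close> provides some object whose nerve is the given congruence. The
  prescribed quotient is only isomorphic to that object, so classification has to be carried
  across.\<close>

lemma classifies_transfer:
  assumes cl: "classifies K X \<gamma> \<gamma>01" and h: "h \<in> hom1 C X Y" and k: "k \<in> hom1 C Y X"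
    and hk: "h \<odot> k = id1 C X" and kh: "k \<odot> h = id1 C Y"
  shows "classifies K Y (\<gamma> \<odot> h) (\<gamma>01 \<lhd> h)"
proof -
  note t = classifies_typed[OF cl]
  note ht = h[unfolded hom1_iff] k[unfolded hom1_iff]
  have R0: "\<exists>!u. u \<in> hom1 C A (obj0 K) \<and> u \<odot> (\<gamma> \<odot> h) = f"
    if A: "groupoid_obj C A" and f: "f \<in> hom1 C A Y" for A f
  proof -
    have "f \<odot> k \<in> hom1 C A X" using f ht by simp
    then have "\<exists>!u. u \<in> hom1 C A (obj0 K) \<and> u \<odot> \<gamma> = f \<odot> k"
      using cl A unfolding classifies_def by blast
    moreover have "u \<odot> \<gamma> = f \<odot> k \<longleftrightarrow> u \<odot> (\<gamma> \<odot> h) = f" if "u \<in> hom1 C A (obj0 K)" for u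
    proof
      assume "u \<odot> \<gamma> = f \<odot> k"
      then have "(u \<odot> \<gamma>) \<odot> h = (f \<odot> k) \<odot> h" by simp
      then show "u \<odot> (\<gamma> \<odot> h) = f" using that f t ht kh by simp
    next
      assume "u \<odot> (\<gamma> \<odot> h) = f"
      then have "(u \<odot> (\<gamma> \<odot> h)) \<odot> k = f \<odot> k" by simp
      then show "u \<odot> \<gamma> = f \<odot> k" using that f t ht hk by simp
    qed
    ultimately show ?thesis by metis
  qed
  have R1: "\<exists>!a. a \<in> hom1 C A (obj1 K) \<and> a \<rhd> (\<gamma>01 \<lhd> h) = \<alpha>"
    if A: "groupoid_obj C A" and \<alpha>: "\<alpha> \<in> Ar (hom_cat C A Y)" for A \<alpha>
  proof -
    have "\<alpha> \<lhd> k \<in> Ar (hom_cat C A X)" using \<alpha> ht by simp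
    then have "\<exists>!a. a \<in> hom1 C A (obj1 K) \<and> a \<rhd> \<gamma>01 = \<alpha> \<lhd> k"
      using cl A unfolding classifies_def by blast
    moreover have "a \<rhd> \<gamma>01 = \<alpha> \<lhd> k \<longleftrightarrow> a \<rhd> (\<gamma>01 \<lhd> h) = \<alpha>" if "a \<in> hom1 C A (obj1 K)" for a
    proof
      assume "a \<rhd> \<gamma>01 = \<alpha> \<lhd> k"
      then have "(a \<rhd> \<gamma>01) \<lhd> h = \<alpha> \<lhd> (k \<odot> h)" using \<alpha> ht by simp
      then show "a \<rhd> (\<gamma>01 \<lhd> h) = \<alpha>" using that \<alpha> t ht kh by simp
    next
      assume "a \<rhd> (\<gamma>01 \<lhd> h) = \<alpha>"
      then have "a \<rhd> (\<gamma>01 \<lhd> (h \<odot> k)) = \<alpha> \<lhd> k" using that t ht by auto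
      then show "a \<rhd> \<gamma>01 = \<alpha> \<lhd> k" using hk that t by simp
    qed
    ultimately show ?thesis by metis
  qed
  show ?thesis
    unfolding classifies_def
    by (intro conjI allI impI R0 R1) (use t ht in simp_all)
qed

lemma strict_quotient_classifies:
  assumes gp: "groupoidant C" and cc: "complete_congruence C K" and q: "strict_quotient C K X \<gamma> \<gamma>01"
  shows "classifies K X \<gamma> \<gamma>01"
proof -
  obtain X0 \<delta> \<delta>01 where nv: "nerve_with_cocone C X0 K \<delta> \<delta>01" and q0: "strict_quotient C K X0 \<delta> \<delta>01"
    using gp cc unfolding groupoidant_def by blast
  obtain h where h: "h \<in> hom1 C X0 X" "\<delta> \<odot> h = \<gamma>" "\<delta>01 \<lhd> h = \<gamma>01"
    using strict_quotient_obtain[OF q0 strict_quotient_typed(1)[OF q]] by blast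
  obtain k where k: "k \<in> hom1 C X X0" "\<gamma> \<odot> k = \<delta>" "\<gamma>01 \<lhd> k = \<delta>01"
    using strict_quotient_obtain[OF q strict_quotient_typed(1)[OF q0]] by blast
  note t0 = classifies_typed[OF nerve_classifies[OF nv]]
  have "\<delta> \<odot> h \<in> Mor C" "cod1 C (\<delta> \<odot> h) = X" "\<delta>01 \<lhd> h \<in> Cell C" "cod1 C (dom2 C (\<delta>01 \<lhd> h)) = X"
    using t0 h(1) by simp_all
  note t = this[unfolded h] t0
  \<comment> \<open>Morphisms out of a quotient are determined by their effect on its cocone, and
    \<open>h \<odot> k\<close> fixes \<open>\<delta>\<close> and \<open>\<delta>01\<close>.\<close>
  have "h \<odot> k = id1 C X0"
    by (rule strict_quotient_inj[OF q0, of _ X0])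
      (use strict_quotient_typed(2)[OF q0] h k t comp1_assoc[of \<delta> h k] rwhisker_comp[of h k \<delta>01] in simp_all)
  moreover have "k \<odot> h = id1 C X"
    by (rule strict_quotient_inj[OF q, of _ X])
      (use strict_quotient_typed(2)[OF q] h k t comp1_assoc[of \<gamma> k h] rwhisker_comp[of k h \<gamma>01] in simp_all)
  ultimately show ?thesis
    using classifies_transfer[OF nerve_classifies[OF nv] h(1) k(1)] h by simp
qed

end

section \<open>The opposite of a complete congruence\<close>

lemma cat_iso_comp:
  assumes "cat_iso D E F" "cat_iso E H G"
  shows "cat_iso D H (\<lambda>x. fst G (fst F x), \<lambda>a. snd G (snd F a))"
proof -
  have F: "is_functor D E F" "bij_betw (fst F) (Ob D) (Ob E)" "bij_betw (snd F) (Ar D) (Ar E)"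
    and G: "is_functor E H G" "bij_betw (fst G) (Ob E) (Ob H)" "bij_betw (snd G) (Ar E) (Ar H)"
    using assms unfolding cat_iso_def by blast+
  have "is_functor D H (\<lambda>x. fst G (fst F x), \<lambda>a. snd G (snd F a))"
    using F(1) G(1) unfolding is_functor_def by (simp add: hom_def)
  then show ?thesis
    using bij_betw_trans[OF F(2) G(2)] bij_betw_trans[OF F(3) G(3)]
    unfolding cat_iso_def o_def by simp
qed

text \<open>Functor data count only on the carriers; that \<open>D\<close> is a category keeps
  identities and composites inside them.\<close>

lemma is_functor_cong:
  assumes "is_functor D E F" "category D"
    and "\<And>x. x \<in> Ob D \<Longrightarrow> fst F x = fst G x" "\<And>a. a \<in> Ar D \<Longrightarrow> snd F a = snd G a"
  shows "is_functor D E G"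
proof -
  have "ident D x \<in> Ar D" if "x \<in> Ob D" for x
    using assms(2) that unfolding category_def hom_def by auto
  moreover have "f \<cdot>\<^bsub>D\<^esub> g \<in> Ar D" if "f \<in> Ar D" "g \<in> Ar D" "tgt D f = src D g" for f g
    using assms(2) that unfolding category_def hom_def by auto
  moreover have "src D f \<in> Ob D" "tgt D f \<in> Ob D" if "f \<in> Ar D" for f
    using assms(2) that unfolding category_def by auto
  ultimately show ?thesis
    using assms(1,3,4) unfolding is_functor_def by metis
qed

lemma cat_iso_cong:
  assumes "cat_iso D E F" "category D"
    and "\<And>x. x \<in> Ob D \<Longrightarrow> fst F x = fst G x" "\<And>a. a \<in> Ar D \<Longrightarrow> snd F a = snd G a"
  shows "cat_iso D E G"
proof -
  have "bij_betw (fst G) (Ob D) (Ob E)" "bij_betw (snd G) (Ar D) (Ar E)"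
    using assms bij_betw_cong unfolding cat_iso_def by metis+
  then show ?thesis
    using is_functor_cong[OF _ assms(2-4)] assms(1) unfolding cat_iso_def by blast
qed

section \<open>Exchanging the legs of pullbacks, products and congruences\<close>

lemma pullback_sym:
  assumes "pullback D f g p q"
  shows "pullback D g f q p"
proof -
  have "\<exists>!u. u \<in> hom D (src D b) (src D q) \<and> u \<cdot>\<^bsub>D\<^esub> q = b \<and> u \<cdot>\<^bsub>D\<^esub> p = a"
    if "a \<in> Ar D" "b \<in> Ar D" "src D a = src D b" "tgt D a = src D f" "tgt D b = src D g"
      "a \<cdot>\<^bsub>D\<^esub> f = b \<cdot>\<^bsub>D\<^esub> g" for a b
  proof -
    have "\<exists>!u. u \<in> hom D (src D a) (src D p) \<and> u \<cdot>\<^bsub>D\<^esub> p = a \<and> u \<cdot>\<^bsub>D\<^esub> q = b" "src D p = src D q"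
      using assms that unfolding pullback_def by blast+
    then show ?thesis using that(3) by metis
  qed
  then show ?thesis
    using assms unfolding pullback_def by (metis (no_types, lifting))
qed

text \<open>Both sides are definite descriptions of the same predicate up to the order of its
  conjuncts, so they agree whether or not a pairing exists.\<close>

lemma pairing_sym:
  assumes "src D a = src D b" "src D p = src D q"
  shows "pairing D q p b a = pairing D p q a b"
  unfolding pairing_def using assms by (metis (no_types, lifting))

lemma op_internal_simps [simp]:
  "obj0 (op_internal K) = obj0 K" "obj1 (op_internal K) = obj1 K" "obj2 (op_internal K) = obj2 K"
  "pi0 (op_internal K) = pi1 K" "pi1 (op_internal K) = pi0 K" "idm (op_internal K) = idm K"
  "pi01 (op_internal K) = pi12 K" "pi12 (op_internal K) = pi01 K" "pi02 (op_internal K) = pi02 K"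
  by (simp_all add: op_internal_def)

text \<open>The exchange swaps the two unit laws and reads associativity backwards: a composable
  triple \<open>p\<close>, \<open>q\<close> of the opposite is the triple \<open>q\<close>,
  \<open>p\<close> of \<open>K\<close>.\<close>

lemma internal_category_op:
  assumes D: "category D" and K: "internal_category D K"
  shows "internal_category D (op_internal K)"
proof -
  have typed: "pi0 K \<in> hom D (obj1 K) (obj0 K)" "pi1 K \<in> hom D (obj1 K) (obj0 K)"
     "idm K \<in> hom D (obj0 K) (obj1 K)"
     "pi01 K \<in> hom D (obj2 K) (obj1 K)" "pi12 K \<in> hom D (obj2 K) (obj1 K)"
     "pi02 K \<in> hom D (obj2 K) (obj1 K)" "obj1 K \<in> Ob D"
    and units:
     "pairing D (pi01 K) (pi12 K) (pi0 K \<cdot>\<^bsub>D\<^esub> idm K) (ident D (obj1 K)) \<cdot>\<^bsub>D\<^esub> pi02 K = ident D (obj1 K)"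
     "pairing D (pi01 K) (pi12 K) (ident D (obj1 K)) (pi1 K \<cdot>\<^bsub>D\<^esub> idm K) \<cdot>\<^bsub>D\<^esub> pi02 K = ident D (obj1 K)"
    and assoc: "\<And>p q. p \<in> Ar D \<Longrightarrow> q \<in> Ar D \<Longrightarrow> src D p = src D q \<Longrightarrow> tgt D p = obj2 K \<Longrightarrow>
       tgt D q = obj2 K \<Longrightarrow> p \<cdot>\<^bsub>D\<^esub> pi12 K = q \<cdot>\<^bsub>D\<^esub> pi01 K \<Longrightarrow>
       pairing D (pi01 K) (pi12 K) (p \<cdot>\<^bsub>D\<^esub> pi02 K) (q \<cdot>\<^bsub>D\<^esub> pi12 K) \<cdot>\<^bsub>D\<^esub> pi02 K =
       pairing D (pi01 K) (pi12 K) (p \<cdot>\<^bsub>D\<^esub> pi01 K) (q \<cdot>\<^bsub>D\<^esub> pi02 K) \<cdot>\<^bsub>D\<^esub> pi02 K"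
    using K unfolding internal_category_def Let_def by simp_all
  have src_comp: "src D (a \<cdot>\<^bsub>D\<^esub> b) = src D a" if "a \<in> Ar D" "b \<in> Ar D" "tgt D a = src D b" for a b
    using D that unfolding category_def hom_def by auto
  have swap: "pairing D (pi12 K) (pi01 K) b a = pairing D (pi01 K) (pi12 K) a b"
    if "src D a = src D b" for a b
    by (rule pairing_sym[OF that]) (use typed in \<open>simp add: hom_def\<close>)
  have id: "src D (ident D (obj1 K)) = obj1 K"
    using D typed unfolding category_def hom_def by auto
  have "pairing D (pi12 K) (pi01 K) (pi1 K \<cdot>\<^bsub>D\<^esub> idm K) (ident D (obj1 K)) \<cdot>\<^bsub>D\<^esub> pi02 K = ident D (obj1 K)"
    by (subst swap) (use units typed id in \<open>simp_all add: src_comp hom_def\<close>)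
  moreover have "pairing D (pi12 K) (pi01 K) (ident D (obj1 K)) (pi0 K \<cdot>\<^bsub>D\<^esub> idm K) \<cdot>\<^bsub>D\<^esub> pi02 K = ident D (obj1 K)"
    by (subst swap) (use units typed id in \<open>simp_all add: src_comp hom_def\<close>)
  moreover have "pairing D (pi12 K) (pi01 K) (p \<cdot>\<^bsub>D\<^esub> pi02 K) (q \<cdot>\<^bsub>D\<^esub> pi01 K) \<cdot>\<^bsub>D\<^esub> pi02 K =
       pairing D (pi12 K) (pi01 K) (p \<cdot>\<^bsub>D\<^esub> pi12 K) (q \<cdot>\<^bsub>D\<^esub> pi02 K) \<cdot>\<^bsub>D\<^esub> pi02 K"
    if pq: "p \<in> Ar D" "q \<in> Ar D" "src D p = src D q" "tgt D p = obj2 K"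
       "tgt D q = obj2 K" "p \<cdot>\<^bsub>D\<^esub> pi01 K = q \<cdot>\<^bsub>D\<^esub> pi12 K" for p q
  proof -
    have "pairing D (pi12 K) (pi01 K) (p \<cdot>\<^bsub>D\<^esub> pi02 K) (q \<cdot>\<^bsub>D\<^esub> pi01 K) =
        pairing D (pi01 K) (pi12 K) (q \<cdot>\<^bsub>D\<^esub> pi01 K) (p \<cdot>\<^bsub>D\<^esub> pi02 K)"
      "pairing D (pi12 K) (pi01 K) (p \<cdot>\<^bsub>D\<^esub> pi12 K) (q \<cdot>\<^bsub>D\<^esub> pi02 K) =
        pairing D (pi01 K) (pi12 K) (q \<cdot>\<^bsub>D\<^esub> pi02 K) (p \<cdot>\<^bsub>D\<^esub> pi12 K)"
      by (rule swap; use pq typed in \<open>simp add: src_comp hom_def\<close>)+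
    then show ?thesis using assoc[of q p] pq by simp
  qed
  ultimately show ?thesis
    using K pullback_sym[of D "pi1 K" "pi0 K"] unfolding internal_category_def Let_def op_internal_simps
    by simp
qed

lemma und_cat_simps [simp]:
  "Ob (und_cat C) = Obj C" "Ar (und_cat C) = Mor C" "src (und_cat C) = dom1 C"
  "tgt (und_cat C) = cod1 C" "ident (und_cat C) = id1 C" "comp (und_cat C) = comp1 C"
  "hom (und_cat C) A B = hom1 C A B"
  by (auto simp: und_cat_def hom_def)

context two_cat
begin

lemma strict_product_sym:
  assumes "strict_product C X Y p q"
  shows "strict_product C Y X q p"
proof -
  have pq: "p \<in> hom1 C (dom1 C p) X" "q \<in> hom1 C (dom1 C p) Y"
    using assms unfolding strict_product_def by auto
  have "cat_iso (hom_cat C B (dom1 C p)) (prod_cat (hom_cat C B Y) (hom_cat C B X))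
      (\<lambda>u. (u \<odot> q, u \<odot> p), \<lambda>\<alpha>. (\<alpha> \<lhd> q, \<alpha> \<lhd> p))" if B: "B \<in> Obj C" for B
  proof -
    have 1: "cat_iso (hom_cat C B (dom1 C p)) (prod_cat (hom_cat C B X) (hom_cat C B Y))
      (\<lambda>u. (u \<odot> p, u \<odot> q), \<lambda>\<alpha>. (\<alpha> \<lhd> p, \<alpha> \<lhd> q))"
      using assms B unfolding strict_product_def by blast
    have "cat_iso (prod_cat D E) (prod_cat E D) (prod.swap, prod.swap)" for D E :: "('m, 'c) cat"
      unfolding cat_iso_def is_functor_def prod_cat_def
      by (auto simp: bij_betw_def hom_def inj_on_def)
    from cat_iso_comp[OF 1 this] show ?thesis by simp
  qed
  moreover have "dom1 C q = dom1 C p" using pq by simp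
  ultimately show ?thesis
    unfolding strict_product_def using pq by simp
qed

lemma strict_product_pairing:
  assumes "strict_product C X Y p q" "a \<in> Mor C" "b \<in> Mor C" "dom1 C b = dom1 C a"
    "cod1 C a = X" "cod1 C b = Y"
  shows "\<exists>!u. u \<in> hom1 C (dom1 C a) (dom1 C p) \<and> u \<odot> p = a \<and> u \<odot> q = b"
proof -
  have "bij_betw (\<lambda>u. (u \<odot> p, u \<odot> q)) (hom1 C (dom1 C a) (dom1 C p))
      (hom1 C (dom1 C a) X \<times> hom1 C (dom1 C a) Y)"
    using assms unfolding strict_product_def cat_iso_def by (simp add: prod_cat_def)
  from bij_betw_ex1[OF this, of "(a, b)"] assms show ?thesis by (simp add: prod_eq_iff)
qed

lemma cat_iso_post:
  assumes "h \<in> hom1 C X Y" "k \<in> hom1 C Y X" "h \<odot> k = id1 C X" "k \<odot> h = id1 C Y"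
  shows "cat_iso (hom_cat C A X) (hom_cat C A Y) (post C h)"
proof -
  have "bij_betw (\<lambda>g. g \<odot> h) (hom1 C A X) (hom1 C A Y)"
    by (rule bij_betw_byWitness[where f' = "\<lambda>g. g \<odot> k"]) (use assms in auto)
  moreover have "bij_betw (\<lambda>\<alpha>. \<alpha> \<lhd> h) (Ar (hom_cat C A X)) (Ar (hom_cat C A Y))"
    by (rule bij_betw_byWitness[where f' = "\<lambda>\<alpha>. \<alpha> \<lhd> k"])
      (use assms in \<open>auto simp flip: rwhisker_comp\<close>)
  ultimately show ?thesis
    unfolding cat_iso_def using is_functor_post[OF assms(1)] by (simp add: post_def)
qed

text \<open>Composition with the isomorphism \<open>h\<close> is an isomorphism of hom categories,
  so preceding the comparison functor by it preserves universality. The intended \<open>h\<close> is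
  the involution \<open>\<tau>\<close> of the arrow object.\<close>

lemma strict_pullback_precomp:
  assumes pb: "strict_pullback C f g p q"
    and h: "h \<in> hom1 C P (dom1 C p)" "k \<in> hom1 C (dom1 C p) P" "h \<odot> k = id1 C P" "k \<odot> h = id1 C (dom1 C p)"
  shows "strict_pullback C f g (h \<odot> p) (h \<odot> q)"
proof -
  have t: "f \<in> Mor C" "g \<in> Mor C" "cod1 C f = cod1 C g"
    "p \<in> hom1 C (dom1 C p) (dom1 C f)" "q \<in> hom1 C (dom1 C p) (dom1 C g)" "p \<odot> f = q \<odot> g"
    using pb unfolding strict_pullback_def by auto
  have "cat_iso (hom_cat C B P)
      (fibre_prod_cat (hom_cat C B (dom1 C f)) (hom_cat C B (dom1 C g)) (post C f) (post C g))
      (\<lambda>u. (u \<odot> (h \<odot> p), u \<odot> (h \<odot> q)), \<lambda>\<alpha>. (\<alpha> \<lhd> (h \<odot> p), \<alpha> \<lhd> (h \<odot> q)))"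
    if B: "B \<in> Obj C" for B
  proof (rule cat_iso_cong[OF cat_iso_comp[OF cat_iso_post[OF h]]])
    show "cat_iso (hom_cat C B (dom1 C p))
      (fibre_prod_cat (hom_cat C B (dom1 C f)) (hom_cat C B (dom1 C g)) (post C f) (post C g))
      (\<lambda>u. (u \<odot> p, u \<odot> q), \<lambda>\<alpha>. (\<alpha> \<lhd> p, \<alpha> \<lhd> q))"
      using pb B unfolding strict_pullback_def by blast
    show "category (hom_cat C B P)" by (rule category_hom_cat) (use h B in auto)
  qed (use h t in \<open>auto simp: post_def\<close>)
  moreover have "dom1 C (h \<odot> p) = P" using h t by simp
  ultimately show ?thesis
    unfolding strict_pullback_def using t h by auto
qed

text \<open>With the product projections exchanged as well, the morphism paired from source and
  target is literally unchanged, and so are its isofibration and DOF properties.\<close>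

lemma gbo_congruence_op:
  assumes "gbo_congruence C K"
  shows "gbo_congruence C (op_internal K)"
proof -
  have ic: "internal_category (und_cat C) K"
    using assms unfolding gbo_congruence_def internal_double_category_def by blast
  then have t: "pi0 K \<in> Mor C" "pi1 K \<in> Mor C" "dom1 C (pi0 K) = dom1 C (pi1 K)"
    unfolding internal_category_def by auto
  have swap: "strict_product C (obj0 K) (obj0 K) s' s \<and>
      pairing (und_cat C) s' s (pi1 K) (pi0 K) = pairing (und_cat C) s s' (pi0 K) (pi1 K)"
    if "strict_product C (obj0 K) (obj0 K) s s'" for s s'
  proof
    show "strict_product C (obj0 K) (obj0 K) s' s" by (rule strict_product_sym[OF that])
    show "pairing (und_cat C) s' s (pi1 K) (pi0 K) = pairing (und_cat C) s s' (pi0 K) (pi1 K)"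
      by (rule pairing_sym) (use that t in \<open>auto simp: strict_product_def\<close>)
  qed
  obtain s s' where s: "strict_product C (obj0 K) (obj0 K) s s'"
    "isofibration C (pairing (und_cat C) s s' (pi0 K) (pi1 K))"
    using assms unfolding gbo_congruence_def internal_double_category_def by blast
  obtain w w' where w: "strict_product C (obj0 K) (obj0 K) w w'"
    "dof C (pairing (und_cat C) w w' (pi0 K) (pi1 K))"
    using assms unfolding gbo_congruence_def by blast
  show ?thesis
    unfolding gbo_congruence_def internal_double_category_def op_internal_simps
    using assms internal_category_op[OF cats(1) ic] swap[OF s(1)] s(2) swap[OF w(1)] w(2)
    unfolding gbo_congruence_def by metis
qed

lemma pullback_ex1:
  assumes "pullback (und_cat C) f g p q" "a \<in> Mor C" "b \<in> Mor C" "dom1 C a = dom1 C b"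
    "cod1 C a = dom1 C f" "cod1 C b = dom1 C g" "a \<odot> f = b \<odot> g"
  shows "\<exists>!u. u \<in> hom1 C (dom1 C a) (dom1 C p) \<and> u \<odot> p = a \<and> u \<odot> q = b"
  using assms unfolding pullback_def und_cat_simps by blast

text \<open>The reflection of the opposite congruence is \<open>\<tau>r\<close>, exhibited by the 2-cell \<open>(\<tau>\<rho>)(\<partial>e)\<close>. If the
  projections of all auxiliary products and pullbacks are swapped as well, then the completeness
  square of the opposite is the original one precomposed with the involution \<open>\<tau>\<close>.\<close>

lemma complete_congruence_op:
  assumes "complete_congruence C K"
  shows "complete_congruence C (op_internal K)"
proof -
  let ?D = "und_cat C"
  obtain P ev r \<tau> l m s t s' t' where
    gbo: "gbo_congruence C K" and P: "strict_cotensor C (ord_cat 1) (obj0 K) P ev" and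
    r: "is_reflection C K P ev r" and
    \<tau>: "\<tau> \<in> hom1 C P P" "\<tau> \<rhd> snd ev (0, 1) = inv_cell C (snd ev (0, 1))" and
    lm: "pullback ?D (pi12 K) (pi01 K) l m" and
    st: "strict_product C (obj0 K) (obj0 K) s t" and
    st': "strict_product C (obj1 K) (obj1 K) s' t'" and
    pb: "strict_pullback C
              (pairing ?D s' t' (l \<odot> pi02 K) (m \<odot> pi02 K))
              (pairing ?D s' t' (s \<odot> idm K) (t \<odot> idm K))
              (pairing ?D l m (pairing ?D (pi01 K) (pi12 K) r (\<tau> \<odot> r))
                (pairing ?D (pi01 K) (pi12 K) (\<tau> \<odot> r) r))
              (pairing ?D s t (fst ev 0) (fst ev 1))"
    using assms unfolding complete_congruence_def Let_def by blast
  define d0 d1 d where "d0 = fst ev 0" and "d1 = fst ev 1" and "d = snd ev (0, 1)"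
  note d_defs = this
  have ar: "arrow_object (obj0 K) P d0 d1 d"
    unfolding d_defs by (rule cotensor_arrow_object[OF P])
  note art = arrow_object_typed[OF ar]
  note \<tau> = \<tau>[folded d_defs] and r = r[unfolded is_reflection_def, folded d_defs]
    and pb = pb[folded d_defs]
  have ic: "internal_category ?D K" and gpd0: "groupoid_obj C (obj0 K)"
    using gbo unfolding gbo_congruence_def internal_double_category_def by blast+
  have K: "pi0 K \<in> hom1 C (obj1 K) (obj0 K)" "pi1 K \<in> hom1 C (obj1 K) (obj0 K)"
    "idm K \<in> hom1 C (obj0 K) (obj1 K)" "pi01 K \<in> hom1 C (obj2 K) (obj1 K)"
    "pi12 K \<in> hom1 C (obj2 K) (obj1 K)" "pi02 K \<in> hom1 C (obj2 K) (obj1 K)"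
    and K2: "pullback ?D (pi1 K) (pi0 K) (pi01 K) (pi12 K)"
    and eK: "idm K \<odot> pi0 K = id1 C (obj0 K)" "idm K \<odot> pi1 K = id1 C (obj0 K)"
    using ic unfolding internal_category_def by simp_all
  have inv: "inverse_arrows (vert_cat C) d (inv_cell C d)"
    by (rule groupoid_obj_inv[OF gpd0]) (use art in auto)
  then have inv': "inv_cell C d \<in> Cell C" "dom2 C (inv_cell C d) = d1" "cod2 C (inv_cell C d) = d0"
    "inv_cell C d \<bullet> d = id2 C d1"
    using art by auto
  have \<tau>d: "\<tau> \<odot> d0 = d1" "\<tau> \<odot> d1 = d0"
  proof -
    have "dom2 C (\<tau> \<rhd> d) = \<tau> \<odot> d0" "cod2 C (\<tau> \<rhd> d) = \<tau> \<odot> d1" using \<tau>(1) art by simp_all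
    then show "\<tau> \<odot> d0 = d1" "\<tau> \<odot> d1 = d0" unfolding \<tau>(2) using inv' by simp_all
  qed
  \<comment> \<open>\<open>\<tau>\<close> sends \<open>d\<close> to its inverse, hence that inverse
    back to \<open>d\<close>; morphisms into the arrow object are determined by whiskering with
    \<open>d\<close>.\<close>
  have \<tau>\<tau>: "\<tau> \<odot> \<tau> = id1 C P"
  proof (rule arrow_object_inj[OF ar])
    have "inverse_arrows (vert_cat C) (\<tau> \<rhd> d) (\<tau> \<rhd> inv_cell C d)"
      by (rule lwhisker_inverse[OF inv]) (use \<tau> art in auto)
    then have "\<tau> \<rhd> inv_cell C d = d"
      using inverse_unique inverse_arrows_sym[OF inv] \<tau>(2) by metis
    then show "\<tau> \<odot> \<tau> \<rhd> d = id1 C P \<rhd> d" using \<tau> art by simp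
  qed (use \<tau> art in auto)
  obtain \<rho> where rt: "r \<in> hom1 C P (obj1 K)" and \<rho>: "\<rho> \<in> hom2 C r (d1 \<odot> idm K)"
    "\<rho> \<lhd> pi0 K = d" "\<rho> \<lhd> pi1 K = id2 C d1"
    using r by blast
  have r\<pi>: "r \<odot> pi0 K = d0" "r \<odot> pi1 K = d1"
  proof -
    have "dom2 C (\<rho> \<lhd> pi0 K) = r \<odot> pi0 K" "dom2 C (\<rho> \<lhd> pi1 K) = r \<odot> pi1 K"
      using rt \<rho>(1) K by simp_all
    then show "r \<odot> pi0 K = d0" "r \<odot> pi1 K = d1" unfolding \<rho>(2,3) using art by simp_all
  qed
  have "is_reflection C (op_internal K) P ev (\<tau> \<odot> r)"
  proof -
    \<comment> \<open>The two cells are composable because \<open>\<tau>\<close> exchanges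
      \<open>d0\<close> and \<open>d1\<close>: the first ends at \<open>d0 \<odot> idm K\<close>,
      where \<open>d \<lhd> idm K\<close> starts.\<close>
    have \<rho>t: "\<tau> \<odot> (d1 \<odot> idm K) = d0 \<odot> idm K"
      using \<tau> K art \<tau>d(2) comp1_assoc[of \<tau> d1 "idm K"] by simp
    have "(\<tau> \<rhd> \<rho> \<bullet> d \<lhd> idm K) \<lhd> pi1 K = (\<tau> \<rhd> \<rho> \<lhd> pi1 K) \<bullet> (d \<lhd> (idm K \<odot> pi1 K))"
      using \<tau> \<rho>(1) K art rt \<rho>t by simp
    also have "\<dots> = d" using \<rho>(3) \<tau> art eK \<tau>d rt K \<rho>(1) by simp
    finally have 1: "(\<tau> \<rhd> \<rho> \<bullet> d \<lhd> idm K) \<lhd> pi1 K = d" .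
    have "(\<tau> \<rhd> \<rho> \<bullet> d \<lhd> idm K) \<lhd> pi0 K = (\<tau> \<rhd> \<rho> \<lhd> pi0 K) \<bullet> (d \<lhd> (idm K \<odot> pi0 K))"
      using \<tau> \<rho>(1) K art rt \<rho>t by simp
    also have "\<dots> = id2 C d1" using \<rho>(2) \<tau> art eK \<tau>d rt K \<rho>(1) inv' by simp
    finally have 2: "(\<tau> \<rhd> \<rho> \<bullet> d \<lhd> idm K) \<lhd> pi0 K = id2 C d1" .
    show ?thesis
      unfolding is_reflection_def op_internal_simps d_defs[symmetric]
      using 1 2 rt \<tau> \<rho>(1) \<rho>t art K by (intro conjI bexI[of _ "\<tau> \<rhd> \<rho> \<bullet> d \<lhd> idm K"]) auto
  qed
  moreover have "strict_pullback C
      (pairing ?D t' s' (m \<odot> pi02 K) (l \<odot> pi02 K))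
      (pairing ?D t' s' (t \<odot> idm K) (s \<odot> idm K))
      (pairing ?D m l (pairing ?D (pi12 K) (pi01 K) (\<tau> \<odot> r) (\<tau> \<odot> (\<tau> \<odot> r)))
        (pairing ?D (pi12 K) (pi01 K) (\<tau> \<odot> (\<tau> \<odot> r)) (\<tau> \<odot> r)))
      (pairing ?D t s d0 d1)"
  proof -
    have lmt: "l \<in> Mor C" "m \<in> Mor C" "dom1 C m = dom1 C l" "cod1 C l = obj2 K" "cod1 C m = obj2 K"
      using lm K unfolding pullback_def by auto
    have stt: "s \<in> Mor C" "t \<in> Mor C" "dom1 C t = dom1 C s" "cod1 C s = obj0 K" "cod1 C t = obj0 K"
      "s' \<in> Mor C" "t' \<in> Mor C" "dom1 C t' = dom1 C s'"
      using st st' unfolding strict_product_def by auto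
    have \<tau>\<tau>r: "\<tau> \<odot> (\<tau> \<odot> r) = r" using comp1_assoc[of \<tau> \<tau> r] \<tau>\<tau> \<tau> rt by simp
    have pair2: "\<exists>!u. u \<in> hom1 C (dom1 C a) (obj2 K) \<and> u \<odot> pi01 K = a \<and> u \<odot> pi12 K = b"
      if "a \<in> hom1 C P (obj1 K)" "b \<in> hom1 C P (obj1 K)" "a \<odot> pi1 K = b \<odot> pi0 K" for a b
      using pullback_ex1[OF K2, of a b] that K by simp
    have p2: "pairing ?D (pi01 K) (pi12 K) a b \<in> hom1 C P (obj2 K)"
      "pairing ?D (pi01 K) (pi12 K) a b \<odot> pi01 K = a" "pairing ?D (pi01 K) (pi12 K) a b \<odot> pi12 K = b"
      if "a \<in> hom1 C P (obj1 K)" "b \<in> hom1 C P (obj1 K)" "a \<odot> pi1 K = b \<odot> pi0 K" for a b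
      using theI'[OF pair2[OF that]] that K unfolding pairing_def by simp_all
    have p2_eqI: "u = pairing ?D (pi01 K) (pi12 K) a b"
      if "a \<in> hom1 C P (obj1 K)" "b \<in> hom1 C P (obj1 K)" "a \<odot> pi1 K = b \<odot> pi0 K"
        "u \<in> hom1 C P (obj2 K)" "u \<odot> pi01 K = a" "u \<odot> pi12 K = b" for a b u
      using pair2[OF that(1-3)] p2[OF that(1-3)] that hom1_iff by metis
    define a where "a = pairing ?D (pi01 K) (pi12 K) r (\<tau> \<odot> r)"
    define b where "b = pairing ?D (pi01 K) (pi12 K) (\<tau> \<odot> r) r"
    have cr: "r \<in> hom1 C P (obj1 K)" "\<tau> \<odot> r \<in> hom1 C P (obj1 K)"
      "r \<odot> pi1 K = \<tau> \<odot> r \<odot> pi0 K" "\<tau> \<odot> r \<odot> pi1 K = r \<odot> pi0 K"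
      using rt \<tau> K r\<pi> \<tau>d by auto
    note a = p2[OF cr(1,2,3), folded a_def] and b = p2[OF cr(2,1,4), folded b_def]
    \<comment> \<open>Precomposition with \<open>\<tau>\<close> exchanges the pairs
      (\<open>r\<close>, \<open>\<tau> \<odot> r\<close>) and (\<open>\<tau> \<odot> r\<close>,
      \<open>r\<close>). On the top edge of the square it thus has the same effect as exchanging the
      projections \<open>l\<close> and \<open>m\<close>.\<close>
    have \<tau>a: "\<tau> \<odot> a = b" unfolding b_def
      by (rule p2_eqI) (use cr a \<tau> K \<tau>\<tau>r in auto)
    have \<tau>b: "\<tau> \<odot> b = a" unfolding a_def
      by (rule p2_eqI) (use cr b \<tau> K \<tau>\<tau>r in auto)
    have swap2: "pairing ?D (pi12 K) (pi01 K) (\<tau> \<odot> r) r = a" "pairing ?D (pi12 K) (pi01 K) r (\<tau> \<odot> r) = b"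
      unfolding a_def b_def by (rule pairing_sym; use K cr in simp)+
    have pair3: "\<exists>!u. u \<in> hom1 C P (dom1 C l) \<and> u \<odot> l = x \<and> u \<odot> m = y"
      if "x \<in> hom1 C P (obj2 K)" "y \<in> hom1 C P (obj2 K)" "x \<odot> pi12 K = y \<odot> pi01 K" for x y
      using pullback_ex1[OF lm, of x y] that K by simp
    have p3: "pairing ?D l m x y \<in> hom1 C P (dom1 C l)" "pairing ?D l m x y \<odot> l = x"
      "pairing ?D l m x y \<odot> m = y"
      if "x \<in> hom1 C P (obj2 K)" "y \<in> hom1 C P (obj2 K)" "x \<odot> pi12 K = y \<odot> pi01 K" for x y
      using theI'[OF pair3[OF that]] that unfolding pairing_def by simp_all
    have ab: "a \<odot> pi12 K = b \<odot> pi01 K" "b \<odot> pi12 K = a \<odot> pi01 K" using a b by simp_all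
    have top: "\<tau> \<odot> pairing ?D l m a b = pairing ?D m l a b"
    proof -
      have "pairing ?D m l a b = pairing ?D l m b a"
        by (rule pairing_sym) (use a b lmt in auto)
      moreover have "\<tau> \<odot> pairing ?D l m a b = pairing ?D l m b a"
        using pair3[OF b(1) a(1) ab(2)] p3[OF a(1) b(1) ab(1)] p3[OF b(1) a(1) ab(2)] \<tau> \<tau>a \<tau>b lmt
        by (metis (no_types, lifting) comp1_assoc comp1_props hom1_iff)
      ultimately show ?thesis by simp
    qed
    have pair0: "\<exists>!u. u \<in> hom1 C P (dom1 C s) \<and> u \<odot> s = x \<and> u \<odot> t = y"
      if "x \<in> hom1 C P (obj0 K)" "y \<in> hom1 C P (obj0 K)" for x y
      using strict_product_pairing[OF st, of x y] that by simp
    have p0: "pairing ?D s t x y \<in> hom1 C P (dom1 C s)" "pairing ?D s t x y \<odot> s = x"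
      "pairing ?D s t x y \<odot> t = y" if "x \<in> hom1 C P (obj0 K)" "y \<in> hom1 C P (obj0 K)" for x y
      using theI'[OF pair0[OF that]] that unfolding pairing_def by simp_all
    have d01: "d0 \<in> hom1 C P (obj0 K)" "d1 \<in> hom1 C P (obj0 K)" using art by auto
    have left: "\<tau> \<odot> pairing ?D s t d0 d1 = pairing ?D t s d0 d1"
    proof -
      have "pairing ?D t s d0 d1 = pairing ?D s t d1 d0"
        by (rule pairing_sym) (use d01 stt in auto)
      moreover have "\<tau> \<odot> pairing ?D s t d0 d1 = pairing ?D s t d1 d0"
      proof -
        have "\<tau> \<odot> pairing ?D s t d0 d1 \<in> hom1 C P (dom1 C s)"
          "\<tau> \<odot> pairing ?D s t d0 d1 \<odot> s = d1" "\<tau> \<odot> pairing ?D s t d0 d1 \<odot> t = d0"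
          using p0[OF d01] \<tau> \<tau>d stt by simp_all
        then show ?thesis
          using pair0[OF d01(2,1)] p0[OF d01(2,1)] by blast
      qed
      ultimately show ?thesis by simp
    qed
    have "dom1 C (pairing ?D l m a b) = P" using p3[OF a(1) b(1) ab(1)] by simp
    then have "strict_pullback C
        (pairing ?D s' t' (l \<odot> pi02 K) (m \<odot> pi02 K))
        (pairing ?D s' t' (s \<odot> idm K) (t \<odot> idm K))
        (\<tau> \<odot> pairing ?D l m a b) (\<tau> \<odot> pairing ?D s t d0 d1)"
      using strict_pullback_precomp[OF pb[folded a_def b_def], of \<tau> P \<tau>] \<tau> \<tau>\<tau> by simp
    moreover have "pairing ?D t' s' (m \<odot> pi02 K) (l \<odot> pi02 K) = pairing ?D s' t' (l \<odot> pi02 K) (m \<odot> pi02 K)"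
      by (rule pairing_sym) (use lmt stt K in auto)
    moreover have "pairing ?D t' s' (t \<odot> idm K) (s \<odot> idm K) = pairing ?D s' t' (s \<odot> idm K) (t \<odot> idm K)"
      by (rule pairing_sym) (use stt K in auto)
    ultimately show ?thesis
      unfolding \<tau>\<tau>r swap2 top left by simp
  qed
  ultimately show ?thesis
    unfolding complete_congruence_def Let_def op_internal_simps
    using gbo_congruence_op[OF gbo] P \<tau>[unfolded d_defs] pullback_sym[OF lm]
      strict_product_sym[OF st] strict_product_sym[OF st']
    unfolding d_defs by blast
qed

end

section \<open>Oppositions\<close>

context two_cat
begin

lemma classifies_mor:
  assumes "classifies K X \<gamma> \<gamma>01" "groupoid_obj C A" "f \<in> hom1 C A X"
  shows "\<exists>!u. u \<in> hom1 C A (obj0 K) \<and> u \<odot> \<gamma> = f"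
  using assms unfolding classifies_def by blast

lemma classifies_cell:
  assumes "classifies K X \<gamma> \<gamma>01" "groupoid_obj C A" "\<alpha> \<in> Ar (hom_cat C A X)"
  shows "\<exists>!a. a \<in> hom1 C A (obj1 K) \<and> a \<rhd> \<gamma>01 = \<alpha>"
  using assms unfolding classifies_def by blast

lemma internal_category_composite:
  assumes "internal_category (und_cat C) K" "a \<in> hom1 C A (obj1 K)" "b \<in> hom1 C A (obj1 K)"
    "a \<odot> pi1 K = b \<odot> pi0 K"
  obtains c where "c \<in> hom1 C A (obj2 K)" "c \<odot> pi01 K = a" "c \<odot> pi12 K = b"
proof -
  have "pullback (und_cat C) (pi1 K) (pi0 K) (pi01 K) (pi12 K)" "pi0 K \<in> hom1 C (obj1 K) (obj0 K)"
    "pi1 K \<in> hom1 C (obj1 K) (obj0 K)" "pi01 K \<in> hom1 C (obj2 K) (obj1 K)"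
    using assms(1) unfolding internal_category_def by simp_all
  then show ?thesis
    using pullback_ex1[of "pi1 K" "pi0 K" "pi01 K" "pi12 K" a b] assms(2-4) that by auto
qed

end

locale opposed = two_cat C for C :: "('o, 'm, 'c) tcat" (structure) +
  fixes X X' :: 'o and K :: "('o, 'm) internal" and \<gamma> \<gamma>' :: 'm and \<gamma>01 \<gamma>01' :: 'c
  assumes groupoidant: "groupoidant C" and opposition: "opposition C X X' K \<gamma> \<gamma>01 \<gamma>' \<gamma>01'"
begin

abbreviation "om \<equiv> opp_mor C K \<gamma> \<gamma>'"
abbreviation "oc \<equiv> opp_cell C K \<gamma>01 \<gamma>01'"

lemma complete_K: "complete_congruence C K" and quotient_X: "strict_quotient C K X \<gamma> \<gamma>01"
  and quotient_X': "strict_quotient C (op_internal K) X' \<gamma>' \<gamma>01'"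
  using opposition unfolding opposition_def by auto

lemma classifies_X: "classifies K X \<gamma> \<gamma>01"
  by (rule strict_quotient_classifies[OF groupoidant complete_K quotient_X])

lemma classifies_X': "classifies (op_internal K) X' \<gamma>' \<gamma>01'"
  by (rule strict_quotient_classifies[OF groupoidant complete_congruence_op[OF complete_K] quotient_X'])

lemma gbo_K: "gbo_congruence C K"
  using complete_K unfolding complete_congruence_def by blast

lemma internal_category_K: "internal_category (und_cat C) K"
  using gbo_K unfolding gbo_congruence_def internal_double_category_def by blast

lemma internal_typed_K: "internal_typed K"
  using gbo_K internal_category_K unfolding gbo_congruence_def internal_typed_def internal_category_def pullback_def
  by simp

lemma K_typed:
  "groupoid_obj C (obj0 K)" "groupoid_obj C (obj1 K)" "groupoid_obj C (obj2 K)"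
  "pi0 K \<in> hom1 C (obj1 K) (obj0 K)" "pi1 K \<in> hom1 C (obj1 K) (obj0 K)"
  "idm K \<in> hom1 C (obj0 K) (obj1 K)" "pi01 K \<in> hom1 C (obj2 K) (obj1 K)"
  "pi12 K \<in> hom1 C (obj2 K) (obj1 K)" "pi02 K \<in> hom1 C (obj2 K) (obj1 K)"
  using internal_typed_K unfolding internal_typed_def by auto

lemma \<gamma>_typed:
  "\<gamma> \<in> Mor C" "dom1 C \<gamma> = obj0 K" "cod1 C \<gamma> = X"
  "\<gamma>01 \<in> Cell C" "dom2 C \<gamma>01 = pi0 K \<odot> \<gamma>" "cod2 C \<gamma>01 = pi1 K \<odot> \<gamma>"
  "idm K \<rhd> \<gamma>01 = id2 C \<gamma>" "pi02 K \<rhd> \<gamma>01 = pi01 K \<rhd> \<gamma>01 \<bullet> pi12 K \<rhd> \<gamma>01"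
  using strict_quotient_typed(1)[OF quotient_X] unfolding is_cocone_def by auto

lemma \<gamma>'_typed:
  "\<gamma>' \<in> Mor C" "dom1 C \<gamma>' = obj0 K" "cod1 C \<gamma>' = X'"
  "\<gamma>01' \<in> Cell C" "dom2 C \<gamma>01' = pi1 K \<odot> \<gamma>'" "cod2 C \<gamma>01' = pi0 K \<odot> \<gamma>'"
  "idm K \<rhd> \<gamma>01' = id2 C \<gamma>'" "pi02 K \<rhd> \<gamma>01' = pi12 K \<rhd> \<gamma>01' \<bullet> pi01 K \<rhd> \<gamma>01'"
  using strict_quotient_typed(1)[OF quotient_X'] unfolding is_cocone_def by auto

lemmas obj_typed = strict_quotient_typed(2)[OF quotient_X] strict_quotient_typed(2)[OF quotient_X']

text \<open>Evaluates the definite description once a factorization is exhibited. Together with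
  \<open>opp_cell_eq\<close> this reduces each law of the operation to finding a classifying
  morphism.\<close>

lemma opp_mor_eq:
  assumes "groupoid_obj C A" "u \<in> hom1 C A (obj0 K)"
  shows "om (u \<odot> \<gamma>) = u \<odot> \<gamma>'"
proof -
  have "u \<odot> \<gamma> \<in> hom1 C A X" using assms \<gamma>_typed by simp
  then have "(THE h. h \<in> hom1 C A (obj0 K) \<and> h \<odot> \<gamma> = u \<odot> \<gamma>) = u"
    using classifies_mor[OF classifies_X assms(1)] assms(2) by (intro the1_equality) auto
  then show ?thesis using assms \<gamma>_typed unfolding opp_mor_def by simp
qed

lemma opp_cell_eq:
  assumes "groupoid_obj C A" "a \<in> hom1 C A (obj1 K)"
  shows "oc (a \<rhd> \<gamma>01) = a \<rhd> \<gamma>01'"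
proof -
  have d: "a \<rhd> \<gamma>01 \<in> Ar (hom_cat C A X)" using assms \<gamma>_typed K_typed by simp
  then have "(THE h. h \<in> hom1 C A (obj1 K) \<and> h \<rhd> \<gamma>01 = a \<rhd> \<gamma>01) = a"
    using classifies_cell[OF classifies_X assms(1)] assms(2) by (intro the1_equality) auto
  moreover have "dom1 C (dom2 C (a \<rhd> \<gamma>01)) = A" using d by simp
  ultimately show ?thesis unfolding opp_cell_def by simp
qed

lemma opp_mor_obtain:
  assumes "groupoid_obj C A" "f \<in> hom1 C A X"
  obtains u where "u \<in> Mor C" "dom1 C u = A" "cod1 C u = obj0 K" "f = u \<odot> \<gamma>" "om f = u \<odot> \<gamma>'"
  using classifies_mor[OF classifies_X assms] opp_mor_eq[OF assms(1)] by auto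

lemma opp_cell_obtain:
  assumes "groupoid_obj C A" "\<alpha> \<in> Ar (hom_cat C A X)"
  obtains a where "a \<in> Mor C" "dom1 C a = A" "cod1 C a = obj1 K" "\<alpha> = a \<rhd> \<gamma>01" "oc \<alpha> = a \<rhd> \<gamma>01'"
  using classifies_cell[OF classifies_X assms] opp_cell_eq[OF assms(1)] by auto

text \<open>The reversal comes from the cocone of the opposite congruence: one and the same
  \<open>a\<close> names a 2-cell from source to target over \<open>\<gamma>\<close> and from target
  to source over \<open>\<gamma>'\<close>.\<close>

lemma opp_cell_hom2:
  assumes A: "groupoid_obj C A" and \<alpha>: "\<alpha> \<in> Ar (hom_cat C A X)"
  shows "oc \<alpha> \<in> hom2 C (om (cod2 C \<alpha>)) (om (dom2 C \<alpha>))"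
proof -
  obtain a where a: "a \<in> Mor C" "dom1 C a = A" "cod1 C a = obj1 K" "\<alpha> = a \<rhd> \<gamma>01" "oc \<alpha> = a \<rhd> \<gamma>01'"
    by (rule opp_cell_obtain[OF A \<alpha>])
  have "dom2 C \<alpha> = (a \<odot> pi0 K) \<odot> \<gamma>" "cod2 C \<alpha> = (a \<odot> pi1 K) \<odot> \<gamma>"
    using a K_typed \<gamma>_typed by simp_all
  then have "om (dom2 C \<alpha>) = (a \<odot> pi0 K) \<odot> \<gamma>'" "om (cod2 C \<alpha>) = (a \<odot> pi1 K) \<odot> \<gamma>'"
    using opp_mor_eq[OF A] a K_typed by simp_all
  then show ?thesis using a K_typed \<gamma>'_typed by simp
qed

lemma opp_mor_hom1: "groupoid_obj C A \<Longrightarrow> f \<in> hom1 C A X \<Longrightarrow> om f \<in> hom1 C A X'"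
  by (rule opp_mor_obtain[of A f]) (use \<gamma>'_typed in auto)

text \<open>The identity on \<open>u \<odot> \<gamma>\<close> is named by
  \<open>u \<odot> idm K\<close>, and the unit law of the second cocone turns the same morphism into
  an identity.\<close>

lemma opp_cell_id2:
  assumes A: "groupoid_obj C A" and f: "f \<in> hom1 C A X"
  shows "oc (id2 C f) = id2 C (om f)"
proof -
  obtain u where u: "u \<in> Mor C" "dom1 C u = A" "cod1 C u = obj0 K" "f = u \<odot> \<gamma>" "om f = u \<odot> \<gamma>'"
    by (rule opp_mor_obtain[OF A f])
  have "id2 C f = (u \<odot> idm K) \<rhd> \<gamma>01" "id2 C (om f) = (u \<odot> idm K) \<rhd> \<gamma>01'"
    using u K_typed \<gamma>_typed \<gamma>'_typed by simp_all
  then show ?thesis using opp_cell_eq[OF A, of "u \<odot> idm K"] u K_typed by simp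
qed

text \<open>The classifying morphisms assemble into a composable pair \<open>c\<close>, and
  \<open>c \<odot> pi02 K\<close> names the composite. The composition law of the second cocone
  lists the two factors in the other order.\<close>

lemma opp_cell_vcomp:
  assumes A: "groupoid_obj C A" and \<alpha>: "\<alpha> \<in> Ar (hom_cat C A X)" and \<beta>: "\<beta> \<in> Ar (hom_cat C A X)"
    and \<alpha>\<beta>: "cod2 C \<alpha> = dom2 C \<beta>"
  shows "oc (\<alpha> \<bullet> \<beta>) = oc \<beta> \<bullet> oc \<alpha>"
proof -
  obtain a where a: "a \<in> Mor C" "dom1 C a = A" "cod1 C a = obj1 K" "\<alpha> = a \<rhd> \<gamma>01" "oc \<alpha> = a \<rhd> \<gamma>01'"
    by (rule opp_cell_obtain[OF A \<alpha>])
  obtain b where b: "b \<in> Mor C" "dom1 C b = A" "cod1 C b = obj1 K" "\<beta> = b \<rhd> \<gamma>01" "oc \<beta> = b \<rhd> \<gamma>01'"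
    by (rule opp_cell_obtain[OF A \<beta>])
  have "cod2 C \<alpha> \<in> hom1 C A X" using \<alpha> by simp
  moreover have "cod2 C \<alpha> = (a \<odot> pi1 K) \<odot> \<gamma>" "cod2 C \<alpha> = (b \<odot> pi0 K) \<odot> \<gamma>"
    using a b K_typed \<gamma>_typed \<alpha>\<beta> by simp_all
  moreover have "a \<odot> pi1 K \<in> hom1 C A (obj0 K)" "b \<odot> pi0 K \<in> hom1 C A (obj0 K)"
    using a b K_typed by simp_all
  \<comment> \<open>Composability in \<open>X\<close> lifts to the congruence, since morphisms from
    \<open>A\<close> to \<open>obj0 K\<close> are determined by their composites with
    \<open>\<gamma>\<close>.\<close>
  ultimately have "a \<odot> pi1 K = b \<odot> pi0 K"
    using classifies_mor[OF classifies_X A, of "cod2 C \<alpha>"] by metis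
  then obtain c where c: "c \<in> hom1 C A (obj2 K)" "c \<odot> pi01 K = a" "c \<odot> pi12 K = b"
    using internal_category_composite[OF internal_category_K, of a A b] a b by auto
  have comp: "c \<odot> pi02 K \<in> hom1 C A (obj1 K)" using c K_typed by simp
  have match: "pi01 K \<odot> pi1 K = pi12 K \<odot> pi0 K"
    using internal_category_K unfolding internal_category_def pullback_def by simp
  have "\<alpha> \<bullet> \<beta> = c \<rhd> (pi01 K \<rhd> \<gamma>01) \<bullet> c \<rhd> (pi12 K \<rhd> \<gamma>01)"
    unfolding a(4) b(4) c(2,3)[symmetric] using c(1) K_typed \<gamma>_typed by simp
  also have "\<dots> = (c \<odot> pi02 K) \<rhd> \<gamma>01"
    using c(1) K_typed \<gamma>_typed match comp1_assoc[of "pi01 K" "pi1 K" \<gamma>] comp1_assoc[of "pi12 K" "pi0 K" \<gamma>]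
    by simp
  finally have "oc (\<alpha> \<bullet> \<beta>) = (c \<odot> pi02 K) \<rhd> \<gamma>01'"
    using opp_cell_eq[OF A comp] by simp
  also have "\<dots> = c \<rhd> (pi12 K \<rhd> \<gamma>01') \<bullet> c \<rhd> (pi01 K \<rhd> \<gamma>01')"
    using c(1) K_typed \<gamma>'_typed match comp1_assoc[of "pi01 K" "pi1 K" \<gamma>'] comp1_assoc[of "pi12 K" "pi0 K" \<gamma>']
    by simp
  also have "\<dots> = oc \<beta> \<bullet> oc \<alpha>"
    unfolding a(5) b(5) c(2,3)[symmetric] using c(1) K_typed \<gamma>'_typed by simp
  finally show ?thesis .
qed

lemma opp_mor_bij:
  assumes A: "groupoid_obj C A"
  shows "bij_betw om (hom1 C A X) (hom1 C A X')"
proof (rule bij_betw_imageI)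
  show "inj_on om (hom1 C A X)"
  proof (rule inj_onI)
    fix f g assume f: "f \<in> hom1 C A X" and g: "g \<in> hom1 C A X" and fg: "om f = om g"
    obtain u where u: "u \<in> Mor C" "dom1 C u = A" "cod1 C u = obj0 K" "f = u \<odot> \<gamma>" "om f = u \<odot> \<gamma>'"
      by (rule opp_mor_obtain[OF A f])
    obtain v where v: "v \<in> Mor C" "dom1 C v = A" "cod1 C v = obj0 K" "g = v \<odot> \<gamma>" "om g = v \<odot> \<gamma>'"
      by (rule opp_mor_obtain[OF A g])
    have "u = v"
      using classifies_mor[OF classifies_X' A opp_mor_hom1[OF A f]] u v fg by auto
    then show "f = g" using u v by simp
  qed
  show "om ` hom1 C A X = hom1 C A X'"
  proof (intro equalityI subsetI)
    fix g assume "g \<in> hom1 C A X'"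
    then obtain u where u: "u \<in> hom1 C A (obj0 K)" "u \<odot> \<gamma>' = g"
      using classifies_mor[OF classifies_X' A, of g] unfolding op_internal_simps by blast
    then have "g = om (u \<odot> \<gamma>)" "u \<odot> \<gamma> \<in> hom1 C A X" using opp_mor_eq[OF A] \<gamma>_typed by auto
    then show "g \<in> om ` hom1 C A X" by blast
  qed (use opp_mor_hom1[OF A] in blast)
qed

lemma opp_cell_bij:
  assumes A: "groupoid_obj C A"
  shows "bij_betw oc (Ar (hom_cat C A X)) (Ar (hom_cat C A X'))"
proof (rule bij_betw_imageI)
  have oc_Ar: "oc \<alpha> \<in> Ar (hom_cat C A X')" if "\<alpha> \<in> Ar (hom_cat C A X)" for \<alpha>
    using opp_cell_hom2[OF A that] opp_mor_hom1[OF A, of "cod2 C \<alpha>"] that by auto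
  show "inj_on oc (Ar (hom_cat C A X))"
  proof (rule inj_onI)
    fix f g assume f: "f \<in> Ar (hom_cat C A X)" and g: "g \<in> Ar (hom_cat C A X)" and fg: "oc f = oc g"
    obtain u where u: "u \<in> Mor C" "dom1 C u = A" "cod1 C u = obj1 K" "f = u \<rhd> \<gamma>01" "oc f = u \<rhd> \<gamma>01'"
      by (rule opp_cell_obtain[OF A f])
    obtain v where v: "v \<in> Mor C" "dom1 C v = A" "cod1 C v = obj1 K" "g = v \<rhd> \<gamma>01" "oc g = v \<rhd> \<gamma>01'"
      by (rule opp_cell_obtain[OF A g])
    have "u = v"
      using classifies_cell[OF classifies_X' A oc_Ar[OF f]] u v fg by auto
    then show "f = g" using u v by simp
  qed
  show "oc ` Ar (hom_cat C A X) = Ar (hom_cat C A X')"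
  proof (intro equalityI subsetI)
    fix g assume "g \<in> Ar (hom_cat C A X')"
    then obtain a where a: "a \<in> hom1 C A (obj1 K)" "a \<rhd> \<gamma>01' = g"
      using classifies_cell[OF classifies_X' A, of g] unfolding op_internal_simps by blast
    then have "g = oc (a \<rhd> \<gamma>01)" "a \<rhd> \<gamma>01 \<in> Ar (hom_cat C A X)"
      using opp_cell_eq[OF A] \<gamma>_typed K_typed by auto
    then show "g \<in> oc ` Ar (hom_cat C A X)" by blast
  qed (use oc_Ar in blast)
qed

lemma opp_cat_iso:
  assumes A: "groupoid_obj C A"
  shows "cat_iso (op_cat (hom_cat C A X)) (hom_cat C A X') (om, oc)"
proof -
  have "is_functor (op_cat (hom_cat C A X)) (hom_cat C A X') (om, oc)"
    unfolding is_functor_def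
    using opp_mor_hom1[OF A] opp_cell_hom2[OF A] opp_cell_id2[OF A] opp_cell_vcomp[OF A] opp_cell_bij[OF A, THEN bij_betw_imp_surj_on]
    by (auto simp: op_cat_def hom_def)
  then show ?thesis
    unfolding cat_iso_def using opp_mor_bij[OF A] opp_cell_bij[OF A] by (simp add: op_cat_def)
qed

section \<open>Naturality of the operation in the groupoid\<close>

lemma opp_mor_precomp:
  assumes A: "groupoid_obj C A" and B: "groupoid_obj C B" and k: "k \<in> hom1 C B A" and f: "f \<in> hom1 C A X"
  shows "om (k \<odot> f) = k \<odot> om f"
proof -
  obtain u where u: "u \<in> Mor C" "dom1 C u = A" "cod1 C u = obj0 K" "f = u \<odot> \<gamma>" "om f = u \<odot> \<gamma>'"
    by (rule opp_mor_obtain[OF A f])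
  then show ?thesis
    using opp_mor_eq[OF B, of "k \<odot> u"] k \<gamma>_typed \<gamma>'_typed by simp
qed

text \<open>If \<open>a\<close> names \<open>\<alpha>\<close>, then \<open>k \<odot> a\<close> names
  \<open>k \<rhd> \<alpha>\<close>, and it does the corresponding thing for both cocones at
  once.\<close>

lemma opp_cell_precomp:
  assumes A: "groupoid_obj C A" and B: "groupoid_obj C B" and k: "k \<in> hom1 C B A"
    and \<alpha>: "\<alpha> \<in> Ar (hom_cat C A X)"
  shows "oc (k \<rhd> \<alpha>) = k \<rhd> oc \<alpha>"
proof -
  obtain a where a: "a \<in> Mor C" "dom1 C a = A" "cod1 C a = obj1 K" "\<alpha> = a \<rhd> \<gamma>01" "oc \<alpha> = a \<rhd> \<gamma>01'"
    by (rule opp_cell_obtain[OF A \<alpha>])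
  then show ?thesis
    using opp_cell_eq[OF B, of "k \<odot> a"] k \<gamma>_typed \<gamma>'_typed K_typed by simp
qed

text \<open>Interchanging the reflection 2-cell \<open>\<rho>\<close> with either cocone shows that the reflection
  morphism classifies \<open>\<partial>\<gamma>\<close> for the first cocone and the inverse of \<open>\<partial>\<gamma>'\<close> for the second.\<close>

lemma opp_cell_inv_core:
  assumes B: "groupoid_obj C B" and \<beta>: "\<beta> \<in> Cell C" "dom1 C (dom2 C \<beta>) = B" "cod1 C (dom2 C \<beta>) = obj0 K"
  shows "oc (inv_cell C \<beta> \<lhd> \<gamma>) = \<beta> \<lhd> \<gamma>'"
proof -
  obtain P ev r where P: "strict_cotensor C (ord_cat 1) (obj0 K) P ev" and r: "is_reflection C K P ev r"
    using complete_K unfolding complete_congruence_def by blast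
  define d0 d1 d where "d0 = fst ev 0" and "d1 = fst ev 1" and "d = snd ev (0, 1)"
  note d_defs = this
  have ar: "arrow_object (obj0 K) P d0 d1 d"
    unfolding d_defs by (rule cotensor_arrow_object[OF P])
  note art = arrow_object_typed[OF ar]
  obtain \<rho> where r: "r \<in> hom1 C P (obj1 K)" and \<rho>: "\<rho> \<in> hom2 C r (d1 \<odot> idm K)"
    "\<rho> \<lhd> pi0 K = d" "\<rho> \<lhd> pi1 K = id2 C d1"
    using r unfolding is_reflection_def d_defs by blast
  have "r \<rhd> \<gamma>01 \<bullet> \<rho> \<lhd> (pi1 K \<odot> \<gamma>) = \<rho> \<lhd> (pi0 K \<odot> \<gamma>) \<bullet> (d1 \<odot> idm K) \<rhd> \<gamma>01"
    using hcomp_whisker[of \<rho> \<gamma>01] \<rho>(1) r \<gamma>_typed K_typed by simp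
  then have 1: "r \<rhd> \<gamma>01 = d \<lhd> \<gamma>"
  proof -
    assume eq: "r \<rhd> \<gamma>01 \<bullet> \<rho> \<lhd> (pi1 K \<odot> \<gamma>) = \<rho> \<lhd> (pi0 K \<odot> \<gamma>) \<bullet> (d1 \<odot> idm K) \<rhd> \<gamma>01"
    \<comment> \<open>The second component of \<open>\<rho>\<close> is an identity, and so is
      \<open>\<gamma>01\<close> on identity arrows: two of the four factors of the interchange
      square vanish.\<close>
    have e: "\<rho> \<lhd> (pi1 K \<odot> \<gamma>) = id2 C (d1 \<odot> \<gamma>)" "\<rho> \<lhd> (pi0 K \<odot> \<gamma>) = d \<lhd> \<gamma>"
      "(d1 \<odot> idm K) \<rhd> \<gamma>01 = id2 C (d1 \<odot> \<gamma>)"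
      using \<rho> r \<gamma>_typed K_typed art by simp_all
    have "dom2 C (\<rho> \<lhd> pi1 K) = r \<odot> pi1 K" using r \<rho>(1) K_typed by simp
    then have "r \<odot> pi1 K = d1" unfolding \<rho>(3) using art by simp
    then have "cod2 C (r \<rhd> \<gamma>01) = d1 \<odot> \<gamma>"
      using r \<gamma>_typed K_typed comp1_assoc[of r "pi1 K" \<gamma>] by simp
    then show ?thesis using eq unfolding e using r \<gamma>_typed K_typed art by simp
  qed
  \<comment> \<open>For the second cocone source and target are exchanged, so
    \<open>d \<lhd> \<gamma>'\<close> lands on the same side as \<open>r \<rhd> \<gamma>01'\<close>,
    and the square says that they compose to an identity.\<close>
  have "r \<rhd> \<gamma>01' \<bullet> \<rho> \<lhd> (pi0 K \<odot> \<gamma>') = \<rho> \<lhd> (pi1 K \<odot> \<gamma>') \<bullet> (d1 \<odot> idm K) \<rhd> \<gamma>01'"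
    using hcomp_whisker[of \<rho> \<gamma>01'] \<rho>(1) r \<gamma>'_typed K_typed by simp
  moreover have "\<rho> \<lhd> (pi1 K \<odot> \<gamma>') = id2 C (d1 \<odot> \<gamma>')" "\<rho> \<lhd> (pi0 K \<odot> \<gamma>') = d \<lhd> \<gamma>'"
    "(d1 \<odot> idm K) \<rhd> \<gamma>01' = id2 C (d1 \<odot> \<gamma>')"
    using \<rho> r \<gamma>'_typed K_typed art by simp_all
  ultimately have 2: "r \<rhd> \<gamma>01' \<bullet> d \<lhd> \<gamma>' = id2 C (d1 \<odot> \<gamma>')"
    using \<gamma>'_typed art by simp
  have inv: "inverse_arrows (vert_cat C) \<beta> (inv_cell C \<beta>)"
    by (rule groupoid_obj_inv[OF K_typed(1) \<beta>(1,3)])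
  then have inv_t: "inv_cell C \<beta> \<in> Cell C" "dom2 C (inv_cell C \<beta>) = cod2 C \<beta>"
    "cod2 C (inv_cell C \<beta>) = dom2 C \<beta>"
    by auto
  \<comment> \<open>\<open>b\<close> is chosen to name the inverse of \<open>\<beta>\<close>: the
    second cocone inverts once more and so returns \<open>\<beta>\<close>.\<close>
  obtain b where b: "b \<in> Mor C" "dom1 C b = B" "cod1 C b = P" "b \<rhd> d = inv_cell C \<beta>"
    "b \<odot> d0 = cod2 C \<beta>" "b \<odot> d1 = dom2 C \<beta>"
    by (rule arrow_object_obtain[OF ar inv_t(1)]) (use inv_t \<beta> in auto)
  have "inv_cell C \<beta> \<lhd> \<gamma> = (b \<odot> r) \<rhd> \<gamma>01"
    using b r 1 \<gamma>_typed K_typed art lrwhisker[of b \<gamma> d] by simp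
  then have "oc (inv_cell C \<beta> \<lhd> \<gamma>) = (b \<odot> r) \<rhd> \<gamma>01'"
    using opp_cell_eq[OF B, of "b \<odot> r"] b r by simp
  also have "\<dots> = \<beta> \<lhd> \<gamma>'"
  proof -
    let ?x = "(b \<odot> r) \<rhd> \<gamma>01'"
    have x: "?x \<in> Cell C" "?x = b \<rhd> (r \<rhd> \<gamma>01')"
      using b r \<gamma>'_typed K_typed by simp_all
    have "dom2 C (\<rho> \<lhd> pi0 K) = r \<odot> pi0 K" "dom2 C (\<rho> \<lhd> pi1 K) = r \<odot> pi1 K"
      using r \<rho>(1) K_typed by simp_all
    then have r01: "r \<odot> pi0 K = d0" "r \<odot> pi1 K = d1" unfolding \<rho>(2,3) using art by simp_all
    have rt: "r \<rhd> \<gamma>01' \<in> Cell C" "dom2 C (r \<rhd> \<gamma>01') = d1 \<odot> \<gamma>'" "cod2 C (r \<rhd> \<gamma>01') = d0 \<odot> \<gamma>'"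
      using r \<gamma>'_typed K_typed r01 comp1_assoc[of r "pi1 K" \<gamma>'] comp1_assoc[of r "pi0 K" \<gamma>'] by simp_all
    have xt: "dom2 C ?x = dom2 C \<beta> \<odot> \<gamma>'" "cod2 C ?x = cod2 C \<beta> \<odot> \<gamma>'"
      unfolding x(2) using rt b \<gamma>'_typed art comp1_assoc[of b d1 \<gamma>'] comp1_assoc[of b d0 \<gamma>'] by simp_all
    have "b \<rhd> (r \<rhd> \<gamma>01' \<bullet> d \<lhd> \<gamma>') = id2 C (dom2 C \<beta> \<odot> \<gamma>')"
      unfolding 2 using b art \<gamma>'_typed comp1_assoc[of b d1 \<gamma>'] by simp
    moreover have "b \<rhd> (r \<rhd> \<gamma>01' \<bullet> d \<lhd> \<gamma>') = ?x \<bullet> inv_cell C \<beta> \<lhd> \<gamma>'"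
      unfolding x(2) using lwhisker_vcomp[of b "r \<rhd> \<gamma>01'" "d \<lhd> \<gamma>'"] rt b(1-4) art \<gamma>'_typed
        lrwhisker[of b \<gamma>' d] by simp
    ultimately have left: "?x \<bullet> inv_cell C \<beta> \<lhd> \<gamma>' = id2 C (dom2 C \<beta> \<odot> \<gamma>')" by simp
    have "inv_cell C \<beta> \<lhd> \<gamma>' \<bullet> \<beta> \<lhd> \<gamma>' = id2 C (cod2 C \<beta> \<odot> \<gamma>')"
      using rwhisker_inverse[OF inv, of \<gamma>'] \<beta> \<gamma>'_typed by simp
    \<comment> \<open>Cancels the invertible cell \<open>inv_cell C \<beta> \<lhd> \<gamma>'\<close>
      on the right.\<close>
    then have "?x = ?x \<bullet> (inv_cell C \<beta> \<lhd> \<gamma>' \<bullet> \<beta> \<lhd> \<gamma>')"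
      using x(1) xt by simp
    also have "\<dots> = (?x \<bullet> inv_cell C \<beta> \<lhd> \<gamma>') \<bullet> \<beta> \<lhd> \<gamma>'"
      by (rule vcomp_assoc[symmetric]) (use x(1) xt inv_t \<beta> \<gamma>'_typed in auto)
    also have "\<dots> = \<beta> \<lhd> \<gamma>'"
      unfolding left using \<beta> \<gamma>'_typed by simp
    finally show ?thesis .
  qed
  finally show ?thesis .
qed

text \<open>Writing \<open>g\<close> as \<open>u \<odot> \<gamma>\<close> moves the question to
  \<open>\<sigma> \<lhd> u\<close>, a 2-cell into \<open>obj0 K\<close>, where the reflection
  decides it. This is the componentwise content of naturality in 2-cells.\<close>

lemma opp_cell_inv_whisker:
  assumes A: "groupoid_obj C A" and \<sigma>: "\<sigma> \<in> Cell C" "cod1 C (dom2 C \<sigma>) = A"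
    and B: "groupoid_obj C (dom1 C (dom2 C \<sigma>))" and g: "g \<in> hom1 C A X"
  shows "oc (inv_cell C \<sigma> \<lhd> g) = \<sigma> \<lhd> om g"
proof -
  obtain u where u: "u \<in> Mor C" "dom1 C u = A" "cod1 C u = obj0 K" "g = u \<odot> \<gamma>" "om g = u \<odot> \<gamma>'"
    by (rule opp_mor_obtain[OF A g])
  have inv: "inverse_arrows (vert_cat C) \<sigma> (inv_cell C \<sigma>)"
    by (rule groupoid_obj_inv[OF A \<sigma>])
  then have "inv_cell C (\<sigma> \<lhd> u) = inv_cell C \<sigma> \<lhd> u"
    by (intro inv_cellI rwhisker_inverse) (use u \<sigma> in auto)
  moreover have "inv_cell C \<sigma> \<in> Cell C" "cod1 C (dom2 C (inv_cell C \<sigma>)) = A"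
    using inv \<sigma> by auto
  moreover have "oc (inv_cell C (\<sigma> \<lhd> u) \<lhd> \<gamma>) = \<sigma> \<lhd> u \<lhd> \<gamma>'"
    by (rule opp_cell_inv_core[OF B]) (use u \<sigma> in auto)
  moreover have "inv_cell C \<sigma> \<lhd> g = inv_cell C \<sigma> \<lhd> u \<lhd> \<gamma>"
    unfolding u(4) using calculation(2,3) u(1-3) \<gamma>_typed by simp
  moreover have "\<sigma> \<lhd> om g = \<sigma> \<lhd> u \<lhd> \<gamma>'"
    unfolding u(5) using u(1-3) \<sigma> \<gamma>'_typed by simp
  ultimately show ?thesis by simp
qed

end

section \<open>Representable 2-functors on groupoids\<close>

lemma op_cat_simps [simp]:
  "Ob (op_cat D) = Ob D" "Ar (op_cat D) = Ar D" "src (op_cat D) = tgt D" "tgt (op_cat D) = src D"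
  "ident (op_cat D) = ident D" "comp (op_cat D) = (\<lambda>f g. g \<cdot>\<^bsub>D\<^esub> f)"
  by (simp_all add: op_cat_def)

lemma category_op: "category D \<Longrightarrow> category (op_cat D)"
  unfolding category_def hom_def by simp

lemma ext_functor_op: "ext_functor D E F \<Longrightarrow> ext_functor (op_cat D) (op_cat E) F"
  unfolding ext_functor_def is_functor_def by (auto simp: hom_def)

lemma Cat_simps [simp]:
  "Obj Cat = {D. category D}"
  "(D, E, F) \<in> Mor Cat \<longleftrightarrow> category D \<and> category E \<and> ext_functor D E F"
  "(M, N, \<eta>) \<in> Cell Cat \<longleftrightarrow> M \<in> Mor Cat \<and> N \<in> Mor Cat \<and> fst N = fst M \<and> fst (snd N) = fst (snd M) \<and>
     nat_trans (fst M) (fst (snd M)) (snd (snd M)) (snd (snd N)) \<eta>"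
  "dom1 Cat = (\<lambda>(D, E, F). D)" "cod1 Cat = (\<lambda>(D, E, F). E)"
  "id1 Cat = (\<lambda>D. (D, D, (restrict (\<lambda>x. x) (Ob D), restrict (\<lambda>a. a) (Ar D))))"
  "comp1 Cat = comp_cat_mor" "dom2 Cat = (\<lambda>(F, G, \<eta>). F)" "cod2 Cat = (\<lambda>(F, G, \<eta>). G)"
  "id2 Cat = (\<lambda>(D, E, F). ((D, E, F), (D, E, F), restrict (\<lambda>x. ident E (fst F x)) (Ob D)))"
  "vcomp Cat = vcomp_cat_cell" "hcomp Cat = hcomp_cat_cell"
  unfolding Cat_def by (auto split: prod.splits)

lemma gpd_simps [simp]:
  "Obj (gpd C) = {X. groupoid_obj C X}"
  "f \<in> Mor (gpd C) \<longleftrightarrow> f \<in> Mor C \<and> groupoid_obj C (dom1 C f) \<and> groupoid_obj C (cod1 C f)"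
  "\<alpha> \<in> Cell (gpd C) \<longleftrightarrow> \<alpha> \<in> Cell C \<and> groupoid_obj C (dom1 C (dom2 C \<alpha>)) \<and>
     groupoid_obj C (cod1 C (dom2 C \<alpha>))"
  "dom1 (gpd C) = dom1 C" "cod1 (gpd C) = cod1 C" "id1 (gpd C) = id1 C" "comp1 (gpd C) = comp1 C"
  "dom2 (gpd C) = dom2 C" "cod2 (gpd C) = cod2 C" "id2 (gpd C) = id2 C" "vcomp (gpd C) = vcomp C"
  "hcomp (gpd C) = hcomp C"
  by (auto simp: gpd_def)

lemma op_tcat_simps [simp]:
  "Obj (op_tcat C) = Obj C" "Mor (op_tcat C) = Mor C" "Cell (op_tcat C) = Cell C"
  "dom1 (op_tcat C) = cod1 C" "cod1 (op_tcat C) = dom1 C" "id1 (op_tcat C) = id1 C"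
  "comp1 (op_tcat C) = (\<lambda>f g. comp1 C g f)" "dom2 (op_tcat C) = dom2 C" "cod2 (op_tcat C) = cod2 C"
  "id2 (op_tcat C) = id2 C" "vcomp (op_tcat C) = vcomp C" "hcomp (op_tcat C) = (\<lambda>\<alpha> \<beta>. hcomp C \<beta> \<alpha>)"
  by (auto simp: op_tcat_def)

lemma vert_cat_simps [simp]:
  "Ob (vert_cat C) = Mor C" "Ar (vert_cat C) = Cell C" "src (vert_cat C) = dom2 C"
  "tgt (vert_cat C) = cod2 C" "ident (vert_cat C) = id2 C" "comp (vert_cat C) = vcomp C"
  "hom (vert_cat C) f g = hom2 C f g"
  by (auto simp: vert_cat_def hom_def)

lemma horiz_cat_simps [simp]:
  "Ob (horiz_cat C) = Obj C" "Ar (horiz_cat C) = Cell C" "src (horiz_cat C) = (\<lambda>\<alpha>. dom1 C (dom2 C \<alpha>))"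
  "tgt (horiz_cat C) = (\<lambda>\<alpha>. cod1 C (dom2 C \<alpha>))" "ident (horiz_cat C) = (\<lambda>A. id2 C (id1 C A))"
  "comp (horiz_cat C) = hcomp C"
  by (auto simp: horiz_cat_def)

fun op_cat_cell :: "('a, 'b) cat_cell \<Rightarrow> ('a, 'b) cat_cell" where
  "op_cat_cell (M, N, \<eta>) = (op_cat_mor N, op_cat_mor M, \<eta>)"

lemma op_cat_mor_Mor: "M \<in> Mor Cat \<Longrightarrow> op_cat_mor M \<in> Mor Cat"
  by (cases M) (auto intro: category_op ext_functor_op)

lemma op_cat_mor_id: "op_cat_mor (id1 Cat D) = id1 Cat (op_cat D)"
  by simp

lemma op_cat_mor_comp: "op_cat_mor (comp_cat_mor M N) = comp_cat_mor (op_cat_mor M) (op_cat_mor N)"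
  by (cases M; cases N) simp

lemma op_cat_cell_Cell:
  assumes "\<kappa> \<in> Cell Cat"
  shows "op_cat_cell \<kappa> \<in> Cell Cat"
proof -
  obtain D E F G \<eta> where \<kappa>: "\<kappa> = ((D, E, F), (D, E, G), \<eta>)"
    using assms by (cases \<kappa>) auto
  have "nat_trans (op_cat D) (op_cat E) G F \<eta>"
  proof -
    have "nat_trans D E F G \<eta>" using assms unfolding \<kappa> by simp
    then show ?thesis unfolding nat_trans_def by (auto simp: hom_def)
  qed
  then show ?thesis using assms unfolding \<kappa> by (auto intro: category_op ext_functor_op)
qed

lemma op_cat_cell_id: "op_cat_cell (id2 Cat M) = id2 Cat (op_cat_mor M)"
  by (cases M) simp

lemma op_cat_cell_vcomp:
  assumes "\<kappa> \<in> Cell Cat" "\<mu> \<in> Cell Cat" "cod2 Cat \<kappa> = dom2 Cat \<mu>"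
  shows "op_cat_cell (vcomp_cat_cell \<kappa> \<mu>) = vcomp_cat_cell (op_cat_cell \<mu>) (op_cat_cell \<kappa>)"
proof -
  obtain D E F G \<eta> where \<kappa>: "\<kappa> = ((D, E, F), (D, E, G), \<eta>)"
    using assms(1) by (cases \<kappa>) auto
  then obtain H \<theta> where \<mu>: "\<mu> = ((D, E, G), (D, E, H), \<theta>)"
    using assms(2,3) by (cases \<mu>) auto
  show ?thesis unfolding \<kappa> \<mu> by simp
qed

text \<open>A horizontal composite can be computed along either side of a naturality square, and
  passing to opposites changes the side chosen in \<open>hcomp_cat_cell\<close>; naturality of
  \<open>\<theta>\<close> at \<open>\<eta> x\<close> equates them.\<close>

lemma op_cat_cell_hcomp:
  assumes "\<kappa> \<in> Cell Cat" "\<mu> \<in> Cell Cat" "cod1 Cat (dom2 Cat \<kappa>) = dom1 Cat (dom2 Cat \<mu>)"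
  shows "op_cat_cell (hcomp_cat_cell \<kappa> \<mu>) = hcomp_cat_cell (op_cat_cell \<kappa>) (op_cat_cell \<mu>)"
proof -
  obtain D E F G \<eta> where \<kappa>: "\<kappa> = ((D, E, F), (D, E, G), \<eta>)"
    using assms(1) by (cases \<kappa>) auto
  then obtain E' F' G' \<theta> where \<mu>: "\<mu> = ((E, E', F'), (E, E', G'), \<theta>)"
    using assms(2,3) by (cases \<mu>) auto
  have "snd F' (\<eta> x) \<cdot>\<^bsub>E'\<^esub> \<theta> (fst G x) = \<theta> (fst F x) \<cdot>\<^bsub>E'\<^esub> snd G' (\<eta> x)" if "x \<in> Ob D" for x
  proof -
    have "\<eta> x \<in> hom E (fst F x) (fst G x)"
      using assms(1) that unfolding \<kappa> by (simp add: nat_trans_def)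
    then show ?thesis
      using assms(2) unfolding \<mu> by (auto simp: nat_trans_def hom_def)
  qed
  then show ?thesis unfolding \<kappa> \<mu> by (auto simp: restrict_def fun_eq_iff)
qed

context two_cat
begin

section \<open>The representable 2-functor on groupoids\<close>

lemma repr_mor_eq:
  "repr_mor C X f = (hom_cat C (cod1 C f) X, hom_cat C (dom1 C f) X,
     (restrict (\<lambda>g. f \<odot> g) (hom1 C (cod1 C f) X),
      restrict (\<lambda>\<alpha>. f \<rhd> \<alpha>) (Ar (hom_cat C (cod1 C f) X))))"
  unfolding repr_mor_def Let_def by simp

lemma ext_functor_repr_mor:
  assumes "f \<in> Mor C" "X \<in> Obj C"
  shows "ext_functor (hom_cat C (cod1 C f) X) (hom_cat C (dom1 C f) X) (snd (snd (repr_mor C X f)))"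
  using assms unfolding ext_functor_def is_functor_def repr_mor_eq by (auto simp: hom_def)

lemma repr_mor_Mor:
  assumes "f \<in> Mor C" "X \<in> Obj C"
  shows "repr_mor C X f \<in> Mor Cat"
  using ext_functor_repr_mor[OF assms] assms category_hom_cat unfolding repr_mor_eq by simp

lemma repr_mor_id:
  assumes "A \<in> Obj C"
  shows "repr_mor C X (id1 C A) = id1 Cat (hom_cat C A X)"
  using assms unfolding repr_mor_eq by (auto simp: restrict_def fun_eq_iff)

lemma repr_mor_comp:
  assumes "f \<in> Mor C" "g \<in> Mor C" "cod1 C f = dom1 C g"
  shows "repr_mor C X (f \<odot> g) = comp_cat_mor (repr_mor C X g) (repr_mor C X f)"
  using assms unfolding repr_mor_eq by (auto simp: restrict_def fun_eq_iff)

definition repr_cell :: "'o \<Rightarrow> 'c \<Rightarrow> ('m \<Rightarrow> 'c)" where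
  "repr_cell X \<sigma> = restrict (\<lambda>g. \<sigma> \<lhd> g) (hom1 C (cod1 C (dom2 C \<sigma>)) X)"

text \<open>Naturality is the interchange of \<open>\<sigma>\<close> with a 2-cell into
  \<open>X\<close>.\<close>

lemma nat_trans_repr_cell:
  assumes "\<sigma> \<in> Cell C"
  shows "nat_trans (hom_cat C (cod1 C (dom2 C \<sigma>)) X) (hom_cat C (dom1 C (dom2 C \<sigma>)) X)
    (snd (snd (repr_mor C X (dom2 C \<sigma>)))) (snd (snd (repr_mor C X (cod2 C \<sigma>)))) (repr_cell X \<sigma>)"
proof -
  have "dom2 C \<sigma> \<rhd> \<alpha> \<bullet> \<sigma> \<lhd> cod2 C \<alpha> = \<sigma> \<lhd> dom2 C \<alpha> \<bullet> cod2 C \<sigma> \<rhd> \<alpha>"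
    if "\<alpha> \<in> Cell C" "dom1 C (dom2 C \<alpha>) = cod1 C (dom2 C \<sigma>)" for \<alpha>
    using hcomp_whisker[of \<sigma> \<alpha>] assms that by simp
  then show ?thesis
    using assms unfolding nat_trans_def repr_mor_eq repr_cell_def by (auto simp: hom_def)
qed

definition repr2 :: "'o \<Rightarrow> 'c \<Rightarrow> ('m, 'c) cat_cell" where
  "repr2 X \<sigma> = (repr_mor C X (dom2 C \<sigma>), repr_mor C X (cod2 C \<sigma>), repr_cell X \<sigma>)"

lemma repr_eq: "repr C X = (\<lambda>A. hom_cat C A X, repr_mor C X, repr2 X)"
  unfolding repr_def repr_cell_def repr2_def ..

lemma repr2_Cell:
  assumes "\<sigma> \<in> Cell C" "X \<in> Obj C"
  shows "repr2 X \<sigma> \<in> Cell Cat"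
proof -
  have "repr_mor C X (dom2 C \<sigma>) \<in> Mor Cat" "repr_mor C X (cod2 C \<sigma>) \<in> Mor Cat"
    using repr_mor_Mor assms by simp_all
  then show ?thesis
    using nat_trans_repr_cell[OF assms(1), of X] assms(1) unfolding repr2_def Cat_simps(3)
    by (simp add: repr_mor_eq del: Cat_simps(2))
qed

lemma repr2_id:
  assumes "f \<in> Mor C"
  shows "repr2 X (id2 C f) = id2 Cat (repr_mor C X f)"
  using assms unfolding repr2_def repr_cell_def repr_mor_eq by (auto simp: restrict_def fun_eq_iff)

lemma repr2_vcomp:
  assumes "\<sigma> \<in> Cell C" "\<tau> \<in> Cell C" "cod2 C \<sigma> = dom2 C \<tau>"
  shows "repr2 X (\<sigma> \<bullet> \<tau>) = vcomp_cat_cell (repr2 X \<sigma>) (repr2 X \<tau>)"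
proof -
  have "cod1 C (dom2 C \<tau>) = cod1 C (dom2 C \<sigma>)" "dom1 C (dom2 C \<tau>) = dom1 C (dom2 C \<sigma>)"
    using assms by (metis Cell_Mor(3,4))+
  then show ?thesis
    using assms unfolding repr2_def repr_cell_def repr_mor_eq by (auto simp: restrict_def fun_eq_iff)
qed

text \<open>The formula in \<open>hcomp_cat_cell\<close> matches the first decomposition in
  \<open>hcomp_whisker\<close>. The factors change places because the representable is contravariant
  on morphisms.\<close>

lemma repr2_hcomp:
  assumes "\<sigma> \<in> Cell C" "\<tau> \<in> Cell C" "cod1 C (dom2 C \<sigma>) = dom1 C (dom2 C \<tau>)"
  shows "repr2 X (\<sigma> \<star> \<tau>) = hcomp_cat_cell (repr2 X \<tau>) (repr2 X \<sigma>)"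
proof -
  have comp: "(\<sigma> \<star> \<tau>) \<lhd> g = \<sigma> \<lhd> (dom2 C \<tau> \<odot> g) \<bullet> cod2 C \<sigma> \<rhd> (\<tau> \<lhd> g)"
    if "g \<in> hom1 C (cod1 C (dom2 C \<tau>)) X" for g
  proof -
    have "(\<sigma> \<star> \<tau>) \<lhd> g = \<sigma> \<star> (\<tau> \<lhd> g)"
      using assms that by (simp add: rwhisker_def hcomp_assoc)
    also have "\<dots> = \<sigma> \<lhd> dom2 C (\<tau> \<lhd> g) \<bullet> cod2 C \<sigma> \<rhd> (\<tau> \<lhd> g)"
      using assms that by (intro hcomp_whisker) simp_all
    finally show ?thesis using assms that by simp
  qed
  have "repr_cell X (\<sigma> \<star> \<tau>) = restrict (\<lambda>g. \<sigma> \<lhd> (dom2 C \<tau> \<odot> g) \<bullet> cod2 C \<sigma> \<rhd> (\<tau> \<lhd> g))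
      (hom1 C (cod1 C (dom2 C \<tau>)) X)"
    unfolding repr_cell_def using assms comp by (auto simp: restrict_def fun_eq_iff)
  moreover have "hcomp_cat_cell (repr2 X \<tau>) (repr2 X \<sigma>) =
     (comp_cat_mor (repr_mor C X (dom2 C \<tau>)) (repr_mor C X (dom2 C \<sigma>)),
      comp_cat_mor (repr_mor C X (cod2 C \<tau>)) (repr_mor C X (cod2 C \<sigma>)),
      restrict (\<lambda>g. \<sigma> \<lhd> (dom2 C \<tau> \<odot> g) \<bullet> cod2 C \<sigma> \<rhd> (\<tau> \<lhd> g)) (hom1 C (cod1 C (dom2 C \<tau>)) X))"
    using assms unfolding repr2_def repr_mor_eq repr_cell_def by (auto simp: restrict_def fun_eq_iff)
  ultimately show ?thesis
    using assms unfolding repr2_def by (simp add: repr_mor_comp)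
qed

lemma repr2_dom_cod: "dom2 Cat (repr2 X \<sigma>) = repr_mor C X (dom2 C \<sigma>)"
  "cod2 Cat (repr2 X \<sigma>) = repr_mor C X (cod2 C \<sigma>)"
  by (simp_all add: repr2_def)

lemma repr_mor_dom_cod: "dom1 Cat (repr_mor C X f) = hom_cat C (cod1 C f) X"
  "cod1 Cat (repr_mor C X f) = hom_cat C (dom1 C f) X"
  by (simp_all add: repr_mor_eq)

lemma two_functor_repr:
  assumes X: "X \<in> Obj C"
  shows "two_functor (op_tcat (gpd C)) Cat (repr C X)"
  unfolding repr_eq two_functor.simps is_functor_def und_cat_simps vert_cat_simps horiz_cat_simps
    fst_conv snd_conv op_tcat_simps gpd_simps
  using repr_mor_Mor[OF _ X] repr2_Cell[OF _ X] category_hom_cat[OF _ X]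
  by (auto simp: hom_def groupoid_obj_Obj repr_mor_id repr_mor_comp repr2_id repr2_vcomp repr2_hcomp
      repr2_dom_cod repr_mor_dom_cod simp del: Cat_simps(2-6,8-10) und_cat_simps(7))

text \<open>The sub-2-category on groupoids is full, so an inverse taken in \<open>C\<close> already
  lies in it; both versions of \<open>inv_cell\<close> therefore describe the same 2-cell.\<close>

lemma inverse_arrows_gpd:
  assumes "\<sigma> \<in> Cell (gpd C)"
  shows "inverse_arrows (vert_cat (gpd C)) \<sigma> \<beta> \<longleftrightarrow> inverse_arrows (vert_cat C) \<sigma> \<beta>"
  using assms unfolding inverse_arrows_vert unfolding inverse_arrows_def vert_cat_simps gpd_simps hom2_iff
  by auto

lemma inv_cell_gpd:
  assumes "\<sigma> \<in> Cell (gpd C)"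
  shows "inv_cell (gpd C) \<sigma> = inv_cell C \<sigma>" "inverse_arrows (vert_cat C) \<sigma> (inv_cell C \<sigma>)"
    "inv_cell C \<sigma> \<in> Cell C" "dom2 C (inv_cell C \<sigma>) = cod2 C \<sigma>" "cod2 C (inv_cell C \<sigma>) = dom2 C \<sigma>"
proof -
  show "inv_cell (gpd C) \<sigma> = inv_cell C \<sigma>"
    unfolding inv_cell_def by (rule arg_cong[where f = The]) (rule ext, rule inverse_arrows_gpd[OF assms])
  show "inverse_arrows (vert_cat C) \<sigma> (inv_cell C \<sigma>)"
    using assms groupoid_obj_inv by auto
  then show "inv_cell C \<sigma> \<in> Cell C" "dom2 C (inv_cell C \<sigma>) = cod2 C \<sigma>" "cod2 C (inv_cell C \<sigma>) = dom2 C \<sigma>"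
    by auto
qed

lemma inv_cell_id2: "f \<in> Mor C \<Longrightarrow> inv_cell C (id2 C f) = id2 C f"
  by (rule inv_cellI) simp

text \<open>Inversion reverses the vertical order, which compensates for the reversal by opposite
  categories in \<open>op_repr2_vcomp\<close>.\<close>

lemma inv_cell_vcomp:
  assumes "\<sigma> \<in> Cell (gpd C)" "\<tau> \<in> Cell (gpd C)" "cod2 C \<sigma> = dom2 C \<tau>"
  shows "inv_cell C (\<sigma> \<bullet> \<tau>) = inv_cell C \<tau> \<bullet> inv_cell C \<sigma>"
proof (rule inv_cellI)
  note i = inv_cell_gpd(2-5)[OF assms(1)] inv_cell_gpd(2-5)[OF assms(2)]
  have st: "\<sigma> \<in> Cell C" "\<tau> \<in> Cell C" using assms by auto
  have "(\<sigma> \<bullet> \<tau>) \<bullet> (inv_cell C \<tau> \<bullet> inv_cell C \<sigma>) = \<sigma> \<bullet> ((\<tau> \<bullet> inv_cell C \<tau>) \<bullet> inv_cell C \<sigma>)"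
    using i st assms(3) by (simp del: inverse_arrows_vert)
  also have "\<dots> = id2 C (dom2 C \<sigma>)" using i st assms(3) by simp
  finally have 1: "(\<sigma> \<bullet> \<tau>) \<bullet> (inv_cell C \<tau> \<bullet> inv_cell C \<sigma>) = id2 C (dom2 C \<sigma>)" .
  have "(inv_cell C \<tau> \<bullet> inv_cell C \<sigma>) \<bullet> (\<sigma> \<bullet> \<tau>) = inv_cell C \<tau> \<bullet> ((inv_cell C \<sigma> \<bullet> \<sigma>) \<bullet> \<tau>)"
    using i st assms(3) by (simp del: inverse_arrows_vert)
  also have "\<dots> = id2 C (cod2 C \<tau>)" using i st assms(3) by simp
  finally show "inverse_arrows (vert_cat C) (\<sigma> \<bullet> \<tau>) (inv_cell C \<tau> \<bullet> inv_cell C \<sigma>)"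
    using 1 i st assms(3) unfolding inverse_arrows_vert by (simp del: vcomp_assoc)
qed

text \<open>Interchange splits the check into the two factors, so the horizontal order is
  kept.\<close>

lemma inv_cell_hcomp:
  assumes "\<sigma> \<in> Cell (gpd C)" "\<tau> \<in> Cell (gpd C)" "cod1 C (dom2 C \<sigma>) = dom1 C (dom2 C \<tau>)"
  shows "inv_cell C (\<sigma> \<star> \<tau>) = inv_cell C \<sigma> \<star> inv_cell C \<tau>"
proof (rule inv_cellI)
  note i = inv_cell_gpd(2-5)[OF assms(1)] inv_cell_gpd(2-5)[OF assms(2)]
  have st: "\<sigma> \<in> Cell C" "\<tau> \<in> Cell C" using assms by auto
  have "\<sigma> \<star> \<tau> \<bullet> inv_cell C \<sigma> \<star> inv_cell C \<tau> = id2 C (dom2 C (\<sigma> \<star> \<tau>))"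
    "inv_cell C \<sigma> \<star> inv_cell C \<tau> \<bullet> \<sigma> \<star> \<tau> = id2 C (cod2 C (\<sigma> \<star> \<tau>))"
    using i st assms(3) by (simp_all add: hcomp_id2 flip: interchange)
  then show "inverse_arrows (vert_cat C) (\<sigma> \<star> \<tau>) (inv_cell C \<sigma> \<star> inv_cell C \<tau>)"
    using i st assms(3) by simp
qed

text \<open>The 2-cell part of \<open>op_repr\<close>. Direction is reversed twice, by inversion and
  by \<open>op_cat_cell\<close>, so the result is covariant on 2-cells.\<close>

definition op_repr2 :: "'o \<Rightarrow> 'c \<Rightarrow> ('m, 'c) cat_cell" where
  "op_repr2 X \<sigma> = op_cat_cell (repr2 X (inv_cell (gpd C) \<sigma>))"

lemma op_repr_eq: "op_repr C X =
    (\<lambda>A. op_cat (hom_cat C A X), \<lambda>f. op_cat_mor (repr_mor C X f), op_repr2 X)"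
  unfolding op_repr_def inv_tfunctor_def repr_eq op_tfunctor_def comp_tfunctor.simps op_repr2_def
  by (simp add: fun_eq_iff repr2_def)

lemma op_repr2_Cell:
  assumes "\<sigma> \<in> Cell (gpd C)" "X \<in> Obj C"
  shows "op_repr2 X \<sigma> \<in> Cell Cat"
  unfolding op_repr2_def using inv_cell_gpd[OF assms(1)] assms(2)
  by (intro op_cat_cell_Cell repr2_Cell) auto

lemma op_repr2_dom_cod:
  assumes "\<sigma> \<in> Cell (gpd C)"
  shows "dom2 Cat (op_repr2 X \<sigma>) = op_cat_mor (repr_mor C X (dom2 C \<sigma>))"
    "cod2 Cat (op_repr2 X \<sigma>) = op_cat_mor (repr_mor C X (cod2 C \<sigma>))"
  using inv_cell_gpd[OF assms] by (simp_all add: op_repr2_def repr2_def)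

lemma op_repr2_id:
  assumes "f \<in> Mor (gpd C)"
  shows "op_repr2 X (id2 C f) = id2 Cat (op_cat_mor (repr_mor C X f))"
proof -
  have f: "f \<in> Mor C" "id2 C f \<in> Cell (gpd C)" using assms by auto
  then show ?thesis
    unfolding op_repr2_def inv_cell_gpd(1)[OF f(2)] inv_cell_id2[OF f(1)] repr2_id[OF f(1)]
    by (rule_tac op_cat_cell_id)
qed

lemma op_repr2_vcomp:
  assumes \<sigma>: "\<sigma> \<in> Cell (gpd C)" and \<tau>: "\<tau> \<in> Cell (gpd C)" and "cod2 C \<sigma> = dom2 C \<tau>" and X: "X \<in> Obj C"
  shows "op_repr2 X (\<sigma> \<bullet> \<tau>) = vcomp_cat_cell (op_repr2 X \<sigma>) (op_repr2 X \<tau>)"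
proof -
  note i = inv_cell_gpd[OF \<sigma>] inv_cell_gpd[OF \<tau>]
  have "cod1 C (dom2 C \<tau>) = cod1 C (dom2 C \<sigma>)"
    using assms by (metis Cell_Mor(4) gpd_simps(3))
  then have st: "\<sigma> \<bullet> \<tau> \<in> Cell (gpd C)" using assms by simp
  have "op_repr2 X (\<sigma> \<bullet> \<tau>) = op_cat_cell (vcomp_cat_cell (repr2 X (inv_cell C \<tau>)) (repr2 X (inv_cell C \<sigma>)))"
    unfolding op_repr2_def inv_cell_gpd(1)[OF st] inv_cell_vcomp[OF assms(1-3)]
    by (subst repr2_vcomp) (use i assms(3) in auto)
  also have "\<dots> = vcomp_cat_cell (op_repr2 X \<sigma>) (op_repr2 X \<tau>)"
    unfolding op_repr2_def i(1) i(6)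
    by (rule op_cat_cell_vcomp[OF repr2_Cell[OF i(8) X] repr2_Cell[OF i(3) X]])
      (use i assms(3) in \<open>simp only: repr2_dom_cod\<close>)
  finally show ?thesis .
qed

lemma op_repr2_hcomp:
  assumes \<sigma>: "\<sigma> \<in> Cell (gpd C)" and \<tau>: "\<tau> \<in> Cell (gpd C)"
    and st: "cod1 C (dom2 C \<sigma>) = dom1 C (dom2 C \<tau>)" and X: "X \<in> Obj C"
  shows "op_repr2 X (\<sigma> \<star> \<tau>) = hcomp_cat_cell (op_repr2 X \<tau>) (op_repr2 X \<sigma>)"
proof -
  note i = inv_cell_gpd[OF \<sigma>] inv_cell_gpd[OF \<tau>]
  have st': "cod1 C (dom2 C (inv_cell C \<sigma>)) = dom1 C (dom2 C (inv_cell C \<tau>))"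
    using st i \<sigma> \<tau> by simp
  have h: "\<sigma> \<star> \<tau> \<in> Cell (gpd C)" using assms by simp
  have "op_repr2 X (\<sigma> \<star> \<tau>) = op_cat_cell (hcomp_cat_cell (repr2 X (inv_cell C \<tau>)) (repr2 X (inv_cell C \<sigma>)))"
    unfolding op_repr2_def inv_cell_gpd(1)[OF h] inv_cell_hcomp[OF assms(1-3)]
    by (subst repr2_hcomp) (use i st' in auto)
  also have "\<dots> = hcomp_cat_cell (op_repr2 X \<tau>) (op_repr2 X \<sigma>)"
    unfolding op_repr2_def i(1) i(6)
    by (rule op_cat_cell_hcomp[OF repr2_Cell[OF i(8) X] repr2_Cell[OF i(3) X]])
      (use st' in \<open>simp only: repr2_dom_cod repr_mor_dom_cod\<close>)
  finally show ?thesis .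
qed

lemma two_functor_op_repr:
  assumes X: "X \<in> Obj C"
  shows "two_functor (op_tcat (gpd C)) Cat (op_repr C X)"
proof -
  have dc: "dom1 Cat (op_cat_mor (repr_mor C X f)) = op_cat (hom_cat C (cod1 C f) X)"
    "cod1 Cat (op_cat_mor (repr_mor C X f)) = op_cat (hom_cat C (dom1 C f) X)" for f
    by (simp_all add: repr_mor_eq)
  have id: "op_cat_mor (repr_mor C X (id1 C A)) = id1 Cat (op_cat (hom_cat C A X))" if "A \<in> Obj C" for A
    by (simp only: repr_mor_id[OF that] op_cat_mor_id)
  have id2: "op_repr2 X (id2 C (id1 C A)) = id2 Cat (id1 Cat (op_cat (hom_cat C A X)))"
    if "groupoid_obj C A" for A
    using op_repr2_id[of "id1 C A" X] id groupoid_obj_Obj[OF that] that by (simp del: Cat_simps)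
  have comp: "op_cat_mor (repr_mor C X (f \<odot> g)) =
      comp1 Cat (op_cat_mor (repr_mor C X g)) (op_cat_mor (repr_mor C X f))"
    if "f \<in> Mor C" "g \<in> Mor C" "cod1 C f = dom1 C g" for f g
    by (simp only: repr_mor_comp[OF that] op_cat_mor_comp Cat_simps)
  show ?thesis
    unfolding op_repr_eq two_functor.simps is_functor_def und_cat_simps vert_cat_simps horiz_cat_simps
      fst_conv snd_conv op_tcat_simps(1-6) op_tcat_simps(8-10)
  proof (intro conjI ballI impI)
    fix \<sigma> \<tau> assume st: "\<sigma> \<in> Cell (gpd C)" "\<tau> \<in> Cell (gpd C)"
    show "op_repr2 X (vcomp (op_tcat (gpd C)) \<sigma> \<tau>) = vcomp Cat (op_repr2 X \<sigma>) (op_repr2 X \<tau>)"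
      if "cod2 (gpd C) \<sigma> = dom2 (gpd C) \<tau>"
      using op_repr2_vcomp[OF st _ X] that by simp
    show "op_repr2 X (hcomp (op_tcat (gpd C)) \<sigma> \<tau>) = hcomp Cat (op_repr2 X \<sigma>) (op_repr2 X \<tau>)"
      if "dom1 (gpd C) (dom2 (gpd C) \<sigma>) = cod1 (gpd C) (dom2 (gpd C) \<tau>)"
      using op_repr2_hcomp[OF st(2,1) _ X] that by simp
  qed (use op_cat_mor_Mor[OF repr_mor_Mor[OF _ X]] op_repr2_Cell[OF _ X] category_op[OF category_hom_cat[OF _ X]]
      in \<open>auto simp: hom_def groupoid_obj_Obj id id2 comp op_repr2_id op_repr2_dom_cod dc
        simp del: Cat_simps(2-6,8-10) und_cat_simps(7) op_cat_mor.simps\<close>)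
qed

end

section \<open>The natural isomorphism and its uniqueness\<close>

lemma cat_iso_inverse:
  assumes iso: "cat_iso D E F" and D: "category D"
  shows "cat_iso E D (inv_into (Ob D) (fst F), inv_into (Ar D) (snd F))"
proof -
  have F: "is_functor D E F" and b0: "bij_betw (fst F) (Ob D) (Ob E)" and b1: "bij_betw (snd F) (Ar D) (Ar E)"
    using iso unfolding cat_iso_def by blast+
  let ?G0 = "inv_into (Ob D) (fst F)" and ?G1 = "inv_into (Ar D) (snd F)"
  have G0: "?G0 (fst F x) = x" if "x \<in> Ob D" for x
    using b0 that by (simp add: bij_betw_def)
  have G1: "?G1 (snd F a) = a" if "a \<in> Ar D" for a
    using b1 that by (simp add: bij_betw_def)
  have Ob_E: "Ob E = fst F ` Ob D" and Ar_E: "Ar E = snd F ` Ar D"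
    using b0 b1 by (auto simp: bij_betw_def)
  have D': "src D a \<in> Ob D" "tgt D a \<in> Ob D" if "a \<in> Ar D" for a
    using D that unfolding category_def by auto
  have D_id: "ident D x \<in> Ar D" if "x \<in> Ob D" for x
    using D that unfolding category_def hom_def by auto
  have D_comp: "a \<cdot>\<^bsub>D\<^esub> b \<in> Ar D" if "a \<in> Ar D" "b \<in> Ar D" "tgt D a = src D b" for a b
    using D that unfolding category_def hom_def by auto
  have F': "src E (snd F a) = fst F (src D a)" "tgt E (snd F a) = fst F (tgt D a)" if "a \<in> Ar D" for a
    using F that unfolding is_functor_def hom_def by auto
  have F_id: "ident E (fst F x) = snd F (ident D x)" if "x \<in> Ob D" for x
    using F that unfolding is_functor_def by auto
  have F_comp: "snd F a \<cdot>\<^bsub>E\<^esub> snd F b = snd F (a \<cdot>\<^bsub>D\<^esub> b)" if "a \<in> Ar D" "b \<in> Ar D" "tgt D a = src D b" for a b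
    using F that unfolding is_functor_def by auto
  \<comment> \<open>Composability in \<open>E\<close> descends to \<open>D\<close> because
    \<open>fst F\<close> is injective on objects.\<close>
  have comp: "?G1 (snd F a \<cdot>\<^bsub>E\<^esub> snd F b) = a \<cdot>\<^bsub>D\<^esub> b"
    if "a \<in> Ar D" "b \<in> Ar D" "fst F (tgt D a) = fst F (src D b)" for a b
    using that G0 D' F_comp G1 D_comp by metis
  have "is_functor E D (?G0, ?G1)"
    unfolding is_functor_def Ob_E Ar_E
    by (auto simp: G0 G1 hom_def D' F' F_id D_id comp)
  then show ?thesis
    unfolding cat_iso_def using bij_betw_inv_into[OF b0] bij_betw_inv_into[OF b1] by simp
qed

text \<open>Morphisms of \<open>Cat\<close> are extensional, so the pointwise inverse is restricted
  to the carriers of \<open>E\<close>; the composites, restricted by \<open>comp_cat_mor\<close>,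
  are then the identities of \<open>Cat\<close> as HOL functions.\<close>

lemma Cat_invertibleI:
  assumes iso: "cat_iso D E F" and D: "category D" and E: "category E"
    and ext: "fst F \<in> extensional (Ob D)" "snd F \<in> extensional (Ar D)"
  shows "(D, E, F) \<in> Mor Cat" "invertible (und_cat Cat) (D, E, F)"
proof -
  let ?G = "(restrict (inv_into (Ob D) (fst F)) (Ob E), restrict (inv_into (Ar D) (snd F)) (Ar E))"
  have F: "is_functor D E F" and b0: "bij_betw (fst F) (Ob D) (Ob E)" and b1: "bij_betw (snd F) (Ar D) (Ar E)"
    using iso unfolding cat_iso_def by blast+
  show M: "(D, E, F) \<in> Mor Cat"
    using F D E ext by (simp add: ext_functor_def)
  have inv: "is_functor E D (inv_into (Ob D) (fst F), inv_into (Ar D) (snd F))"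
    using cat_iso_inverse[OF iso D] unfolding cat_iso_def by blast
  have "is_functor E D ?G"
    by (rule is_functor_cong[OF inv E]) simp_all
  then have N: "(E, D, ?G) \<in> Mor Cat" using D E by (simp add: ext_functor_def)
  have e: "fst F x \<in> Ob E" "inv_into (Ob D) (fst F) (fst F x) = x" if "x \<in> Ob D" for x
    using b0 that by (auto simp: bij_betw_def)
  have e1: "snd F a \<in> Ar E" "inv_into (Ar D) (snd F) (snd F a) = a" if "a \<in> Ar D" for a
    using b1 that by (auto simp: bij_betw_def)
  have e': "inv_into (Ob D) (fst F) x \<in> Ob D" "fst F (inv_into (Ob D) (fst F) x) = x" if "x \<in> Ob E" for x
    using b0 that by (auto simp: bij_betw_def f_inv_into_f inv_into_into)
  have e1': "inv_into (Ar D) (snd F) a \<in> Ar D" "snd F (inv_into (Ar D) (snd F) a) = a" if "a \<in> Ar E" for a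
    using b1 that by (auto simp: bij_betw_def f_inv_into_f inv_into_into)
  have "comp_cat_mor (D, E, F) (E, D, ?G) = id1 Cat D" "comp_cat_mor (E, D, ?G) (D, E, F) = id1 Cat E"
    using e e1 e' e1' by (auto simp: restrict_def fun_eq_iff)
  then have "inverse_arrows (und_cat Cat) (D, E, F) (E, D, ?G)"
    unfolding inverse_arrows_def und_cat_simps hom1_iff using M N by (simp del: comp_cat_mor.simps Cat_simps(2))
  then show "invertible (und_cat Cat) (D, E, F)" unfolding invertible_def by blast
qed

text \<open>Turns the abstract components of a given natural isomorphism into concrete bijections,
  the form used by the uniqueness argument.\<close>

lemma Cat_invertibleD:
  assumes "invertible (und_cat Cat) (D, E, F)"
  shows "cat_iso D E F"
proof -
  obtain G where M: "(D, E, F) \<in> Mor Cat" and N: "(E, D, G) \<in> Mor Cat"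
    and DG: "comp_cat_mor (D, E, F) (E, D, G) = id1 Cat D" and GD: "comp_cat_mor (E, D, G) (D, E, F) = id1 Cat E"
    using assms unfolding invertible_def inverse_arrows_def und_cat_simps hom1_iff by auto
  have fu: "is_functor D E F" "is_functor E D G" using M N by (auto simp: ext_functor_def)
  then have im: "fst F ` Ob D \<subseteq> Ob E" "fst G ` Ob E \<subseteq> Ob D" "snd F ` Ar D \<subseteq> Ar E" "snd G ` Ar E \<subseteq> Ar D"
    unfolding is_functor_def hom_def by auto
  have r: "restrict f S = restrict g S \<Longrightarrow> x \<in> S \<Longrightarrow> f x = g x" for f g :: "'z \<Rightarrow> 'w" and S x
    by (metis restrict_apply')
  have "\<forall>x\<in>Ob D. fst G (fst F x) = x" "\<forall>a\<in>Ar D. snd G (snd F a) = a"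
    "\<forall>x\<in>Ob E. fst F (fst G x) = x" "\<forall>a\<in>Ar E. snd F (snd G a) = a"
    using DG GD by (auto dest: r)
  then show ?thesis
    unfolding cat_iso_def using fu im
    by (auto intro: bij_betw_byWitness[of _ "fst G"] bij_betw_byWitness[of _ "snd G"])
qed

section \<open>Yoneda for representables restricted to groupoids\<close>

context two_cat
begin

text \<open>An isomorphism, natural in 1-cells, between the representables of \<open>Z\<close> and
  \<open>Z'\<close> on groupoids, expressed by equations in \<open>C\<close> instead of in
  \<open>Cat\<close>. The naturality equations will be evaluated at the structure maps of a
  congruence.\<close>

definition natural_iso_on_gpd ::
  "'o \<Rightarrow> 'o \<Rightarrow> ('o \<Rightarrow> 'm \<Rightarrow> 'm) \<Rightarrow> ('o \<Rightarrow> 'c \<Rightarrow> 'c) \<Rightarrow> bool" where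
  "natural_iso_on_gpd Z Z' \<phi>0 \<phi>1 \<longleftrightarrow>
     (\<forall>A. groupoid_obj C A \<longrightarrow> cat_iso (hom_cat C A Z) (hom_cat C A Z') (\<phi>0 A, \<phi>1 A)) \<and>
     (\<forall>A B k. groupoid_obj C A \<longrightarrow> groupoid_obj C B \<longrightarrow> k \<in> hom1 C B A \<longrightarrow>
        (\<forall>f\<in>hom1 C A Z. \<phi>0 B (k \<odot> f) = k \<odot> \<phi>0 A f) \<and>
        (\<forall>\<alpha>\<in>Ar (hom_cat C A Z). \<phi>1 B (k \<rhd> \<alpha>) = k \<rhd> \<phi>1 A \<alpha>))"

lemma natural_iso_on_gpdD:
  assumes "natural_iso_on_gpd Z Z' \<phi>0 \<phi>1" "groupoid_obj C A"
  shows "cat_iso (hom_cat C A Z) (hom_cat C A Z') (\<phi>0 A, \<phi>1 A)"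
    "groupoid_obj C B \<Longrightarrow> k \<in> hom1 C B A \<Longrightarrow> f \<in> hom1 C A Z \<Longrightarrow> \<phi>0 B (k \<odot> f) = k \<odot> \<phi>0 A f"
    "groupoid_obj C B \<Longrightarrow> k \<in> hom1 C B A \<Longrightarrow> \<alpha> \<in> Ar (hom_cat C A Z) \<Longrightarrow> \<phi>1 B (k \<rhd> \<alpha>) = k \<rhd> \<phi>1 A \<alpha>"
  using assms unfolding natural_iso_on_gpd_def by blast+

lemma natural_iso_on_gpd_functor:
  assumes n: "natural_iso_on_gpd Z Z' \<phi>0 \<phi>1" and A: "groupoid_obj C A"
  shows "f \<in> hom1 C A Z \<Longrightarrow> \<phi>0 A f \<in> hom1 C A Z'"
    "f \<in> hom1 C A Z \<Longrightarrow> \<phi>1 A (id2 C f) = id2 C (\<phi>0 A f)"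
    "\<alpha> \<in> Ar (hom_cat C A Z) \<Longrightarrow> \<phi>1 A \<alpha> \<in> hom2 C (\<phi>0 A (dom2 C \<alpha>)) (\<phi>0 A (cod2 C \<alpha>))"
    "\<alpha> \<in> Ar (hom_cat C A Z) \<Longrightarrow> \<beta> \<in> Ar (hom_cat C A Z) \<Longrightarrow> cod2 C \<alpha> = dom2 C \<beta> \<Longrightarrow>
       \<phi>1 A (\<alpha> \<bullet> \<beta>) = \<phi>1 A \<alpha> \<bullet> \<phi>1 A \<beta>"
proof -
  have fu: "is_functor (hom_cat C A Z) (hom_cat C A Z') (\<phi>0 A, \<phi>1 A)"
    using natural_iso_on_gpdD(1)[OF assms] unfolding cat_iso_def by blast
  show "f \<in> hom1 C A Z \<Longrightarrow> \<phi>0 A f \<in> hom1 C A Z'"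
    "f \<in> hom1 C A Z \<Longrightarrow> \<phi>1 A (id2 C f) = id2 C (\<phi>0 A f)"
    using fu unfolding is_functor_def hom_cat_simps(1,5) by simp_all
  show "\<alpha> \<in> Ar (hom_cat C A Z) \<Longrightarrow> \<phi>1 A \<alpha> \<in> hom2 C (\<phi>0 A (dom2 C \<alpha>)) (\<phi>0 A (cod2 C \<alpha>))"
    using fu unfolding is_functor_def hom_def by simp
  show "\<alpha> \<in> Ar (hom_cat C A Z) \<Longrightarrow> \<beta> \<in> Ar (hom_cat C A Z) \<Longrightarrow> cod2 C \<alpha> = dom2 C \<beta> \<Longrightarrow>
       \<phi>1 A (\<alpha> \<bullet> \<beta>) = \<phi>1 A \<alpha> \<bullet> \<phi>1 A \<beta>"
    using fu unfolding is_functor_def by simp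
qed

text \<open>Each element of the target is an image, so the naturality equations can be read
  backwards. The Yoneda argument is run in both directions.\<close>

lemma natural_iso_on_gpd_inverse:
  assumes n: "natural_iso_on_gpd Z Z' \<phi>0 \<phi>1" and Z: "Z \<in> Obj C"
  shows "natural_iso_on_gpd Z' Z (\<lambda>A. inv_into (hom1 C A Z) (\<phi>0 A)) (\<lambda>A. inv_into (Ar (hom_cat C A Z)) (\<phi>1 A))"
    (is "natural_iso_on_gpd Z' Z ?\<psi>0 ?\<psi>1")
proof -
  have bij: "bij_betw (\<phi>0 A) (hom1 C A Z) (hom1 C A Z')"
    "bij_betw (\<phi>1 A) (Ar (hom_cat C A Z)) (Ar (hom_cat C A Z'))" if "groupoid_obj C A" for A
    using natural_iso_on_gpdD(1)[OF n that] unfolding cat_iso_def by auto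
  have "cat_iso (hom_cat C A Z') (hom_cat C A Z) (?\<psi>0 A, ?\<psi>1 A)" if A: "groupoid_obj C A" for A
    using cat_iso_inverse[OF natural_iso_on_gpdD(1)[OF n A] category_hom_cat[OF groupoid_obj_Obj[OF A] Z]] by simp
  moreover have "?\<psi>0 B (k \<odot> f) = k \<odot> ?\<psi>0 A f"
    if A: "groupoid_obj C A" and B: "groupoid_obj C B" and k: "k \<in> hom1 C B A" and f: "f \<in> hom1 C A Z'" for A B k f
  proof -
    obtain g where g: "g \<in> hom1 C A Z" "f = \<phi>0 A g"
      using bij_betw_imp_surj_on[OF bij(1)[OF A]] f by blast
    have "k \<odot> g \<in> hom1 C B Z" using k g by simp
    then have "?\<psi>0 B (\<phi>0 B (k \<odot> g)) = k \<odot> g"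
      using bij_betw_inv_into_left[OF bij(1)[OF B]] by blast
    moreover have "?\<psi>0 A f = g" using bij_betw_inv_into_left[OF bij(1)[OF A] g(1)] g(2) by simp
    ultimately show ?thesis using natural_iso_on_gpdD(2)[OF n A B k g(1)] g(2) by simp
  qed
  moreover have "?\<psi>1 B (k \<rhd> f) = k \<rhd> ?\<psi>1 A f"
    if A: "groupoid_obj C A" and B: "groupoid_obj C B" and k: "k \<in> hom1 C B A" and f: "f \<in> Ar (hom_cat C A Z')" for A B k f
  proof -
    obtain g where g: "g \<in> Ar (hom_cat C A Z)" "f = \<phi>1 A g"
      using bij_betw_imp_surj_on[OF bij(2)[OF A]] f by blast
    have "k \<rhd> g \<in> Ar (hom_cat C B Z)" using k g by simp
    then have "?\<psi>1 B (\<phi>1 B (k \<rhd> g)) = k \<rhd> g"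
      using bij_betw_inv_into_left[OF bij(2)[OF B]] by blast
    moreover have "?\<psi>1 A f = g" using bij_betw_inv_into_left[OF bij(2)[OF A] g(1)] g(2) by simp
    ultimately show ?thesis using natural_iso_on_gpdD(3)[OF n A B k g(1)] g(2) by simp
  qed
  ultimately show ?thesis unfolding natural_iso_on_gpd_def by blast
qed

text \<open>A Yoneda argument: the image of the universal cocone is again a cocone, hence factors through
  the quotient.\<close>

lemma natural_iso_on_gpd_induced:
  assumes n: "natural_iso_on_gpd Z Z' \<phi>0 \<phi>1" and K: "internal_typed K"
    and q: "strict_quotient C K Z \<gamma> \<gamma>01" and cl: "classifies K Z \<gamma> \<gamma>01"
  obtains h where "h \<in> hom1 C Z Z'"
    "\<And>A f. groupoid_obj C A \<Longrightarrow> f \<in> hom1 C A Z \<Longrightarrow> f \<odot> h = \<phi>0 A f"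
    "\<And>A \<alpha>. groupoid_obj C A \<Longrightarrow> \<alpha> \<in> Ar (hom_cat C A Z) \<Longrightarrow> \<alpha> \<lhd> h = \<phi>1 A \<alpha>"
proof -
  have g: "groupoid_obj C (obj0 K)" "groupoid_obj C (obj1 K)" "groupoid_obj C (obj2 K)"
    and Kt: "pi0 K \<in> hom1 C (obj1 K) (obj0 K)" "pi1 K \<in> hom1 C (obj1 K) (obj0 K)"
    "idm K \<in> hom1 C (obj0 K) (obj1 K)" "pi01 K \<in> hom1 C (obj2 K) (obj1 K)"
    "pi12 K \<in> hom1 C (obj2 K) (obj1 K)" "pi02 K \<in> hom1 C (obj2 K) (obj1 K)"
    using K unfolding internal_typed_def by blast+
  have \<gamma>: "\<gamma> \<in> hom1 C (obj0 K) Z" and \<gamma>01: "\<gamma>01 \<in> Ar (hom_cat C (obj1 K) Z)"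
    and d\<gamma>: "dom2 C \<gamma>01 = pi0 K \<odot> \<gamma>" "cod2 C \<gamma>01 = pi1 K \<odot> \<gamma>"
    and co: "idm K \<rhd> \<gamma>01 = id2 C \<gamma>" "pi02 K \<rhd> \<gamma>01 = pi01 K \<rhd> \<gamma>01 \<bullet> pi12 K \<rhd> \<gamma>01"
    using strict_quotient_typed[OF q] classifies_typed[OF cl] unfolding is_cocone_def by auto
  let ?\<delta> = "\<phi>0 (obj0 K) \<gamma>" and ?\<delta>01 = "\<phi>1 (obj1 K) \<gamma>01"
  have \<delta>: "?\<delta> \<in> hom1 C (obj0 K) Z'" by (rule natural_iso_on_gpd_functor(1)[OF n g(1) \<gamma>])
  have \<delta>01: "?\<delta>01 \<in> hom2 C (pi0 K \<odot> ?\<delta>) (pi1 K \<odot> ?\<delta>)"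
    using natural_iso_on_gpd_functor(3)[OF n g(2) \<gamma>01]
      natural_iso_on_gpdD(2)[OF n g(1,2) Kt(1) \<gamma>] natural_iso_on_gpdD(2)[OF n g(1,2) Kt(2) \<gamma>] d\<gamma> by simp
  have "idm K \<rhd> ?\<delta>01 = id2 C ?\<delta>"
    using natural_iso_on_gpdD(3)[OF n g(2,1) Kt(3) \<gamma>01] natural_iso_on_gpd_functor(2)[OF n g(1) \<gamma>] co(1) by simp
  moreover have "pi02 K \<rhd> ?\<delta>01 = pi01 K \<rhd> ?\<delta>01 \<bullet> pi12 K \<rhd> ?\<delta>01"
  proof -
    \<comment> \<open>Functoriality of \<open>\<phi>1\<close> concerns composable 2-cells; the
      matching equation of \<open>K\<close> provides composability.\<close>
    have "pi01 K \<odot> pi1 K = pi12 K \<odot> pi0 K" using K unfolding internal_typed_def by blast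
    then have comp: "cod2 C (pi01 K \<rhd> \<gamma>01) = dom2 C (pi12 K \<rhd> \<gamma>01)"
      using Kt \<gamma> \<gamma>01 d\<gamma> comp1_assoc[of "pi01 K" "pi1 K" \<gamma>] comp1_assoc[of "pi12 K" "pi0 K" \<gamma>] by simp
    have "\<phi>1 (obj2 K) (pi01 K \<rhd> \<gamma>01 \<bullet> pi12 K \<rhd> \<gamma>01) =
        \<phi>1 (obj2 K) (pi01 K \<rhd> \<gamma>01) \<bullet> \<phi>1 (obj2 K) (pi12 K \<rhd> \<gamma>01)"
      by (rule natural_iso_on_gpd_functor(4)[OF n g(3) _ _ comp]) (use Kt \<gamma>01 in auto)
    then show ?thesis
      using natural_iso_on_gpdD(3)[OF n g(2,3) Kt(4) \<gamma>01] natural_iso_on_gpdD(3)[OF n g(2,3) Kt(5) \<gamma>01]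
        natural_iso_on_gpdD(3)[OF n g(2,3) Kt(6) \<gamma>01] co(2) by simp
  qed
  ultimately have "is_cocone C K Z' (?\<delta>, ?\<delta>01)"
    unfolding is_cocone_def using \<delta> \<delta>01 by simp
  then obtain h where h: "h \<in> hom1 C Z Z'" "\<gamma> \<odot> h = ?\<delta>" "\<gamma>01 \<lhd> h = ?\<delta>01"
    using strict_quotient_obtain[OF q] by blast
  \<comment> \<open>By construction \<open>h\<close> is known on the universal
    \<open>\<gamma>\<close>; naturality along the factorization \<open>u\<close> spreads this to
    every \<open>f\<close> from a groupoid.\<close>
  have "f \<odot> h = \<phi>0 A f" if A: "groupoid_obj C A" and f: "f \<in> hom1 C A Z" for A f
  proof -
    obtain u where u: "u \<in> hom1 C A (obj0 K)" "u \<odot> \<gamma> = f" using classifies_mor[OF cl A f] by blast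
    have "f \<odot> h = u \<odot> ?\<delta>" using u h \<gamma> by auto
    then show ?thesis using natural_iso_on_gpdD(2)[OF n g(1) A u(1) \<gamma>] u(2) by simp
  qed
  moreover have "\<alpha> \<lhd> h = \<phi>1 A \<alpha>" if A: "groupoid_obj C A" and \<alpha>: "\<alpha> \<in> Ar (hom_cat C A Z)" for A \<alpha>
  proof -
    obtain a where a: "a \<in> hom1 C A (obj1 K)" "a \<rhd> \<gamma>01 = \<alpha>" using classifies_cell[OF cl A \<alpha>] by blast
    have "\<alpha> \<lhd> h = a \<rhd> ?\<delta>01" using a h \<gamma>01 by auto
    then show ?thesis using natural_iso_on_gpdD(3)[OF n g(2) A a(1) \<gamma>01] a(2) by simp
  qed
  ultimately show ?thesis using that[OF h(1)] by blast
qed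

text \<open>On everything coming from a groupoid the two induced morphisms act as the given
  isomorphism and its inverse. The quotient cocones have groupoid sources and detect equality of
  morphisms, so both composites are identities.\<close>

lemma natural_iso_on_gpd_isomorphic:
  assumes n: "natural_iso_on_gpd Z Z' \<phi>0 \<phi>1"
    and K: "internal_typed K" "strict_quotient C K Z \<gamma> \<gamma>01" "classifies K Z \<gamma> \<gamma>01"
    and K': "internal_typed K'" "strict_quotient C K' Z' \<gamma>' \<gamma>01'" "classifies K' Z' \<gamma>' \<gamma>01'"
  shows "isomorphic C Z' Z"
proof -
  note Z = strict_quotient_typed(2)[OF K(2)] and Z' = strict_quotient_typed(2)[OF K'(2)]
  have bij: "bij_betw (\<phi>0 A) (hom1 C A Z) (hom1 C A Z')"
    "bij_betw (\<phi>1 A) (Ar (hom_cat C A Z)) (Ar (hom_cat C A Z'))" if "groupoid_obj C A" for A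
    using natural_iso_on_gpdD(1)[OF n that] unfolding cat_iso_def by auto
  obtain h where h: "h \<in> hom1 C Z Z'"
    "\<And>A f. groupoid_obj C A \<Longrightarrow> f \<in> hom1 C A Z \<Longrightarrow> f \<odot> h = \<phi>0 A f"
    "\<And>A \<alpha>. groupoid_obj C A \<Longrightarrow> \<alpha> \<in> Ar (hom_cat C A Z) \<Longrightarrow> \<alpha> \<lhd> h = \<phi>1 A \<alpha>"
    using natural_iso_on_gpd_induced[OF n K] by blast
  obtain k where k: "k \<in> hom1 C Z' Z"
    "\<And>A f. groupoid_obj C A \<Longrightarrow> f \<in> hom1 C A Z' \<Longrightarrow> f \<odot> k = inv_into (hom1 C A Z) (\<phi>0 A) f"
    "\<And>A \<alpha>. groupoid_obj C A \<Longrightarrow> \<alpha> \<in> Ar (hom_cat C A Z') \<Longrightarrow>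
       \<alpha> \<lhd> k = inv_into (Ar (hom_cat C A Z)) (\<phi>1 A) \<alpha>"
    using natural_iso_on_gpd_induced[OF natural_iso_on_gpd_inverse[OF n Z] K'] by blast
  have g: "groupoid_obj C (obj0 K)" "groupoid_obj C (obj1 K)" "groupoid_obj C (obj0 K')" "groupoid_obj C (obj1 K')"
    using K(1) K'(1) unfolding internal_typed_def by blast+
  have \<gamma>: "\<gamma> \<in> hom1 C (obj0 K) Z" "\<gamma>01 \<in> Ar (hom_cat C (obj1 K) Z)"
    and \<gamma>': "\<gamma>' \<in> hom1 C (obj0 K') Z'" "\<gamma>01' \<in> Ar (hom_cat C (obj1 K') Z')"
    using classifies_typed[OF K(3)] classifies_typed[OF K'(3)] by auto
  have "\<gamma> \<odot> h \<in> hom1 C (obj0 K) Z'" "\<gamma>01 \<lhd> h \<in> Ar (hom_cat C (obj1 K) Z')"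
    using \<gamma> h(1) by simp_all
  then have "(\<gamma> \<odot> h) \<odot> k = \<gamma>" "(\<gamma>01 \<lhd> h) \<lhd> k = \<gamma>01"
    using k(2)[OF g(1)] k(3)[OF g(2)] h(2)[OF g(1) \<gamma>(1)] h(3)[OF g(2) \<gamma>(2)]
      bij_betw_inv_into_left[OF bij(1)[OF g(1)] \<gamma>(1)] bij_betw_inv_into_left[OF bij(2)[OF g(2)] \<gamma>(2)]
    by simp_all
  then have hk': "\<gamma> \<odot> (h \<odot> k) = \<gamma> \<odot> id1 C Z" "\<gamma>01 \<lhd> (h \<odot> k) = \<gamma>01 \<lhd> id1 C Z"
    using \<gamma> h(1) k(1) by simp_all
  have hk: "h \<odot> k = id1 C Z"
    by (rule strict_quotient_inj[OF K(2) _ _ hk']) (use h(1) k(1) Z in simp_all)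
  have "\<gamma>' \<odot> k \<in> hom1 C (obj0 K') Z" "\<gamma>01' \<lhd> k \<in> Ar (hom_cat C (obj1 K') Z)"
    using \<gamma>' k(1) by simp_all
  then have "(\<gamma>' \<odot> k) \<odot> h = \<gamma>'" "(\<gamma>01' \<lhd> k) \<lhd> h = \<gamma>01'"
    using h(2)[OF g(3)] h(3)[OF g(4)] k(2)[OF g(3) \<gamma>'(1)] k(3)[OF g(4) \<gamma>'(2)]
      bij_betw_inv_into_right[OF bij(1)[OF g(3)] \<gamma>'(1)] bij_betw_inv_into_right[OF bij(2)[OF g(4)] \<gamma>'(2)]
    by simp_all
  then have kh': "\<gamma>' \<odot> (k \<odot> h) = \<gamma>' \<odot> id1 C Z'" "\<gamma>01' \<lhd> (k \<odot> h) = \<gamma>01' \<lhd> id1 C Z'"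
    using \<gamma>' h(1) k(1) by simp_all
  have kh: "k \<odot> h = id1 C Z'"
    by (rule strict_quotient_inj[OF K'(2) _ _ kh']) (use h(1) k(1) Z' in simp_all)
  have "inverse_arrows (und_cat C) k h"
    unfolding inverse_arrows_def und_cat_simps using hk kh h(1) k(1) by simp
  then show ?thesis unfolding isomorphic_def invertible_def using k(1) by blast
qed

text \<open>Puts an arbitrary \<open>Y\<close>, for which no opposition is given, under the
  hypotheses of \<open>natural_iso_on_gpd_isomorphic\<close>.\<close>

lemma groupoidant_presentation:
  assumes "groupoidant C" "Y \<in> Obj C"
  obtains K \<gamma> \<gamma>01 where "internal_typed K" "strict_quotient C K Y \<gamma> \<gamma>01" "classifies K Y \<gamma> \<gamma>01"
  using nerve_exists[of Y] nerve_classifies assms unfolding groupoidant_def by blast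

end

lemma op_internal_op_internal: "op_internal (op_internal K) = (K :: ('o, 'm) internal)"
  by (simp add: op_internal_def)

lemma cat_iso_op: "cat_iso D E F \<Longrightarrow> cat_iso (op_cat D) (op_cat E) F"
  unfolding cat_iso_def is_functor_def by (auto simp: hom_def)

lemma op_cat_op_cat: "op_cat (op_cat (hom_cat C A X)) = hom_cat C A X"
  by (simp add: op_cat_def hom_cat_def)

section \<open>Strict naturality and uniqueness for a given opposition\<close>

context opposed
begin

abbreviation "\<Theta> \<equiv> opp_functor C X X' K \<gamma> \<gamma>01 \<gamma>' \<gamma>01'"

lemma \<Theta>_eq: "\<Theta> A = (op_cat (hom_cat C A X), hom_cat C A X',
    (restrict om (hom1 C A X), restrict oc (Ar (hom_cat C A X))))"
  unfolding opp_functor_def by simp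

lemma \<Theta>_invertible:
  assumes A: "groupoid_obj C A"
  shows "\<Theta> A \<in> Mor Cat" "invertible (und_cat Cat) (\<Theta> A)"
proof -
  have c: "category (hom_cat C A X)" "category (hom_cat C A X')"
    using category_hom_cat groupoid_obj_Obj[OF A] obj_typed by blast+
  have "cat_iso (op_cat (hom_cat C A X)) (hom_cat C A X')
      (restrict om (hom1 C A X), restrict oc (Ar (hom_cat C A X)))"
    by (rule cat_iso_cong[OF opp_cat_iso[OF A] category_op[OF c(1)]]) simp_all
  from Cat_invertibleI[OF this category_op[OF c(1)] c(2)]
  show "\<Theta> A \<in> Mor Cat" "invertible (und_cat Cat) (\<Theta> A)"
    unfolding \<Theta>_eq by simp_all
qed

lemma \<Theta>_natural_mor:
  assumes f: "f \<in> Mor (gpd C)"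
  shows "comp_cat_mor (op_cat_mor (repr_mor C X f)) (\<Theta> (dom1 C f)) = comp_cat_mor (\<Theta> (cod1 C f)) (repr_mor C X' f)"
proof -
  have f': "f \<in> Mor C" "groupoid_obj C (cod1 C f)" "groupoid_obj C (dom1 C f)" using f by auto
  have "om (f \<odot> g) = f \<odot> om g" "om g \<in> hom1 C (cod1 C f) X'" if "g \<in> hom1 C (cod1 C f) X" for g
    using opp_mor_precomp[OF f'(2,3) _ that] opp_mor_hom1[OF f'(2) that] f' by simp_all
  moreover have "oc (f \<rhd> \<alpha>) = f \<rhd> oc \<alpha>" "oc \<alpha> \<in> Ar (hom_cat C (cod1 C f) X')"
    if "\<alpha> \<in> Ar (hom_cat C (cod1 C f) X)" for \<alpha>
    using opp_cell_precomp[OF f'(2,3) _ that] bij_betw_apply[OF opp_cell_bij[OF f'(2)] that] f' by simp_all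
  ultimately show ?thesis
    using f'(1) unfolding \<Theta>_eq repr_mor_eq by (auto simp: restrict_def fun_eq_iff)
qed

text \<open>Whiskering in \<open>Cat\<close> is horizontal composition with an identity, which
  leaves an identity factor on each side. Apart from these the components agree by
  \<open>opp_cell_inv_whisker\<close>, and the source and target functors by naturality in
  1-cells.\<close>

lemma \<Theta>_natural_cell:
  assumes \<sigma>: "\<sigma> \<in> Cell (gpd C)"
  shows "rwhisker Cat (op_repr2 X \<sigma>) (\<Theta> (dom1 C (dom2 C \<sigma>))) = lwhisker Cat (\<Theta> (cod1 C (dom2 C \<sigma>))) (repr2 X' \<sigma>)"
proof -
  let ?A = "cod1 C (dom2 C \<sigma>)" and ?B = "dom1 C (dom2 C \<sigma>)"
  note i = inv_cell_gpd[OF \<sigma>]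
  have \<sigma>': "\<sigma> \<in> Cell C" "groupoid_obj C ?A" "groupoid_obj C ?B" using \<sigma> by auto
  have dc: "dom2 C \<sigma> \<in> Mor (gpd C)" "cod2 C \<sigma> \<in> Mor (gpd C)" using \<sigma>' by auto
  have L: "rwhisker Cat (op_repr2 X \<sigma>) (\<Theta> ?B) =
      (comp_cat_mor (op_cat_mor (repr_mor C X (dom2 C \<sigma>))) (\<Theta> ?B),
       comp_cat_mor (op_cat_mor (repr_mor C X (cod2 C \<sigma>))) (\<Theta> ?B),
       restrict (\<lambda>g. id2 C (om (dom2 C \<sigma> \<odot> g)) \<bullet> oc (inv_cell C \<sigma> \<lhd> g)) (hom1 C ?A X))"
    using \<sigma>'(1) i unfolding op_repr2_def i(1) repr2_def rwhisker_def \<Theta>_eq repr_mor_eq repr_cell_def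
    by (auto simp: restrict_def fun_eq_iff simp del: inverse_arrows_vert)
  have R: "lwhisker Cat (\<Theta> ?A) (repr2 X' \<sigma>) =
      (comp_cat_mor (\<Theta> ?A) (repr_mor C X' (dom2 C \<sigma>)), comp_cat_mor (\<Theta> ?A) (repr_mor C X' (cod2 C \<sigma>)),
       restrict (\<lambda>g. \<sigma> \<lhd> om g \<bullet> cod2 C \<sigma> \<rhd> id2 C (om g)) (hom1 C ?A X))"
    using \<sigma>'(1) opp_mor_hom1[OF \<sigma>'(2)] unfolding repr2_def lwhisker_def \<Theta>_eq repr_mor_eq repr_cell_def
    by (auto simp: restrict_def fun_eq_iff)
  have "id2 C (om (dom2 C \<sigma> \<odot> g)) \<bullet> oc (inv_cell C \<sigma> \<lhd> g) = \<sigma> \<lhd> om g \<bullet> cod2 C \<sigma> \<rhd> id2 C (om g)"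
    if g: "g \<in> hom1 C ?A X" for g
    using opp_mor_precomp[OF \<sigma>'(2,3) _ g, of "dom2 C \<sigma>"] opp_cell_inv_whisker[OF \<sigma>'(2,1) refl \<sigma>'(3) g]
      opp_mor_hom1[OF \<sigma>'(2) g] \<sigma>'(1) by simp
  then show ?thesis
    unfolding L R using \<Theta>_natural_mor[OF dc(1)] \<Theta>_natural_mor[OF dc(2)] \<sigma>'(1)
    by (auto simp: restrict_def fun_eq_iff simp del: comp_cat_mor.simps)
qed

lemma opp_functor_natural_iso: "strict_natural_iso (op_tcat (gpd C)) Cat (op_repr C X) (repr C X') \<Theta>"
proof -
  have \<Theta>_dc: "dom1 Cat (\<Theta> A) = op_cat (hom_cat C A X)" "cod1 Cat (\<Theta> A) = hom_cat C A X'" for A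
    by (simp_all add: \<Theta>_eq)
  show ?thesis
    using two_functor_op_repr[OF obj_typed(1)] two_functor_repr[OF obj_typed(2)]
      \<Theta>_invertible \<Theta>_natural_mor \<Theta>_natural_cell \<Theta>_dc
    unfolding op_repr_eq repr_eq strict_natural_iso.simps op_tcat_simps hom1_iff Cat_simps(7)
    unfolding gpd_simps(1,4,5,8) by blast
qed

text \<open>\<open>op_internal\<close> is an involution, so the two quotients can trade roles. The
  reversed opposition supplies the operation from morphisms into \<open>X'\<close> back to morphisms
  into \<open>X\<close>.\<close>

lemma opposed_sym: "opposed C X' X (op_internal K) \<gamma>' \<gamma> \<gamma>01' \<gamma>01"
proof
  show "opposition C X' X (op_internal K) \<gamma>' \<gamma>01' \<gamma> \<gamma>01"
    unfolding opposition_def op_internal_op_internal using complete_congruence_op[OF complete_K] quotient_X quotient_X' by blast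
qed (rule groupoidant)

text \<open>The components of \<open>\<theta>\<close> start from opposite categories. Preceding them
  by the operation of the reversed opposition, itself contravariant, gives an isomorphism between
  the representables of \<open>X'\<close> and \<open>Y\<close>, to which the Yoneda argument
  applies.\<close>

lemma opposite_unique:
  assumes \<theta>: "strict_natural_iso (op_tcat (gpd C)) Cat (op_repr C X) (repr C Y) \<theta>" and Y: "Y \<in> Obj C"
  shows "isomorphic C Y X'"
proof -
  interpret sym: opposed C X' X "op_internal K" \<gamma>' \<gamma> \<gamma>01' \<gamma>01 by (rule opposed_sym)
  define T where "T = (\<lambda>A. snd (snd (\<theta> A)))"
  have \<theta>': "\<theta> A \<in> hom1 Cat (op_cat (hom_cat C A X)) (hom_cat C A Y)" "invertible (und_cat Cat) (\<theta> A)"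
    if "groupoid_obj C A" for A
    using \<theta> that unfolding op_repr_eq repr_eq strict_natural_iso.simps by auto
  have \<theta>_eq: "\<theta> A = (op_cat (hom_cat C A X), hom_cat C A Y, T A)" if "groupoid_obj C A" for A
    using \<theta>'(1)[OF that] unfolding T_def by (cases "\<theta> A") simp
  have T: "cat_iso (op_cat (hom_cat C A X)) (hom_cat C A Y) (T A)" if "groupoid_obj C A" for A
    using \<theta>'(2)[OF that] unfolding \<theta>_eq[OF that] by (rule Cat_invertibleD)
  have nat: "fst (T B) (k \<odot> f) = k \<odot> fst (T A) f" "\<alpha> \<in> Ar (hom_cat C A X) \<Longrightarrow> snd (T B) (k \<rhd> \<alpha>) = k \<rhd> snd (T A) \<alpha>"
    if A: "groupoid_obj C A" and B: "groupoid_obj C B" and k: "k \<in> hom1 C B A" and f: "f \<in> hom1 C A X" for A B k f \<alpha>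
  proof -
    have "k \<in> Mor (gpd C)" using A B k by simp
    then have "comp_cat_mor (op_cat_mor (repr_mor C X k)) (\<theta> (dom1 C k)) = comp_cat_mor (\<theta> (cod1 C k)) (repr_mor C Y k)"
      using \<theta> unfolding op_repr_eq repr_eq strict_natural_iso.simps op_tcat_simps Cat_simps(7) gpd_simps(4,5) by blast
    then have "comp_cat_mor (op_cat_mor (repr_mor C X k)) (op_cat (hom_cat C B X), hom_cat C B Y, T B) =
        comp_cat_mor (op_cat (hom_cat C A X), hom_cat C A Y, T A) (repr_mor C Y k)"
      using k \<theta>_eq[OF A] \<theta>_eq[OF B] by simp
    note eq = this[unfolded repr_mor_eq]
    have bij: "bij_betw (fst (T A)) (hom1 C A X) (hom1 C A Y)"
      "bij_betw (snd (T A)) (Ar (hom_cat C A X)) (Ar (hom_cat C A Y))"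
      using T[OF A] unfolding cat_iso_def by simp_all
    have TA: "fst (T A) f \<in> hom1 C A Y" by (rule bij_betw_apply[OF bij(1) f])
    \<comment> \<open>Equality of morphisms of \<open>Cat\<close> is equality of restricted
      functions; it may be evaluated at \<open>f\<close> because \<open>f\<close> and its image lie
      in the carriers.\<close>
    have "restrict (\<lambda>x. fst (T B) (restrict ((\<odot>) k) (hom1 C A X) x)) (hom1 C A X) =
        restrict (\<lambda>x. restrict ((\<odot>) k) (hom1 C A Y) (fst (T A) x)) (hom1 C A X)"
      using eq k by simp
    from fun_cong[OF this, of f] show "fst (T B) (k \<odot> f) = k \<odot> fst (T A) f"
      using f TA by simp
    assume \<alpha>: "\<alpha> \<in> Ar (hom_cat C A X)"
    have TA: "snd (T A) \<alpha> \<in> Ar (hom_cat C A Y)"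
      by (rule bij_betw_apply[OF bij(2) \<alpha>])
    have "restrict (\<lambda>x. snd (T B) (restrict ((\<rhd>) k) (Ar (hom_cat C A X)) x)) (Ar (hom_cat C A X)) =
        restrict (\<lambda>x. restrict ((\<rhd>) k) (Ar (hom_cat C A Y)) (snd (T A) x)) (Ar (hom_cat C A X))"
      using eq k by simp
    from fun_cong[OF this, of \<alpha>] show "snd (T B) (k \<rhd> \<alpha>) = k \<rhd> snd (T A) \<alpha>"
      using \<alpha> TA by (simp only: restrict_apply')
  qed
  have om: "sym.om f \<in> hom1 C A X" if "groupoid_obj C A" "f \<in> hom1 C A X'" for A f
    by (rule sym.opp_mor_hom1[OF that])
  have oc: "sym.oc \<alpha> \<in> Ar (hom_cat C A X)" if "groupoid_obj C A" "\<alpha> \<in> Ar (hom_cat C A X')" for A \<alpha>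
    by (rule bij_betw_apply[OF sym.opp_cell_bij[OF that(1)] that(2)])
  have "natural_iso_on_gpd X' Y (\<lambda>A f. fst (T A) (sym.om f)) (\<lambda>A \<alpha>. snd (T A) (sym.oc \<alpha>))"
    unfolding natural_iso_on_gpd_def
  proof (intro conjI allI impI ballI)
    fix A assume A: "groupoid_obj C A"
    \<comment> \<open>Taking opposites on both sides moves the contravariance from source to target,
      where \<open>T A\<close> absorbs it.\<close>
    have "cat_iso (hom_cat C A X') (op_cat (hom_cat C A X)) (sym.om, sym.oc)"
      using cat_iso_op[OF sym.opp_cat_iso[OF A]] by (simp only: op_cat_op_cat)
    from cat_iso_comp[OF this T[OF A]]
    show "cat_iso (hom_cat C A X') (hom_cat C A Y) (\<lambda>f. fst (T A) (sym.om f), \<lambda>\<alpha>. snd (T A) (sym.oc \<alpha>))"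
      by simp
  next
    fix A B k f assume A: "groupoid_obj C A" and B: "groupoid_obj C B" and k: "k \<in> hom1 C B A"
      and f: "f \<in> hom1 C A X'"
    show "fst (T B) (sym.om (k \<odot> f)) = k \<odot> fst (T A) (sym.om f)"
      unfolding sym.opp_mor_precomp[OF A B k f] by (rule nat(1)[OF A B k om[OF A f]])
  next
    fix A B k \<alpha> assume A: "groupoid_obj C A" and B: "groupoid_obj C B" and k: "k \<in> hom1 C B A"
      and \<alpha>: "\<alpha> \<in> Ar (hom_cat C A X')"
    have "dom2 C (sym.oc \<alpha>) \<in> hom1 C A X" using oc[OF A \<alpha>] by simp
    from nat(2)[OF A B k this oc[OF A \<alpha>]]
    show "snd (T B) (sym.oc (k \<rhd> \<alpha>)) = k \<rhd> snd (T A) (sym.oc \<alpha>)"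
      unfolding sym.opp_cell_precomp[OF A B k \<alpha>] .
  qed
  moreover obtain L \<delta> \<delta>01 where "internal_typed L" "strict_quotient C L Y \<delta> \<delta>01" "classifies L Y \<delta> \<delta>01"
    using groupoidant_presentation[OF groupoidant Y] by blast
  ultimately show ?thesis
    using natural_iso_on_gpd_isomorphic sym.internal_typed_K quotient_X' classifies_X' by blast
qed

end

theorem proposition6p3p5:
  fixes C :: "('o, 'm, 'c) tcat"
    and X Xop :: 'o
    and K :: "('o, 'm) internal"
    and \<gamma> \<gamma>op :: 'm
    and \<gamma>01 \<gamma>op01 :: 'c
  assumes "groupoidant C"
    and "X \<in> Obj C" and "Xop \<in> Obj C"
    and "opposition C X Xop K \<gamma> \<gamma>01 \<gamma>op \<gamma>op01"
  shows "(\<forall>A. groupoid_obj C A \<longrightarrow>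
            cat_iso (op_cat (hom_cat C A X)) (hom_cat C A Xop)
              (opp_mor C K \<gamma> \<gamma>op, opp_cell C K \<gamma>01 \<gamma>op01)) \<and>
         strict_natural_iso (op_tcat (gpd C)) Cat (op_repr C X) (repr C Xop)
           (opp_functor C X Xop K \<gamma> \<gamma>01 \<gamma>op \<gamma>op01) \<and>
         (\<forall>Y\<in>Obj C.
            (\<exists>\<theta>. strict_natural_iso (op_tcat (gpd C)) Cat (op_repr C X) (repr C Y) \<theta>) \<longrightarrow>
            isomorphic C Y Xop)"
proof -
  interpret opposed C X Xop K \<gamma> \<gamma>op \<gamma>01 \<gamma>op01
    using assms by unfold_locales (auto simp: groupoidant_def)
  show ?thesis using opp_cat_iso opp_functor_natural_iso opposite_unique by blast
qed

end
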